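(* Let $n\ge1$, $0\le k\le n/2$, let $1\le d\le n/2$ and $s=1-2d/n$. Let $\Omega$ be a nonempty finite set of valid triples (for $n,k$) that is connected in the positive-weight box-transfer graph. For a positive profile $w=(w_\omega)_{\omega\in\Omega}$ put $$\lambda_\Omega(w)=\min_{\nu\in\Omega}\frac{\sum_{\omega\in\Omega}p_{\omega,\nu}w_\omega}{w_\nu},\qquad \mathcal D_\Omega(w)=\frac{(\sum_{\omega\in\Omega}w_\omega)^2}{\sum_{\omega\in\Omega}w_\omega^2/D_\omega}.$$ For every positive profile $w$ with $\lambda_\Omega(w)>s$, $$A_2(n,d)\le\frac{1-s}{d_k\,(\lambda_\Omega(w)-s)}\,\mathcal D_\Omega(w).$$ In particular, if $v$ is the positive unit Perron vector of $J_\Omega$, $\Lambda_\Omega=\lambda_{\max}(J_\Omega)$, and $\Lambda_\Omega>s$, then $$A_2(n,d)\le\frac{1-s}{d_k(\Lambda_\Omega-s)}\Big(\sum_{\omega\in\Omega}\sqrt{D_\omega}\,v_\omega\Big)^2\le\frac{1-s}{d_k(\Lambda_\Omega-s)}\sum_{\omega\in\Omega}D_\omega.$$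
   Context: $A_2(n,d)$ is the largest size of a subset of $\{\pm1\}^n$ in which any two distinct words differ in at least $d$ coordinates. $f^\theta$ is the dimension of the Specht module of the partition $\theta$ (number of standard Young tableaux), $f^\varnothing=1$; $d_k=f^{(n-k,k)}=\binom nk-\binom n{k-1}$ (with $\binom n{-1}=0$). A triple of nonnegative integers $\omega=(i,j,\ell)$ is valid if $i\le n$, $2j\le n-i$, $2\ell\le i$, and with $A_0=n-i-2j$, $B_0=i-2\ell$, $E_0=n-2k$ one has $|A_0-B_0|\le E_0\le A_0+B_0$. Put $D_\omega=\binom nif^{(n-i-j,j)}f^{(i-\ell,\ell)}$. Directed weights: for valid $\omega=(i,j,\ell)$ and valid $\omega'=(i+1,j-\sigma,\ell+\tau)$ with $\sigma,\tau\in\{0,1\}$, let $\lambda=(n-i-j,j)$, $\mu=(i-\ell,\ell)$, $\lambda'=(n-i-1-(j-\sigma),j-\sigma)$, $\mu'=(i+1-(\ell+\tau),\ell+\tau)$, $$a=\tfrac{n-i-1}2-(j-\sigma),\ c=\tfrac{n-i}2-j,\ d_0=\tfrac i2-\ell,\ f=\tfrac{i+1}2-(\ell+\tau),\ e=\tfrac n2-k,$$ $$R_{\sigma\tau}=\sqrt{(2c+1)(2f+1)}\begin{Bmatrix}a&\frac12&c\\ d_0&e&f\end{Bmatrix}\quad\text{(Wigner $6j$ symbol)},$$ $$p_{\omega,\omega'}=\frac{n-i}n\frac{f^{\lambda'}}{f^\lambda}R_{\sigma\tau}^2,\qquad p_{\omega',\omega}=\frac{i+1}n\frac{f^\mu}{f^{\mu'}}R_{\sigma\tau}^2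 .$$ All other $p_{\omega,\omega'}$ are $0$. The positive-weight box-transfer graph has the valid triples as vertices, with $\omega,\omega'$ joined when these weights are nonzero. $J_\Omega$ is the symmetric matrix indexed by $\Omega$ with entries $(J_\Omega)_{\omega,\omega'}=\sqrt{p_{\omega,\omega'}p_{\omega',\omega}}$. A positive profile is a vector with all entries $w_\omega>0$. *)

theory Defs
  imports Complex_Main "HOL-Library.FuncSet"
begin

section \<open>Binary codes\<close>

definition words :: "nat \<Rightarrow> (nat \<Rightarrow> int) set" where
  "words n = {..<n} \<rightarrow>\<^sub>E {-1, 1}"

definition hamming :: "nat \<Rightarrow> (nat \<Rightarrow> int) \<Rightarrow> (nat \<Rightarrow> int) \<Rightarrow> nat" where
  "hamming n x y = card {i. i < n \<and> x i \<noteq> y i}"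

definition A2 :: "nat \<Rightarrow> nat \<Rightarrow> nat" where
  "A2 n d = Max (card ` {C. C \<subseteq> words n \<and> (\<forall>x\<in>C. \<forall>y\<in>C. x \<noteq> y \<longrightarrow> d \<le> hamming n x y)})"

section \<open>Dimensions of Specht modules\<close>

text \<open>A partition is given by the list of its parts in weakly decreasing order;
  trailing zero parts are allowed and do not affect the diagram.\<close>

definition young_diagram :: "nat list \<Rightarrow> (nat \<times> nat) set" where
  "young_diagram \<theta> = {(r, c). r < length \<theta> \<and> c < \<theta> ! r}"

definition standard_tableaux :: "nat list \<Rightarrow> (nat \<times> nat \<Rightarrow> nat) set" where
  "standard_tableaux \<theta> =
    {T \<in> extensional (young_diagram \<theta>).
       bij_betw T (young_diagram \<theta>) {1..sum_list \<theta>} \<and>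
       (\<forall>r c. (r, Suc c) \<in> young_diagram \<theta> \<longrightarrow> T (r, c) < T (r, Suc c)) \<and>
       (\<forall>r c. (Suc r, c) \<in> young_diagram \<theta> \<longrightarrow> T (r, c) < T (Suc r, c))}"

definition specht_dim :: "nat list \<Rightarrow> nat" where
  "specht_dim \<theta> = card (standard_tableaux \<theta>)"

section \<open>Wigner 6j symbols\<close>

text \<open>Spins are nonnegative half-integers, represented as reals. The symbol is given by Racah's
  single-sum formula and is zero unless all four triads are admissible. When they are, every
  argument of \<open>rfact\<close> below is a nonnegative integer.\<close>

definition rfact :: "real \<Rightarrow> real" where
  "rfact x = fact (nat \<lfloor>x\<rfloor>)"

definition spin :: "real \<Rightarrow> bool" where
  "spin x \<longleftrightarrow> 0 \<le> x \<and> 2 * x \<in> \<int>"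

definition triad :: "real \<Rightarrow> real \<Rightarrow> real \<Rightarrow> bool" where
  "triad a b c \<longleftrightarrow> spin a \<and> spin b \<and> spin c \<and> a + b + c \<in> \<int> \<and> \<bar>a - b\<bar> \<le> c \<and> c \<le> a + b"

definition triangle_coeff :: "real \<Rightarrow> real \<Rightarrow> real \<Rightarrow> real" where
  "triangle_coeff a b c =
     sqrt (rfact (a + b - c) * rfact (a - b + c) * rfact (- a + b + c) / rfact (a + b + c + 1))"

definition wigner6j :: "real \<Rightarrow> real \<Rightarrow> real \<Rightarrow> real \<Rightarrow> real \<Rightarrow> real \<Rightarrow> real" where
  "wigner6j j1 j2 j3 j4 j5 j6 =
    (if triad j1 j2 j3 \<and> triad j1 j5 j6 \<and> triad j4 j2 j6 \<and> triad j4 j5 j3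
     then triangle_coeff j1 j2 j3 * triangle_coeff j1 j5 j6 *
          triangle_coeff j4 j2 j6 * triangle_coeff j4 j5 j3 *
          (\<Sum>t \<in> {t :: nat.
                    j1 + j2 + j3 \<le> real t \<and> j1 + j5 + j6 \<le> real t \<and>
                    j4 + j2 + j6 \<le> real t \<and> j4 + j5 + j3 \<le> real t \<and>
                    real t \<le> j1 + j2 + j4 + j5 \<and> real t \<le> j2 + j3 + j5 + j6 \<and>
                    real t \<le> j3 + j1 + j6 + j4}.
             (-1) ^ t * fact (t + 1) /
               (rfact (t - j1 - j2 - j3) * rfact (t - j1 - j5 - j6) *
                rfact (t - j4 - j2 - j6) * rfact (t - j4 - j5 - j3) *
                rfact (j1 + j2 + j4 + j5 - t) * rfact (j2 + j3 + j5 + j6 - t) *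
                rfact (j3 + j1 + j6 + j4 - t)))
     else 0)"

section \<open>Valid triples and box-transfer weights\<close>

type_synonym triple = "nat \<times> nat \<times> nat"

fun valid :: "nat \<Rightarrow> nat \<Rightarrow> triple \<Rightarrow> bool" where
  "valid n k (i, j, l) \<longleftrightarrow>
     i \<le> n \<and> 2 * j \<le> n - i \<and> 2 * l \<le> i \<and>
     (let A0 = int n - int i - 2 * int j; B0 = int i - 2 * int l; E0 = int n - 2 * int k
      in \<bar>A0 - B0\<bar> \<le> E0 \<and> E0 \<le> A0 + B0)"

fun dim_left :: "nat \<Rightarrow> triple \<Rightarrow> nat" where
  "dim_left n (i, j, l) = specht_dim [n - i - j, j]"

fun dim_right :: "triple \<Rightarrow> nat" where
  "dim_right (i, j, l) = specht_dim [i - l, l]"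

fun mult_dim :: "nat \<Rightarrow> triple \<Rightarrow> real" where
  "mult_dim n (i, j, l) = real (n choose i) * real (dim_left n (i, j, l)) * real (dim_right (i, j, l))"

text \<open>\<open>up_step (i, j, l) (i', j', l')\<close> says \<open>i' = i + 1\<close>, \<open>j' = j - \<sigma>\<close>, \<open>l' = l + \<tau>\<close> with
  \<open>\<sigma>, \<tau> \<in> {0, 1}\<close>, avoiding truncated subtraction. The arguments of \<open>coupling\<close> are written in terms
  of \<open>i', j', l'\<close> accordingly.\<close>

fun up_step :: "nat \<Rightarrow> nat \<Rightarrow> triple \<Rightarrow> triple \<Rightarrow> bool" where
  "up_step n k (i, j, l) (i', j', l') \<longleftrightarrow>
     valid n k (i, j, l) \<and> valid n k (i', j', l') \<and> i' = i + 1 \<and>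
     (\<exists>\<sigma>\<in>{0, 1}. \<exists>\<tau>\<in>{0, 1}. j = j' + \<sigma> \<and> l' = l + \<tau>)"

fun coupling :: "nat \<Rightarrow> nat \<Rightarrow> triple \<Rightarrow> triple \<Rightarrow> real" where
  "coupling n k (i, j, l) (i', j', l') =
     (let a = (real n - real i') / 2 - real j';
          c = (real n - real i) / 2 - real j;
          d0 = real i / 2 - real l;
          f = real i' / 2 - real l';
          e = real n / 2 - real k
      in sqrt ((2 * c + 1) * (2 * f + 1)) * wigner6j a (1/2) c d0 e f)"

definition weight :: "nat \<Rightarrow> nat \<Rightarrow> triple \<Rightarrow> triple \<Rightarrow> real" where
  "weight n k \<omega> \<nu> =
    (if up_step n k \<omega> \<nu> then
       (real n - real (fst \<omega>)) / real n * (real (dim_left n \<nu>) / real (dim_left n \<omega>))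
         * (coupling n k \<omega> \<nu>)\<^sup>2
     else if up_step n k \<nu> \<omega> then
       real (fst \<omega>) / real n * (real (dim_right \<nu>) / real (dim_right \<omega>))
         * (coupling n k \<nu> \<omega>)\<^sup>2
     else 0)"

definition box_edges :: "nat \<Rightarrow> nat \<Rightarrow> (triple \<times> triple) set" where
  "box_edges n k = {(\<omega>, \<nu>). valid n k \<omega> \<and> valid n k \<nu> \<and> weight n k \<omega> \<nu> \<noteq> 0 \<and> weight n k \<nu> \<omega> \<noteq> 0}"

definition box_connected :: "nat \<Rightarrow> nat \<Rightarrow> triple set \<Rightarrow> bool" where
  "box_connected n k \<Omega> \<longleftrightarrow> (\<forall>\<omega>\<in>\<Omega>. \<forall>\<nu>\<in>\<Omega>. (\<omega>, \<nu>) \<in> (box_edges n k \<inter> \<Omega> \<times> \<Omega>)\<^sup>*)"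

section \<open>Profiles and the matrix of a set of triples\<close>

definition positive_profile :: "triple set \<Rightarrow> (triple \<Rightarrow> real) \<Rightarrow> bool" where
  "positive_profile \<Omega> w \<longleftrightarrow> (\<forall>\<omega>\<in>\<Omega>. w \<omega> > 0)"

definition profile_rate :: "nat \<Rightarrow> nat \<Rightarrow> triple set \<Rightarrow> (triple \<Rightarrow> real) \<Rightarrow> real" where
  "profile_rate n k \<Omega> w = Min ((\<lambda>\<nu>. (\<Sum>\<omega>\<in>\<Omega>. weight n k \<omega> \<nu> * w \<omega>) / w \<nu>) ` \<Omega>)"

definition profile_dim :: "nat \<Rightarrow> triple set \<Rightarrow> (triple \<Rightarrow> real) \<Rightarrow> real" where
  "profile_dim n \<Omega> w = (\<Sum>\<omega>\<in>\<Omega>. w \<omega>)\<^sup>2 / (\<Sum>\<omega>\<in>\<Omega>. (w \<omega>)\<^sup>2 / mult_dim n \<omega>)"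

definition J :: "nat \<Rightarrow> nat \<Rightarrow> triple \<Rightarrow> triple \<Rightarrow> real" where
  "J n k \<omega> \<nu> = sqrt (weight n k \<omega> \<nu> * weight n k \<nu> \<omega>)"

definition J_eigenpair :: "nat \<Rightarrow> nat \<Rightarrow> triple set \<Rightarrow> real \<Rightarrow> (triple \<Rightarrow> real) \<Rightarrow> bool" where
  "J_eigenpair n k \<Omega> x u \<longleftrightarrow>
     (\<exists>\<omega>\<in>\<Omega>. u \<omega> \<noteq> 0) \<and> (\<forall>\<omega>\<in>\<Omega>. (\<Sum>\<nu>\<in>\<Omega>. J n k \<omega> \<nu> * u \<nu>) = x * u \<omega>)"

definition J_lambda_max :: "nat \<Rightarrow> nat \<Rightarrow> triple set \<Rightarrow> real" where
  "J_lambda_max n k \<Omega> = Max {x. \<exists>u. J_eigenpair n k \<Omega> x u}"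

definition positive_unit_perron :: "nat \<Rightarrow> nat \<Rightarrow> triple set \<Rightarrow> (triple \<Rightarrow> real) \<Rightarrow> bool" where
  "positive_unit_perron n k \<Omega> v \<longleftrightarrow>
     J_eigenpair n k \<Omega> (J_lambda_max n k \<Omega>) v \<and>
     (\<forall>\<omega>\<in>\<Omega>. v \<omega> > 0) \<and> (\<Sum>\<omega>\<in>\<Omega>. (v \<omega>)\<^sup>2) = 1"

end

theory Submission
  imports Defs "HOL-Combinatorics.Transposition" "HOL-Computational_Algebra.Polynomial"
begin

text \<open>
  In the chain of \<open>n\<close> spins one half, permuted by the symmetric group, the Specht module of \<open>(n - k, k)\<close>
  tensored with a multiplicity space is the eigenspace of the total Casimir operator for spin \<open>n/2 - k\<close>.
  For a set \<open>S\<close> of \<open>i\<close> sites and a triple \<open>\<omega> = (i, j, l)\<close>, let \<open>P\<^sub>S\<^sub>,\<^sub>\<omega>\<close> be the projection of this eigenspace onto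
  the part where the complement of \<open>S\<close> and \<open>S\<close> itself have spin \<open>(n - i)/2 - j\<close> and \<open>i/2 - l\<close>. Moving one site gives
  \<open>\<Sum>\<^sub>t P\<^sub>S\<^sub>\<triangle>\<^sub>t\<^sub>,\<^sub>\<omega> = n \<Sum>\<^sub>\<nu> p\<^sub>\<nu>\<^sub>,\<^sub>\<omega> P\<^sub>S\<^sub>,\<^sub>\<nu>\<close>; since a spectral projection of the Casimir operator of an enlarged or reduced
  set is linear in the added transpositions, this follows from a few sums of products of transpositions.

  Put \<open>M\<^sub>S = \<Sum>\<^sub>\<omega> (w\<^sub>\<omega> / D\<^sub>\<omega>) P\<^sub>S\<^sub>,\<^sub>\<omega>\<close>. By detailed balance, \<open>\<Sum>\<^sub>t M\<^sub>S\<^sub>\<triangle>\<^sub>t - n \<lambda> M\<^sub>S\<close> is a nonnegative combination of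
  projections. For a code \<open>C\<close> with characters \<open>\<chi>\<^sub>S\<close>, the kernel \<open>G x y = tr ((\<Sum>\<^sub>S \<chi>\<^sub>S(x) \<chi>\<^sub>S(y) M\<^sub>S)\<^sup>2)\<close> is nonnegative, so in
  \<open>\<Sum>\<^sub>x\<^sub>,\<^sub>y (\<langle>x, y\<rangle> / n - s) G x y\<close> only the diagonal contributes positively, and it is explicit because \<open>\<Sum>\<^sub>S M\<^sub>S\<close> is a scalar
  on the eigenspace. Expanding in characters bounds the same sum below by \<open>(\<lambda> - s) |C|\<^sup>2 \<Sum>\<^sub>S tr (M\<^sub>S\<^sup>2)\<close>.
\<close>

section \<open>Operators on a chain of spins\<close>

text \<open>Schur's lemma is replaced by counting. That the cells of one triple sum over all
  \<open>S\<close> to a scalar on the eigenspace is proved by induction on the size of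
  \<open>S\<close>: adding a site expresses level \<open>i + 1\<close> through level
  \<open>i\<close>, detailed balance reverses the weights, and the reversed weights out of a triple
  at level \<open>i + 1\<close> have total \<open>(i + 1) / n\<close>. The scalar
  \<open>D / d_k\<close> comes out of this induction, which starts from \<open>D = d_k\<close> at
  the empty set; dimensions of representations are never compared with counts of tableaux. The trace
  of the projection onto the eigenspace is a common factor of both bounds on the final sum, so only
  its positivity has to be known, and a product of singlets supplies it. The 6j symbols are not
  interpreted as recoupling coefficients either: the weights and the coefficients of the moves are
  brought to the same rational function of signed spins. The division by \<open>D\<close> in
  \<open>M_S\<close> adapts the rate condition to the operators: by detailed balance,
  \<open>\<Sum> p_{\<omega>,\<nu>} w_\<omega> \<ge> \<lambda> w_\<nu>\<close> becomes
  \<open>\<Sum> p_{\<nu>,\<omega>} u_\<omega> \<ge> \<lambda> u_\<nu>\<close> for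
  \<open>u = w / D\<close>.\<close>

text \<open>A basis vector of the chain is indexed by the set of its down spins. The chain is infinite, so that the
  operators form a single ring for all \<open>n\<close>.\<close>

typedef operator = "{f :: (nat set \<Rightarrow> real) \<Rightarrow> nat set \<Rightarrow> real.
    (\<forall>g h. f (\<lambda>A. g A + h A) = (\<lambda>A. f g A + f h A)) \<and> (\<forall>c g. f (\<lambda>A. c * g A) = (\<lambda>A. c * f g A))}"
  morphisms app Operator
  by (rule exI[of _ "\<lambda>g A. 0"]) auto

setup_lifting type_definition_operator

lemma app_add: "app x (\<lambda>A. g A + h A) A = app x g A + app x h A"
  and app_scale: "app x (\<lambda>A. c * g A) A = c * app x g A"
  using app[of x] by (auto simp: fun_eq_iff)

lemma operator_eqI: "(\<And>g A. app x g A = app y g A) \<Longrightarrow> x = y"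
  by (simp add: app_inject[symmetric] fun_eq_iff)

instantiation operator :: real_algebra_1
begin
lift_definition zero_operator :: operator is "\<lambda>g A. 0" by auto
lift_definition one_operator :: operator is "\<lambda>g. g" by auto
lift_definition plus_operator :: "operator \<Rightarrow> operator \<Rightarrow> operator" is "\<lambda>x y g A. x g A + y g A"
  by (auto simp: fun_eq_iff algebra_simps)
lift_definition uminus_operator :: "operator \<Rightarrow> operator" is "\<lambda>x g A. - x g A"
  by (auto simp: fun_eq_iff algebra_simps)
lift_definition minus_operator :: "operator \<Rightarrow> operator \<Rightarrow> operator" is "\<lambda>x y g A. x g A - y g A"
  by (auto simp: fun_eq_iff algebra_simps)
lift_definition times_operator :: "operator \<Rightarrow> operator \<Rightarrow> operator" is "\<lambda>x y g. x (y g)"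
  by simp
lift_definition scaleR_operator :: "real \<Rightarrow> operator \<Rightarrow> operator" is "\<lambda>c x g A. c * x g A"
  by (auto simp: fun_eq_iff algebra_simps)
instance
proof
  show "(0::operator) \<noteq> 1"
    by transfer (auto simp: fun_eq_iff intro!: exI[of _ "\<lambda>_. 1::real"])
qed (transfer; auto simp: fun_eq_iff algebra_simps)+
end

lemma app_simps [simp]:
  "app 0 g A = 0" "app 1 g A = g A" "app (x + y) g A = app x g A + app y g A"
  "app (- x) g A = - app x g A" "app (x - y) g A = app x g A - app y g A"
  "app (x * y) g A = app x (app y g) A" "app (c *\<^sub>R x) g A = c * app x g A"
  by (transfer; simp)+

lemma app_of_real [simp]: "app (of_real c) g A = c * g A"
  by (simp add: of_real_def)

lemma app_uminus: "app x (\<lambda>A. - g A) A = - app x g A"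
  using app_scale[of x "-1" g A] by simp

lemma app_diff: "app x (\<lambda>A. g A - h A) A = app x g A - app x h A"
  using app_add[of x g "\<lambda>A. - h A" A] by (simp add: app_uminus)

lemma app_sum [simp]: "app (sum f I) g A = (\<Sum>i\<in>I. app (f i) g A)"
  by (induction I rule: infinite_finite_induct) auto

lemma app_of_nat [simp]: "app (of_nat k) g A = real k * g A"
  by (induction k) (auto simp: algebra_simps)

lemma app_numeral [simp]: "app (numeral k) g A = numeral k * g A"
  using app_of_nat[of "numeral k" g A] by simp

lemma app_zero_fun [simp]: "app x (\<lambda>A. 0) A = 0"
  using app_scale[of x 0 "\<lambda>_. 0" A] by simp

lemma app_sum_fun: "app x (\<lambda>A. \<Sum>i\<in>I. c i * f i A) A = (\<Sum>i\<in>I. c i * app x (f i) A)"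
  by (induction I rule: infinite_finite_induct) (auto simp: app_add app_scale)

lift_definition tau :: "nat \<Rightarrow> nat \<Rightarrow> operator" is "\<lambda>a b g A. g (transpose a b ` A)" by auto
text \<open>Operators act on amplitudes, so the value at \<open>A\<close> is read off at
  \<open>insert a A\<close>: on basis vectors this turns a down spin at \<open>a\<close> up and
  kills an up spin.\<close>

lift_definition raise :: "nat \<Rightarrow> operator" is "\<lambda>a g A. if a \<in> A then 0 else g (insert a A)" by auto
lift_definition lower :: "nat \<Rightarrow> operator" is "\<lambda>a g A. if a \<in> A then g (A - {a}) else 0" by auto
lift_definition spinz :: "nat \<Rightarrow> operator" is "\<lambda>a g A. (if a \<in> A then - (1/2) else 1/2) * g A"
  by (auto simp: fun_eq_iff algebra_simps)

lemma app_basic [simp]: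
  "app (tau a b) g A = g (transpose a b ` A)"
  "app (raise a) g A = (if a \<in> A then 0 else g (insert a A))"
  "app (lower a) g A = (if a \<in> A then g (A - {a}) else 0)"
  "app (spinz a) g A = (if a \<in> A then - (1/2) else 1/2) * g A"
  by (transfer; simp)+

lemma tau_commute: "tau a b = tau b a"
  by (rule operator_eqI) (simp add: transpose_commute)

lemma tau_same [simp]: "tau a a = 1"
  by (rule operator_eqI) simp

lemma tau_square [simp]: "tau a b * tau a b = 1"
  by (rule operator_eqI) (simp add: image_comp)

lemma tau_conj: "tau a b * tau c d = tau (transpose a b c) (transpose a b d) * tau a b"
proof (rule operator_eqI)
  fix g :: "nat set \<Rightarrow> real" and A
  have "transpose c d \<circ> transpose a b = transpose a b \<circ> transpose (transpose a b c) (transpose a b d)"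
    using transpose_comp_eq[of "transpose a b" c d] by simp
  then show "app (tau a b * tau c d) g A = app (tau (transpose a b c) (transpose a b d) * tau a b) g A"
    by (simp only: app_simps app_basic image_comp)
qed

text \<open>The antisymmetrizer on three tensor factors of a two-dimensional space vanishes.\<close>

lemma tau_three:
  assumes "a \<noteq> b" "a \<noteq> t" "b \<noteq> t"
  shows "tau a t * tau b t + tau b t * tau a t = tau a b + tau a t + tau b t - 1"
proof (rule operator_eqI)
  fix g :: "nat set \<Rightarrow> real" and A
  have c: "transpose b t \<circ> transpose a t = transpose a t \<circ> transpose a b"
    "transpose b t \<circ> transpose a t = transpose a b \<circ> transpose b t"
    "transpose a t \<circ> transpose b t = transpose b t \<circ> transpose a b"
    "transpose a t \<circ> transpose b t = transpose a b \<circ> transpose a t"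
    using assms by (auto simp: fun_eq_iff transpose_def)
  have c1: "transpose b t ` transpose a t ` A = transpose a t ` transpose a b ` A"
    "transpose b t ` transpose a t ` A = transpose a b ` transpose b t ` A"
    "transpose a t ` transpose b t ` A = transpose b t ` transpose a b ` A"
    "transpose a t ` transpose b t ` A = transpose a b ` transpose a t ` A"
    unfolding image_comp using c by simp_all
  \<comment> \<open>Pigeonhole: there are two spin values, so two of the three sites agree in
    \<open>A\<close> and their transposition fixes \<open>A\<close>. The matching rewriting in
    \<open>c1\<close> pairs off the remaining terms.\<close>
  consider "a \<in> A \<longleftrightarrow> b \<in> A" | "a \<in> A \<longleftrightarrow> t \<in> A" | "b \<in> A \<longleftrightarrow> t \<in> A" by blast
  then have "g (transpose b t ` transpose a t ` A) + g (transpose a t ` transpose b t ` A)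
      = g (transpose a b ` A) + g (transpose a t ` A) + g (transpose b t ` A) - g A"
  proof cases
    case 1
    then have "transpose a b ` A = A" by simp
    then show ?thesis unfolding c1(1,3) by simp
  next
    case 2
    then have "transpose a t ` A = A" by simp
    then show ?thesis unfolding c1(4) by simp
  next
    case 3
    then have "transpose b t ` A = A" by simp
    then show ?thesis unfolding c1(2) by simp
  qed
  then show "app (tau a t * tau b t + tau b t * tau a t) g A = app (tau a b + tau a t + tau b t - 1) g A"
    by (simp only: app_simps app_basic)
qed

text \<open>Dirac's exchange identity: the left side is twice the inner product of the two spin
  vectors. It links the permutation action to the ladder operators.\<close>

lemma tau_raise_lower:
  assumes "a \<noteq> b"
  shows "raise a * lower b + lower a * raise b + 2 * (spinz a * spinz b) = tau a b - of_real (1/2)"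
proof (rule operator_eqI)
  fix g :: "nat set \<Rightarrow> real" and A
  have 1: "transpose a b ` A = insert b (A - {a})" if "a \<in> A" "b \<notin> A"
    using that assms by (auto simp: transpose_def image_iff split: if_splits)
  have 2: "transpose a b ` A = insert a A - {b}" if "a \<notin> A" "b \<in> A"
    using that assms by (auto simp: transpose_def image_iff split: if_splits)
  have 3: "transpose a b ` A = A" if "a \<in> A \<longleftrightarrow> b \<in> A"
    using that by simp
  show "app (raise a * lower b + lower a * raise b + 2 * (spinz a * spinz b)) g A = app (tau a b - of_real (1/2)) g A"
    using assms 1 2 3 by (cases "a \<in> A"; cases "b \<in> A") (auto simp: mult_2 insert_absorb)
qed

lemma raise_lower_same: "raise a * lower a + lower a * raise a + 2 * (spinz a * spinz a) = of_real (3/2)"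
proof (rule operator_eqI)
  fix g :: "nat set \<Rightarrow> real" and A
  show "app (raise a * lower a + lower a * raise a + 2 * (spinz a * spinz a)) g A = app (of_real (3/2)) g A"
    by (cases "a \<in> A") (simp_all add: insert_absorb)
qed

lemma raise_lower_commutator:
  "raise a * lower b - lower b * raise a = (if a = b then 2 * spinz a else 0)"
proof (rule operator_eqI)
  fix g :: "nat set \<Rightarrow> real" and A
  have "insert a A - {b} = insert a (A - {b})" if "a \<noteq> b"
    using that by auto
  then show "app (raise a * lower b - lower b * raise a) g A = app (if a = b then 2 * spinz a else 0) g A"
    by (cases "a \<in> A"; cases "b \<in> A"; cases "a = b") (simp_all add: insert_absorb)
qed

text \<open>The scalars make the eigenvalue for spin \<open>j\<close> equal to \<open>j (j + 1)\<close>; the terms with \<open>a = b\<close> are \<open>1\<close>.\<close>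

definition casimir :: "nat set \<Rightarrow> operator" where
  "casimir S = (1/2) *\<^sub>R (\<Sum>a\<in>S. \<Sum>b\<in>S. tau a b) + of_real (real (card S) * (2 - real (card S)) / 4)"

text \<open>Subtracting the scalar makes this twice the inner product of the total spin of
  \<open>S\<close> with the spin at \<open>t\<close>.\<close>

definition link :: "nat set \<Rightarrow> nat \<Rightarrow> operator" where
  "link S t = (\<Sum>a\<in>S. tau a t) - of_real (real (card S) / 2)"

lemma casimir_empty [simp]: "casimir {} = 0"
  by (simp add: casimir_def)

text \<open>The square of a sum of two spin vectors; \<open>3/4\<close> is the Casimir value of the
  single spin one half.\<close>

lemma casimir_insert:
  assumes "finite S" "t \<notin> S"
  shows "casimir (insert t S) = casimir S + of_real (3/4) + link S t"
proof -
  have "(\<Sum>a\<in>insert t S. \<Sum>b\<in>insert t S. tau a b) = (\<Sum>a\<in>S. \<Sum>b\<in>S. tau a b) + 2 *\<^sub>R (\<Sum>a\<in>S. tau a t) + 1"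
    using assms by (simp add: sum.distrib tau_commute[of t] scaleR_2)
  then show ?thesis
    using assms unfolding casimir_def link_def
    by (intro operator_eqI) (simp del: app_sum sum.insert add: field_simps)
qed

text \<open>On spin \<open>j\<close> the link takes the values \<open>j\<close> and
  \<open>- j - 1\<close>, according to whether the new site raises or lowers the spin. The identity
  comes from symmetrizing the square of the sum of transpositions, so that \<open>tau_three\<close>
  reduces it to single transpositions.\<close>

lemma link_quadratic:
  assumes "finite S" "t \<notin> S"
  shows "link S t * (link S t + 1) = casimir S"
proof -
  let ?J = "\<Sum>a\<in>S. tau a t" and ?m = "real (card S)"
  have "2 *\<^sub>R (?J * ?J) = (\<Sum>a\<in>S. \<Sum>b\<in>S. tau a t * tau b t) + (\<Sum>a\<in>S. \<Sum>b\<in>S. tau b t * tau a t)"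
    by (simp add: sum_product scaleR_2) (rule sum.swap)
  also have "\<dots> = (\<Sum>a\<in>S. \<Sum>b\<in>S. tau a t * tau b t + tau b t * tau a t)"
    by (simp add: sum.distrib)
  \<comment> \<open>\<open>tau_three\<close> requires distinct sites. For \<open>a = b\<close> the
    product term is \<open>2\<close> while its right side is \<open>2 * tau a t\<close>, which
    explains the correction.\<close>
  also have "\<dots> = (\<Sum>a\<in>S. \<Sum>b\<in>S. tau a b + tau a t + tau b t - 1 + (if a = b then 2 - 2 * tau a t else 0))"
  proof (intro sum.cong refl)
    fix a b assume "a \<in> S" "b \<in> S"
    then show "tau a t * tau b t + tau b t * tau a t =
        tau a b + tau a t + tau b t - 1 + (if a = b then 2 - 2 * tau a t else 0)"
      using assms tau_three[of a b t] by (cases "a = b") (auto simp: mult_2)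
  qed
  also have "\<dots> = (\<Sum>a\<in>S. \<Sum>b\<in>S. tau a b) + ((2 * ?m) *\<^sub>R ?J - of_real (?m * ?m)) + (of_real (2 * ?m) - 2 *\<^sub>R ?J)"
  proof -
    have 1: "(\<Sum>b\<in>S. if a = b then 2 - 2 * tau a t else 0) = 2 - 2 *\<^sub>R tau a t" if "a \<in> S" for a
      using that assms by (simp add: mult_2 scaleR_2)
    have 2: "(\<Sum>a\<in>S. 2 - 2 *\<^sub>R tau a t) = of_real (2 * ?m) - 2 *\<^sub>R ?J"
      by (rule operator_eqI) (simp add: sum_subtractf sum_distrib_left)
    have 3: "(\<Sum>a\<in>S. \<Sum>b\<in>S. tau a t + tau b t - 1) = (2 * ?m) *\<^sub>R ?J - of_real (?m * ?m)"
      by (rule operator_eqI) (simp add: sum_subtractf sum.distrib flip: sum_distrib_left)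
    have "(\<Sum>a\<in>S. \<Sum>b\<in>S. tau a b + tau a t + tau b t - 1 + (if a = b then 2 - 2 * tau a t else 0))
        = (\<Sum>a\<in>S. \<Sum>b\<in>S. tau a b + (tau a t + tau b t - 1) + (if a = b then 2 - 2 * tau a t else 0))"
      by (intro sum.cong refl) (simp add: add_diff_eq add.assoc)
    also have "\<dots> = (\<Sum>a\<in>S. \<Sum>b\<in>S. tau a b) + (\<Sum>a\<in>S. \<Sum>b\<in>S. tau a t + tau b t - 1)
        + (\<Sum>a\<in>S. \<Sum>b\<in>S. if a = b then 2 - 2 * tau a t else 0)"
      by (simp only: sum.distrib)
    also have "(\<Sum>a\<in>S. \<Sum>b\<in>S. if a = b then 2 - 2 * tau a t else 0) = (\<Sum>a\<in>S. 2 - 2 *\<^sub>R tau a t)"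
      by (intro sum.cong refl 1)
    finally show ?thesis unfolding 2 3 .
  qed
  finally have J2: "2 *\<^sub>R (?J * ?J) = (\<Sum>a\<in>S. \<Sum>b\<in>S. tau a b) + ((2 * ?m) *\<^sub>R ?J - of_real (?m * ?m)) + (of_real (2 * ?m) - 2 *\<^sub>R ?J)" .
  define J where "J = ?J"
  define X where "X = (\<Sum>a\<in>S. \<Sum>b\<in>S. tau a b)"
  have "link S t * (link S t + 1) = (1/2) *\<^sub>R (2 *\<^sub>R (J * J)) + (1 - ?m) *\<^sub>R J + of_real (?m * ?m / 4 - ?m / 2)"
    unfolding link_def J_def[symmetric]
    by (rule operator_eqI) (simp add: of_real_def app_add app_diff app_scale field_simps)
  also have "\<dots> = casimir S"
    unfolding J2[folded J_def X_def] casimir_def X_def[symmetric]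
    by (rule operator_eqI) (simp add: field_simps)
  finally show ?thesis .
qed

section \<open>Spectrum of the Casimir operators\<close>

lemma tau_casimir:
  assumes "a \<in> S \<longleftrightarrow> b \<in> S"
  shows "tau a b * casimir S = casimir S * tau a b"
proof -
  have bij: "bij_betw (transpose a b) S S" using assms by simp
  have "tau a b * (\<Sum>c\<in>S. \<Sum>d\<in>S. tau c d)
      = (\<Sum>c\<in>S. \<Sum>d\<in>S. tau (transpose a b c) (transpose a b d)) * tau a b"
    unfolding sum_distrib_left sum_distrib_right by (intro sum.cong refl tau_conj)
  also have "(\<Sum>c\<in>S. \<Sum>d\<in>S. tau (transpose a b c) (transpose a b d)) = (\<Sum>c\<in>S. \<Sum>d\<in>S. tau c d)"
    by (subst sum.reindex_bij_betw[OF bij, of "\<lambda>c. \<Sum>d\<in>S. tau c (transpose a b d)"])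
      (intro sum.cong refl sum.reindex_bij_betw[OF bij])
  finally show ?thesis
    by (simp add: casimir_def distrib_left distrib_right of_real_def)
qed

lemma casimir_commute:
  assumes "S \<subseteq> S' \<or> S \<inter> S' = {}"
  shows "casimir S * casimir S' = casimir S' * casimir S"
proof -
  have "(\<Sum>a\<in>S. \<Sum>b\<in>S. tau a b) * casimir S' = casimir S' * (\<Sum>a\<in>S. \<Sum>b\<in>S. tau a b)"
    unfolding sum_distrib_left sum_distrib_right using assms
    by (intro sum.cong refl tau_casimir) auto
  then show ?thesis
    unfolding casimir_def[of S] by (simp add: distrib_left distrib_right of_real_def)
qed

text \<open>The symmetric form shows positivity; the form with the raising operator on the right
  evaluates the Casimir operator on vectors killed by raising.\<close>

lemma casimir_ladder:
  assumes "finite S"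
  defines "R \<equiv> \<Sum>a\<in>S. raise a" and "L \<equiv> \<Sum>a\<in>S. lower a" and "Z \<equiv> \<Sum>a\<in>S. spinz a"
  shows "casimir S = (1/2) *\<^sub>R (R * L + L * R) + Z * Z"
    and "casimir S = L * R + Z * Z + Z"
proof -
  have "(\<Sum>a\<in>S. \<Sum>b\<in>S. raise a * lower b + lower a * raise b + 2 * (spinz a * spinz b))
      = (\<Sum>a\<in>S. \<Sum>b\<in>S. tau a b - of_real (1/2) + (if a = b then 1 else 0))"
  proof (intro sum.cong refl)
    fix a b
    show "raise a * lower b + lower a * raise b + 2 * (spinz a * spinz b)
        = tau a b - of_real (1/2) + (if a = b then 1 else 0)"
    proof (cases "a = b")
      case True
      have "(of_real (3/2) :: operator) = 1 - of_real (1/2) + 1"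
        by (rule operator_eqI) simp
      with True show ?thesis using raise_lower_same[of a] by simp
    next
      case False
      then show ?thesis using tau_raise_lower by simp
    qed
  qed
  also have "\<dots> = (\<Sum>a\<in>S. \<Sum>b\<in>S. tau a b) - of_real (real (card S) * real (card S) / 2) + of_nat (card S)"
    using assms(1) by (intro operator_eqI) (simp add: sum_subtractf sum.distrib)
  also have "(\<Sum>a\<in>S. \<Sum>b\<in>S. raise a * lower b + lower a * raise b + 2 * (spinz a * spinz b))
      = R * L + L * R + 2 *\<^sub>R (Z * Z)"
    unfolding R_def L_def Z_def sum_product by (simp add: sum.distrib scaleR_sum_right scaleR_2 mult_2)
  finally have eq: "(\<Sum>a\<in>S. \<Sum>b\<in>S. tau a b) = R * L + L * R + 2 *\<^sub>R (Z * Z)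
      + of_real (real (card S) * real (card S) / 2) - of_nat (card S)"
    by (simp add: algebra_simps)
  show 1: "casimir S = (1/2) *\<^sub>R (R * L + L * R) + Z * Z"
    unfolding casimir_def eq by (rule operator_eqI) (simp add: field_simps)
  have "R * L - L * R = (\<Sum>a\<in>S. \<Sum>b\<in>S. raise a * lower b - lower b * raise a)"
  proof -
    have "L * R = (\<Sum>a\<in>S. \<Sum>b\<in>S. lower b * raise a)"
      unfolding L_def R_def sum_product by (rule sum.swap)
    then show ?thesis unfolding R_def L_def sum_product by (simp add: sum_subtractf)
  qed
  also have "\<dots> = 2 *\<^sub>R Z"
    using assms(1) unfolding raise_lower_commutator Z_def
    by (simp add: scaleR_2 mult_2 sum.distrib)
  finally have "R * L = L * R + 2 *\<^sub>R Z" by (simp add: algebra_simps)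
  then show "casimir S = L * R + Z * Z + Z"
    unfolding 1 by (intro operator_eqI) (simp add: field_simps)
qed

section \<open>Positivity of the Casimir operator and its consequence for spin zero\<close>

lemma raise_adjoint:
  assumes "finite S" "a \<in> S"
  shows "(\<Sum>A\<in>Pow S. h A * app (raise a) g A) = (\<Sum>A\<in>Pow S. app (lower a) h A * g A)"
proof -
  have "(\<Sum>A\<in>Pow S. h A * app (raise a) g A) = (\<Sum>A\<in>{A\<in>Pow S. a \<notin> A}. h A * g (insert a A))"
    using assms(1) by (intro sum.mono_neutral_cong_right) auto
  also have "\<dots> = (\<Sum>A\<in>{A\<in>Pow S. a \<in> A}. h (A - {a}) * g A)"
    using assms(2) by (intro sum.reindex_bij_witness[of _ "\<lambda>A. A - {a}" "insert a"]) (auto simp: insert_absorb)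
  also have "\<dots> = (\<Sum>A\<in>Pow S. app (lower a) h A * g A)"
    using assms(1) by (intro sum.mono_neutral_cong_left) auto
  finally show ?thesis .
qed

text \<open>Raising and lowering are transposes of each other and \<open>Z\<close> is diagonal, so
  the quadratic form is a combination of squared norms.\<close>

lemma casimir_nonneg:
  assumes "finite S"
  shows "0 \<le> (\<Sum>A\<in>Pow S. g A * app (casimir S) g A)"
proof -
  define R where "R = (\<Sum>a\<in>S. raise a)"
  define L where "L = (\<Sum>a\<in>S. lower a)"
  define Z where "Z = (\<Sum>a\<in>S. spinz a)"
  have RL: "(\<Sum>A\<in>Pow S. h A * app R f A) = (\<Sum>A\<in>Pow S. app L h A * f A)" for h f
  proof -
    have "(\<Sum>A\<in>Pow S. h A * app R f A) = (\<Sum>a\<in>S. \<Sum>A\<in>Pow S. h A * app (raise a) f A)"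
      unfolding R_def app_sum sum_distrib_left by (rule sum.swap)
    also have "\<dots> = (\<Sum>a\<in>S. \<Sum>A\<in>Pow S. app (lower a) h A * f A)"
      using assms by (intro sum.cong refl raise_adjoint)
    also have "\<dots> = (\<Sum>A\<in>Pow S. app L h A * f A)"
      unfolding L_def app_sum sum_distrib_right by (rule sum.swap)
    finally show ?thesis .
  qed
  have Z: "app Z h A = (\<Sum>a\<in>S. if a \<in> A then -(1/2) else 1/2) * h A" for h A
    unfolding Z_def app_sum by (simp add: sum_distrib_right)
  have "(\<Sum>A\<in>Pow S. g A * app (casimir S) g A)
     = 1/2 * ((\<Sum>A\<in>Pow S. g A * app R (app L g) A) + (\<Sum>A\<in>Pow S. app L (app R g) A * g A))
      + (\<Sum>A\<in>Pow S. g A * app Z (app Z g) A)"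
    unfolding casimir_ladder(1)[OF assms, folded R_def L_def Z_def]
    by (simp add: sum_distrib_left sum.distrib[symmetric] field_simps del: app_sum)
  also have "\<dots> = 1/2 * ((\<Sum>A\<in>Pow S. app L g A * app L g A) + (\<Sum>A\<in>Pow S. app R g A * app R g A))
      + (\<Sum>A\<in>Pow S. app Z g A * app Z g A)"
    unfolding RL[of g "app L g"] RL[of "app R g" g, symmetric] by (simp add: Z mult_ac)
  also have "\<dots> \<ge> 0" by (intro add_nonneg_nonneg mult_nonneg_nonneg[of "1/2"] sum_nonneg zero_le_square) auto
  finally show ?thesis .
qed

text \<open>Sites outside \<open>S\<close> are spectators. This cuts a vector of the infinite chain
  into slices indexed by \<open>Pow S\<close>, where positivity is available.\<close>

lemma casimir_shift:
  assumes "A \<subseteq> S" "B \<inter> S = {}"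
  shows "app (casimir S) g (B \<union> A) = app (casimir S) (\<lambda>C. g (B \<union> C)) A"
proof -
  have "transpose a b ` (B \<union> A) = B \<union> transpose a b ` A" if "a \<in> S" "b \<in> S" for a b
  proof -
    have "transpose a b ` B = B" using that assms by (intro transpose_image_eq) auto
    then show ?thesis by (simp add: image_Un)
  qed
  then show ?thesis by (simp add: casimir_def)
qed

lemma casimir_no_negative_eigenvalue:
  assumes "finite S" "casimir S * x = c *\<^sub>R x" "c < 0"
  shows "x = 0"
proof (rule operator_eqI)
  fix g A
  define h where "h = app x g"
  define B where "B = A - S"
  define f where "f = (\<lambda>C. h (B \<union> C))"
  have eig: "app (casimir S) h C = c * h C" for C
    using arg_cong[OF assms(2), of "\<lambda>y. app y g C"] by (simp add: h_def)
  have "app (casimir S) f C = c * f C" if "C \<subseteq> S" for C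
    using casimir_shift[OF that, of B h] eig[of "B \<union> C"] unfolding f_def B_def by (simp add: Int_commute)
  then have "(\<Sum>C\<in>Pow S. f C * app (casimir S) f C) = c * (\<Sum>C\<in>Pow S. f C * f C)"
    unfolding sum_distrib_left by (intro sum.cong refl) auto
  with casimir_nonneg[OF assms(1), of f] have "(\<Sum>C\<in>Pow S. f C * f C) \<le> 0"
    using assms(3) by (simp add: zero_le_mult_iff)
  moreover have "(\<Sum>C\<in>Pow S. f C * f C) \<ge> 0" by (intro sum_nonneg) auto
  ultimately have "\<forall>C\<in>Pow S. f C * f C = 0"
    using assms(1) by (subst sum_nonneg_eq_0_iff[symmetric]) auto
  then have "f (A \<inter> S) = 0" by auto
  moreover have "B \<union> A \<inter> S = A" unfolding B_def by auto
  ultimately show "app x g A = app 0 g A" by (simp add: f_def h_def)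
qed

lemma link_casimir:
  assumes "finite S" "t \<notin> S"
  shows "link S t * casimir S = casimir S * link S t"
  unfolding link_quadratic[OF assms, symmetric] by (simp add: algebra_simps)

text \<open>Spin zero and spin one half can only combine to spin one half. The quadratic relation
  alone would still allow the link value \<open>-1\<close>; that value would give the enlarged set
  the Casimir value \<open>3/4 - 1 < 0\<close>, which positivity excludes.\<close>

lemma link_spin_zero:
  assumes "finite S" "t \<notin> S" "casimir S * y = 0"
  shows "link S t * y = 0"
proof (rule casimir_no_negative_eigenvalue[of "insert t S"])
  have 1: "casimir S * (link S t * y) = 0"
    using assms link_casimir[OF assms(1,2)] by (metis mult.assoc mult_zero_right)
  have "link S t * (link S t * y) + link S t * y = 0"
    using assms(3) unfolding link_quadratic[OF assms(1,2), symmetric] by (simp add: algebra_simps)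
  then have 2: "link S t * (link S t * y) = - (link S t * y)"
    by (simp add: eq_neg_iff_add_eq_0)
  show "casimir (insert t S) * (link S t * y) = (-1/4) *\<^sub>R (link S t * y)"
    unfolding casimir_insert[OF assms(1,2)] distrib_right 1 2
    by (rule operator_eqI) simp
qed (use assms in auto)

section \<open>Polynomials evaluated in an algebra, and spectral projections\<close>

definition peval :: "real poly \<Rightarrow> 'a::real_algebra_1 \<Rightarrow> 'a" where
  "peval p x = fold_coeffs (\<lambda>a y. of_real a + x * y) p 0"

lemma peval_0 [simp]: "peval 0 x = 0"
  by (simp add: peval_def)

lemma peval_pCons [simp]: "peval (pCons a p) x = of_real a + x * peval p x"
  by (cases "p = 0 \<and> a = 0") (auto simp: peval_def)

lemma peval_1 [simp]: "peval 1 x = 1"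
  by (simp add: one_pCons)

lemma peval_add: "peval (p + q) x = peval p x + peval q x"
  by (induction p q rule: poly_induct2) (auto simp: algebra_simps)

lemma peval_smult: "peval (smult c p) x = c *\<^sub>R peval p x"
  by (induction p) (auto simp: scaleR_add_right of_real_def)

lemma peval_diff: "peval (p - q) x = peval p x - peval q x"
  using peval_add[of "p - q" q x] by (simp add: algebra_simps)

lemma peval_commute: "x * y = y * x \<Longrightarrow> peval p x * y = y * peval p x"
proof (induction p)
  case (pCons a p)
  then show ?case
    using mult.assoc[of x y "peval p x"] mult.assoc[of y x "peval p x"] mult.assoc[of x "peval p x" y]
    by (simp add: distrib_left distrib_right mult.assoc of_real_def)
qed simp

lemma peval_mult: "peval (p * q) x = peval p x * peval q x"
  by (induction p) (auto simp: peval_add peval_smult distrib_right mult.assoc of_real_def)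

lemma peval_sum: "peval (sum f I) x = (\<Sum>i\<in>I. peval (f i) x)"
  by (induction I rule: infinite_finite_induct) (auto simp: peval_add)

text \<open>The total spin of \<open>m\<close> sites that is paired with the partition
  \<open>(m - l, l)\<close>.\<close>

definition spin_of :: "nat \<Rightarrow> nat \<Rightarrow> real" where
  "spin_of m l = real m / 2 - real l"

definition eigval :: "nat \<Rightarrow> nat \<Rightarrow> real" where
  "eigval m l = spin_of m l * (spin_of m l + 1)"

lemma spin_of_nonneg: "2 * l \<le> m \<Longrightarrow> 0 \<le> spin_of m l"
  unfolding spin_of_def by (simp add: field_simps flip: of_nat_mult)

lemma spin_quadratic_inj:
  fixes x y :: real
  assumes "x * (x + 1) = y * (y + 1)" "0 \<le> x" "0 \<le> y"
  shows "x = y"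
proof -
  have "(x - y) * (x + y + 1) = 0" using assms(1) by (simp add: algebra_simps)
  then show ?thesis using assms(2,3) by auto
qed

lemma eigval_inj: "eigval m l = eigval m l' \<Longrightarrow> 2 * l \<le> m \<Longrightarrow> 2 * l' \<le> m \<Longrightarrow> l = l'"
  unfolding eigval_def
  by (drule spin_quadratic_inj) (auto intro: spin_of_nonneg simp: spin_of_def)

lemma eigval_Suc:
  "eigval (Suc m) l = (spin_of m l + 1/2) * (spin_of m l + 3/2)"
  "eigval (Suc m) (Suc l) = (spin_of m l - 1/2) * (spin_of m l + 1/2)"
  by (simp_all add: eigval_def spin_of_def field_simps)

lemma finite_spins [simp]: "finite {l::nat. 2 * l \<le> m}"
  by (rule finite_subset[of _ "{..m}"]) auto

lemma peval_linear [simp]: "peval [:- c, 1:] x = x - of_real c"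
  by simp

lemma poly_two_roots_dvd:
  fixes p :: "real poly"
  assumes "poly p r1 = 0" "poly p r2 = 0" "r1 \<noteq> r2"
  obtains q where "p = q * ([:- r1, 1:] * [:- r2, 1:])"
proof -
  obtain p' where p': "p = [:- r1, 1:] * p'" using assms(1) by (auto simp: poly_eq_0_iff_dvd dvd_def)
  then have "poly p' r2 = 0" using assms(2,3) by simp
  then obtain q where q: "p' = [:- r2, 1:] * q" by (auto simp: poly_eq_0_iff_dvd dvd_def)
  show thesis by (rule that[of q]) (simp add: p' q mult_ac del: mult_pCons_left mult_pCons_right)
qed

definition lagrange :: "nat \<Rightarrow> nat \<Rightarrow> real poly" where
  "lagrange m l = (\<Prod>l'\<in>{l'. 2 * l' \<le> m} - {l}. smult (inverse (eigval m l - eigval m l')) [:- eigval m l', 1:])"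

lemma poly_lagrange:
  assumes "2 * l \<le> m" "2 * l' \<le> m"
  shows "poly (lagrange m l) (eigval m l') = (if l = l' then 1 else 0)"
proof (cases "l = l'")
  case True
  have "poly (smult (inverse (eigval m l - eigval m x)) [:- eigval m x, 1:]) (eigval m l) = 1"
    if "x \<in> {l'. 2 * l' \<le> m} - {l}" for x
  proof -
    have "eigval m l - eigval m x \<noteq> 0" using that assms eigval_inj[of m l x] by auto
    moreover have "poly (smult (inverse (eigval m l - eigval m x)) [:- eigval m x, 1:]) (eigval m l)
        = inverse (eigval m l - eigval m x) * (eigval m l - eigval m x)"
      by (simp add: algebra_simps)
    ultimately show ?thesis by simp
  qed
  then have "poly (lagrange m l) (eigval m l) = 1"
    unfolding lagrange_def poly_prod by (intro prod.neutral ballI)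
  with True show ?thesis by simp
next
  case False
  then show ?thesis using assms
    unfolding lagrange_def poly_prod by (auto simp: prod_zero_iff)
qed

text \<open>Being a polynomial in the Casimir operator, the projection inherits from it every
  commutation relation and the symmetry of its matrix.\<close>

definition proj :: "nat set \<Rightarrow> nat \<Rightarrow> operator" where
  "proj S l = peval (lagrange (card S) l) (casimir S)"

text \<open>Diagonalizability with the listed spectrum, phrased through annihilating polynomials:
  any two polynomials agreeing on the listed values may be exchanged, and sums and products of
  projections become interpolation identities.\<close>

definition spectral :: "nat set \<Rightarrow> bool" where
  "spectral S \<longleftrightarrow> (\<forall>p. (\<forall>l. 2 * l \<le> card S \<longrightarrow> poly p (eigval (card S) l) = 0) \<longrightarrow> peval p (casimir S) = 0)"

lemma peval_cong_spectral:
  assumes "spectral S" "\<And>l. 2 * l \<le> card S \<Longrightarrow> poly p (eigval (card S) l) = poly q (eigval (card S) l)"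
  shows "peval p (casimir S) = peval q (casimir S)"
proof -
  have "peval (p - q) (casimir S) = 0"
    using assms(1) unfolding spectral_def by (rule allE[of _ "p - q"]) (simp add: assms(2))
  then show ?thesis by (simp add: peval_diff)
qed

lemma sum_proj_spectral:
  assumes "spectral S"
  shows "(\<Sum>l | 2 * l \<le> card S. proj S l) = 1"
proof -
  have "(\<Sum>l | 2 * l \<le> card S. proj S l) = peval (\<Sum>l | 2 * l \<le> card S. lagrange (card S) l) (casimir S)"
    by (simp add: proj_def peval_sum)
  also have "\<dots> = peval 1 (casimir S)"
    by (rule peval_cong_spectral[OF assms]) (simp add: poly_sum poly_lagrange sum.delta)
  finally show ?thesis by simp
qed

lemma proj_mult_spectral:
  assumes "spectral S" "2 * l \<le> card S" "2 * l' \<le> card S"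
  shows "proj S l * proj S l' = (if l = l' then proj S l else 0)"
proof -
  have "proj S l * proj S l' = peval (lagrange (card S) l * lagrange (card S) l') (casimir S)"
    by (simp add: proj_def peval_mult)
  also have "\<dots> = peval (if l = l' then lagrange (card S) l else 0) (casimir S)"
    using assms by (intro peval_cong_spectral[OF assms(1)]) (auto simp: poly_lagrange)
  finally show ?thesis by (auto simp: proj_def)
qed

lemma casimir_proj_spectral:
  assumes "spectral S" "2 * l \<le> card S"
  shows "casimir S * proj S l = eigval (card S) l *\<^sub>R proj S l"
proof -
  have "casimir S * proj S l = peval ([:0, 1:] * lagrange (card S) l) (casimir S)"
    unfolding proj_def peval_mult by simp
  also have "\<dots> = peval (smult (eigval (card S) l) (lagrange (card S) l)) (casimir S)"
    using assms by (intro peval_cong_spectral[OF assms(1)]) (auto simp: poly_lagrange)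
  finally show ?thesis by (simp add: proj_def peval_smult)
qed

text \<open>On the part where \<open>S\<close> has spin \<open>j\<close>, the enlarged Casimir
  operator is a root of the quadratic whose zeros belong to the spins \<open>j + 1/2\<close> and
  \<open>j - 1/2\<close>. A polynomial vanishing at both is a multiple of this quadratic.\<close>

lemma spectral_insert:
  assumes S: "finite S" "t \<notin> S" "spectral S"
  shows "spectral (insert t S)"
  unfolding spectral_def
proof (intro allI impI)
  fix p assume p: "\<forall>l. 2 * l \<le> card (insert t S) \<longrightarrow> poly p (eigval (card (insert t S)) l) = 0"
  let ?m = "card S" and ?K = "casimir (insert t S)"
  have zero: "peval p ?K * proj S l = 0" if l: "2 * l \<le> ?m" for l
  proof -
    let ?j = "spin_of ?m l" and ?y = "proj S l"
    have Ky: "casimir S * ?y = of_real (?j * (?j + 1)) * ?y"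
      using casimir_proj_spectral[OF S(3) l] by (simp add: eigval_def scaleR_conv_of_real)
    have up: "poly p ((?j + 1/2) * (?j + 3/2)) = 0"
      using p[rule_format, of l] l S by (simp add: eigval_Suc)
    show ?thesis
    proof (cases "2 * l = ?m")
      case True
      \<comment> \<open>At spin zero the lower value would be \<open>-1/4\<close>, which is not
        listed. The vanishing of the link leaves \<open>3/4\<close> as the only root.\<close>
      then have j0: "?j = 0" by (simp add: spin_of_def field_simps flip: of_nat_mult)
      have "link S t * ?y = 0"
        using link_spin_zero[OF S(1,2)] Ky j0 by simp
      then have K: "(?K - of_real (3/4)) * ?y = 0"
        using Ky unfolding casimir_insert[OF S(1,2)] j0 by (simp add: algebra_simps)
      obtain q where "p = q * [:- (3/4), 1:]"
        using up j0 by (auto simp: poly_eq_0_iff_dvd dvd_def mult.commute)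
      then have "peval p ?K * ?y = peval q ?K * ((?K - of_real (3/4)) * ?y)"
        using peval_mult[of q "[:- (3/4), 1:]" ?K] peval_linear[of "3/4" ?K]
        by (simp del: peval_pCons peval_linear add: mult.assoc)
      then show ?thesis using K by simp
    next
      case False
      then have "2 * (l + 1) \<le> ?m + 1" using l by simp
      then have down: "poly p ((?j - 1/2) * (?j + 1/2)) = 0"
        using p[rule_format, of "Suc l"] S by (simp add: eigval_Suc(2))
      have "(?j + 1/2) * (?j + 3/2) - (?j - 1/2) * (?j + 1/2) = 2 * ?j + 1"
        by (simp add: algebra_simps)
      then have ne: "(?j + 1/2) * (?j + 3/2) \<noteq> (?j - 1/2) * (?j + 1/2)"
        using spin_of_nonneg[OF l] by auto
      obtain q where q: "p = q * ([:- ((?j + 1/2) * (?j + 3/2)), 1:] * [:- ((?j - 1/2) * (?j + 1/2)), 1:])"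
        using poly_two_roots_dvd[OF up down ne] .
      let ?L = "link S t"
      \<comment> \<open>On \<open>?y\<close> the two linear factors act as
        \<open>?L + (?j + 1)\<close> and \<open>?L - ?j\<close>, whose product is the relation
        \<open>link_quadratic\<close>.\<close>
      have e1: "(?K - of_real ((?j - 1/2) * (?j + 1/2))) * ?y = (?L + of_real (?j + 1)) * ?y"
        unfolding casimir_insert[OF S(1,2)] left_diff_distrib distrib_right Ky
        by (rule operator_eqI) (simp add: algebra_simps)
      have "(?K - of_real ((?j + 1/2) * (?j + 3/2))) * (?L * ?y) = ?L * ((?K - of_real ((?j + 1/2) * (?j + 3/2))) * ?y)"
        unfolding casimir_insert[OF S(1,2)]
        using link_casimir[OF S(1,2)] by (simp add: algebra_simps of_real_def) (metis mult.assoc)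
      moreover have e2: "(?K - of_real ((?j + 1/2) * (?j + 3/2))) * ?y = ?L * ?y - of_real ?j * ?y"
        unfolding casimir_insert[OF S(1,2)] left_diff_distrib distrib_right Ky
        by (rule operator_eqI) (simp add: algebra_simps)
      ultimately have e3: "(?K - of_real ((?j + 1/2) * (?j + 3/2))) * ((?L + of_real (?j + 1)) * ?y)
          = ?L * (?L * ?y - of_real ?j * ?y) + of_real (?j + 1) * (?L * ?y - of_real ?j * ?y)"
        by (simp add: distrib_right distrib_left of_real_def)
      also have "\<dots> = ?L * (?L + 1) * ?y - of_real (?j * (?j + 1)) * ?y"
        by (simp add: of_real_def algebra_simps)
      also have "\<dots> = 0" unfolding link_quadratic[OF S(1,2)] Ky by simp
      finally have "(?K - of_real ((?j + 1/2) * (?j + 3/2))) * ((?K - of_real ((?j - 1/2) * (?j + 1/2))) * ?y) = 0"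
        unfolding e1 .
      then show ?thesis
        unfolding q peval_mult peval_linear by (simp add: mult.assoc)
    qed
  qed
  have "peval p ?K = peval p ?K * (\<Sum>l | 2 * l \<le> ?m. proj S l)"
    using sum_proj_spectral[OF S(3)] by simp
  also have "\<dots> = 0" unfolding sum_distrib_left using zero by (intro sum.neutral) auto
  finally show "peval p ?K = 0" .
qed

lemma spectral: "finite S \<Longrightarrow> spectral S"
proof (induction S rule: finite_induct)
  case empty
  show ?case unfolding spectral_def
  proof (intro allI impI)
    fix p :: "real poly" assume "\<forall>l. 2 * l \<le> card {} \<longrightarrow> poly p (eigval (card {}) l) = 0"
    then have "poly p 0 = 0" by (simp add: eigval_def spin_of_def)
    then show "peval p (casimir {}) = 0" by (cases p) auto
  qed
qed (simp add: spectral_insert)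

lemmas sum_proj = sum_proj_spectral[OF spectral]
  and proj_mult = proj_mult_spectral[OF spectral]
  and casimir_proj = casimir_proj_spectral[OF spectral]

lemma proj_commute: "x * casimir S = casimir S * x \<Longrightarrow> proj S l * x = x * proj S l"
  unfolding proj_def by (rule peval_commute) simp

lemma proj_commute_proj:
  assumes "S \<subseteq> S' \<or> S \<inter> S' = {} \<or> S' \<subseteq> S"
  shows "proj S l * proj S' l' = proj S' l' * proj S l"
  using assms casimir_commute[of S S'] casimir_commute[of S' S]
  by (intro proj_commute proj_commute[symmetric]) (auto simp: Int_commute)

lemma proj_casimir_diff:
  assumes "finite S" "2 * l \<le> card S"
  shows "proj S l * ((casimir S - of_real c) * z) = (eigval (card S) l - c) *\<^sub>R (proj S l * z)"
proof -
  have "proj S l * (casimir S - of_real c) = (casimir S - of_real c) * proj S l"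
    by (rule proj_commute) (simp add: algebra_simps of_real_def)
  also have "\<dots> = (eigval (card S) l - c) *\<^sub>R proj S l"
    using casimir_proj[OF assms] by (simp add: left_diff_distrib scaleR_diff_left of_real_def)
  finally show ?thesis by (simp flip: mult.assoc)
qed

text \<open>The root \<open>r'\<close> need not be an eigenvalue, so no separate treatment of extremal spins is required.\<close>

lemma proj_two_roots:
  assumes "finite S" "2 * l \<le> card S" "eigval (card S) l = r" "r \<noteq> r'"
    and "(casimir S - of_real r) * ((casimir S - of_real r') * y) = 0"
  shows "proj S l * y = (1 / (r - r')) *\<^sub>R ((casimir S - of_real r') * y)"
proof -
  let ?K = "casimir S" and ?m = "card S"
  note K = proj_casimir_diff[OF assms(1)]
  have zero: "proj S l' * ((?K - of_real r') * y) = (if l' = l then (r - r') *\<^sub>R (proj S l * y) else 0)" if "2 * l' \<le> ?m" for l'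
  proof (cases "l' = l")
    case True
    then show ?thesis using K[OF that] assms(3) by simp
  next
    case False
    then have ne: "eigval ?m l' \<noteq> r" using eigval_inj[of ?m l' l] that assms(2,3) by auto
    have "(eigval ?m l' - r) *\<^sub>R (eigval ?m l' - r') *\<^sub>R (proj S l' * y) = 0"
      using arg_cong[OF assms(5), of "\<lambda>z. proj S l' * z"] by (simp add: K[OF that] del: scaleR_scaleR)
    then have "(eigval ?m l' - r') *\<^sub>R (proj S l' * y) = 0" using ne by simp
    then show ?thesis using False K[OF that, of r' y] by simp
  qed
  have "(?K - of_real r') * y = (\<Sum>l' | 2 * l' \<le> ?m. proj S l') * ((?K - of_real r') * y)"
    using sum_proj[OF assms(1)] by simp
  also have "\<dots> = (r - r') *\<^sub>R (proj S l * y)"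
    using assms(2) by (simp add: sum_distrib_right zero sum.delta)
  finally show ?thesis using assms(4) by simp
qed

section \<open>Moving a site\<close>

lemma of_real_times: "of_real c * x = c *\<^sub>R x" "x * of_real c = c *\<^sub>R x"
  for x :: "'a::real_algebra_1"
  by (simp_all add: of_real_def)

lemma of_nat_times: "of_nat k * x = real k *\<^sub>R x"
  for x :: "'a::real_algebra_1"
  by (simp add: scaleR_conv_of_real)

text \<open>\<open>G\<close> is twice the inner product of the total spins of \<open>S\<close> and
  \<open>U\<close>. The first two sums are linear in transpositions. The sum of products has one
  term for each pair of sites of \<open>U\<close>, and symmetrizing in that pair makes
  \<open>tau_three\<close> applicable.\<close>

lemma link_sums:
  assumes fin: "finite S" "finite U" and disj: "S \<inter> U = {}"
  defines "m \<equiv> real (card U)" and "G \<equiv> casimir (S \<union> U) - casimir S - casimir U"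
  shows sum_link_inner: "(\<Sum>t\<in>U. link (U - {t}) t) = 2 *\<^sub>R casimir U - of_real (3 * m / 2)"
    and sum_link_outer: "(\<Sum>t\<in>U. link S t) = G"
    and sum_link_prod: "(\<Sum>t\<in>U. link (U - {t}) t * link S t) = ((m - 1) / 2) *\<^sub>R G"
proof -
  define D where "D = (\<Sum>a\<in>U. \<Sum>b\<in>U. tau a b)"
  define X where "X = (\<Sum>t\<in>U. \<Sum>a\<in>S. tau a t)"
  let ?i = "real (card S)"
  have DX: "(\<Sum>a\<in>S \<union> U. \<Sum>b\<in>S \<union> U. tau a b) = (\<Sum>a\<in>S. \<Sum>b\<in>S. tau a b) + D + 2 *\<^sub>R X"
  proof -
    have "X = (\<Sum>a\<in>S. \<Sum>t\<in>U. tau a t)" unfolding X_def by (rule sum.swap)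
    moreover have "X = (\<Sum>t\<in>U. \<Sum>a\<in>S. tau t a)" unfolding X_def by (simp add: tau_commute)
    ultimately show ?thesis
      using fin disj by (simp add: sum.union_disjoint sum.distrib D_def scaleR_2)
  qed
  have cVU: "real (card (S \<union> U)) = ?i + m" using fin disj by (simp add: m_def card_Un_disjoint)
  have G: "G = X - of_real (?i * m / 2)"
    unfolding G_def casimir_def DX cVU m_def[symmetric] D_def[symmetric]
    by (rule operator_eqI) (simp add: field_simps)
  have cU: "real (card (U - {t})) = m - 1" if "t \<in> U" for t
    using card_Suc_Diff1[OF fin(2) that] by (simp add: m_def)
  define J where "J t = (\<Sum>a\<in>U - {t}. tau a t)" for t
  define J' where "J' t = (\<Sum>a\<in>S. tau a t)" for t
  have lU: "link (U - {t}) t = J t - of_real ((m - 1) / 2)" if "t \<in> U" for t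
    unfolding link_def cU[OF that] J_def ..
  have sJ: "(\<Sum>t\<in>U. J t) = D - of_real m"
  proof -
    have "(\<Sum>t\<in>U. J t) = (\<Sum>t\<in>U. (\<Sum>a\<in>U. tau a t) - 1)"
      unfolding J_def using fin by (intro sum.cong refl) (simp add: sum_diff1)
    also have "\<dots> = (\<Sum>t\<in>U. \<Sum>a\<in>U. tau a t) - of_real m"
      by (simp add: sum_subtractf m_def)
    also have "(\<Sum>t\<in>U. \<Sum>a\<in>U. tau a t) = D" unfolding D_def by (rule sum.swap)
    finally show ?thesis .
  qed
  have const: "(\<Sum>t\<in>U. of_real c :: operator) = of_real (m * c)" for c
    unfolding m_def by simp
  have "(\<Sum>t\<in>U. link (U - {t}) t) = (\<Sum>t\<in>U. J t - of_real ((m - 1) / 2))"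
    by (intro sum.cong refl lU)
  also have "\<dots> = D - of_real m - of_real (m * ((m - 1) / 2))"
    unfolding sum_subtractf sJ const ..
  also have "\<dots> = 2 *\<^sub>R casimir U - of_real (3 * m / 2)"
    unfolding casimir_def D_def[symmetric] m_def[symmetric]
    by (rule operator_eqI) (simp add: field_simps)
  finally show "(\<Sum>t\<in>U. link (U - {t}) t) = 2 *\<^sub>R casimir U - of_real (3 * m / 2)" .
  have sJ': "(\<Sum>t\<in>U. J' t) = X" unfolding J'_def X_def ..
  have lS: "link S t = J' t - of_real (?i / 2)" for t by (simp add: link_def J'_def)
  show "(\<Sum>t\<in>U. link S t) = G"
    unfolding lS sum_subtractf const sJ' G by (simp add: mult.commute)
  \<comment> \<open>One ordered pair of sites of \<open>U\<close>. The diagonal value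
    \<open>0\<close> lets both indices run over all of \<open>U\<close>, so that
    \<open>f b t\<close> can be added to \<open>f t b\<close>.\<close>
  define f where "f b t = (if b = t then 0 else \<Sum>a\<in>S. tau b t * tau a t)" for b t
  have ff: "f b t + f t b = (\<Sum>a\<in>S. tau a b + tau a t + tau b t - 1) - (if b = t then 2 *\<^sub>R (\<Sum>a\<in>S. tau a t) else 0)"
    if "b \<in> U" "t \<in> U" for b t
  proof (cases "b = t")
    case True
    then show ?thesis by (simp add: f_def sum.distrib sum_subtractf scaleR_2)
  next
    case False
    have "tau b t * tau a t + tau t b * tau a b = tau a b + tau a t + tau b t - 1" if "a \<in> S" for a
    proof -
      have "a \<noteq> b" "a \<noteq> t" using that \<open>b \<in> U\<close> \<open>t \<in> U\<close> disj by auto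
      \<comment> \<open>Conjugation turns the term with \<open>b\<close> and \<open>t\<close>
        exchanged into the opposite order of the same two transpositions, which completes the
        anticommutator.\<close>
      then have "tau t b * tau a b = tau a t * tau b t"
        using tau_conj[of t b a b] by (simp add: tau_commute)
      then show ?thesis using tau_three[OF \<open>a \<noteq> b\<close> \<open>a \<noteq> t\<close> False] by (simp add: add.commute)
    qed
    then show ?thesis using False by (simp add: f_def sum.distrib[symmetric])
  qed
  have E0: "(\<Sum>t\<in>U. J t * J' t) = (\<Sum>t\<in>U. \<Sum>b\<in>U. f b t)"
  proof (intro sum.cong refl)
    fix t assume "t \<in> U"
    have "J t * J' t = (\<Sum>b\<in>U - {t}. f b t)"
      unfolding J_def J'_def sum_product by (intro sum.cong refl) (auto simp: f_def)
    also have "\<dots> = (\<Sum>b\<in>U. f b t)"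
      using fin by (intro sum.mono_neutral_left) (auto simp: f_def)
    finally show "J t * J' t = (\<Sum>b\<in>U. f b t)" .
  qed
  have "2 *\<^sub>R (\<Sum>t\<in>U. J t * J' t) = (\<Sum>t\<in>U. \<Sum>b\<in>U. f b t) + (\<Sum>t\<in>U. \<Sum>b\<in>U. f t b)"
    unfolding E0 scaleR_2 by (simp add: sum.swap[of "\<lambda>t b. f t b"])
  also have "\<dots> = (\<Sum>t\<in>U. \<Sum>b\<in>U. (\<Sum>a\<in>S. tau a b + tau a t + tau b t - 1) - (if b = t then 2 *\<^sub>R (\<Sum>a\<in>S. tau a t) else 0))"
    unfolding sum.distrib[symmetric] by (intro sum.cong refl ff)
  also have "\<dots> = (\<Sum>t\<in>U. \<Sum>b\<in>U. (\<Sum>a\<in>S. tau a b) + (\<Sum>a\<in>S. tau a t) + ?i *\<^sub>R tau b t - of_real ?i) - 2 *\<^sub>R X"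
  proof -
    have 1: "(\<Sum>a\<in>S. tau a b + tau a t + tau b t - 1) = (\<Sum>a\<in>S. tau a b) + (\<Sum>a\<in>S. tau a t) + ?i *\<^sub>R tau b t - of_real ?i" for b t
      by (rule operator_eqI) (simp add: sum.distrib sum_subtractf)
    have 2: "(\<Sum>b\<in>U. if b = t then 2 *\<^sub>R (\<Sum>a\<in>S. tau a t) else 0) = 2 *\<^sub>R (\<Sum>a\<in>S. tau a t)" if "t \<in> U" for t
      using that fin by simp
    have "(\<Sum>t\<in>U. \<Sum>b\<in>U. if b = t then 2 *\<^sub>R (\<Sum>a\<in>S. tau a t) else 0) = 2 *\<^sub>R X"
      unfolding X_def scaleR_sum_right[of _ _ U] by (intro sum.cong refl 2)
    then show ?thesis unfolding 1 by (simp only: sum_subtractf)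
  qed
  also have "\<dots> = (2 * m) *\<^sub>R X + ?i *\<^sub>R D - of_real (?i * m * m) - 2 *\<^sub>R X"
  proof -
    have "(\<Sum>t\<in>U. \<Sum>b\<in>U. (\<Sum>a\<in>S. tau a b)) = m *\<^sub>R X"
      unfolding X_def m_def by (simp add: of_nat_times)
    moreover have "(\<Sum>t\<in>U. \<Sum>b\<in>U. (\<Sum>a\<in>S. tau a t)) = m *\<^sub>R X"
      unfolding X_def m_def by (simp add: of_nat_times scaleR_sum_right)
    moreover have "(\<Sum>t\<in>U. \<Sum>b\<in>U. ?i *\<^sub>R tau b t) = ?i *\<^sub>R D"
      unfolding D_def scaleR_sum_right by (rule sum.swap)
    moreover have "(\<Sum>t\<in>U. \<Sum>b\<in>U. of_real ?i :: operator) = of_real (?i * m * m)"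
      unfolding const by (simp only: mult_ac)
    ultimately show ?thesis
      unfolding sum_subtractf sum.distrib by (intro operator_eqI) (simp add: algebra_simps)
  qed
  finally have E: "2 *\<^sub>R (\<Sum>t\<in>U. J t * J' t) = (2 * m) *\<^sub>R X + ?i *\<^sub>R D - of_real (?i * m * m) - 2 *\<^sub>R X" .
  have "(\<Sum>t\<in>U. link (U - {t}) t * link S t) = (\<Sum>t\<in>U. J t * J' t - ((m - 1) / 2) *\<^sub>R J' t - (?i / 2) *\<^sub>R J t + of_real (?i * (m - 1) / 4))"
  proof (intro sum.cong refl)
    fix t assume t: "t \<in> U"
    have "(x - of_real p) * (y - of_real q) = x * y - p *\<^sub>R y - q *\<^sub>R x + of_real (q * p)" for x y :: operator and p q
      by (simp add: left_diff_distrib right_diff_distrib of_real_times scaleR_diff_right)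
        (simp add: of_real_def mult.commute)
    then show "link (U - {t}) t * link S t = J t * J' t - ((m - 1) / 2) *\<^sub>R J' t - (?i / 2) *\<^sub>R J t + of_real (?i * (m - 1) / 4)"
      unfolding lS lU[OF t] by (simp del: of_real_mult of_real_divide)
  qed
  also have "\<dots> = (1/2) *\<^sub>R (2 *\<^sub>R (\<Sum>t\<in>U. J t * J' t)) - ((m - 1) / 2) *\<^sub>R X - (?i / 2) *\<^sub>R (D - of_real m) + of_real (m * (?i * (m - 1) / 4))"
    unfolding sum.distrib sum_subtractf const sJ[symmetric] sJ'[symmetric] scaleR_sum_right by simp
  also have "\<dots> = ((m - 1) / 2) *\<^sub>R G"
    unfolding E G by (rule operator_eqI) (simp add: field_simps)
  finally show "(\<Sum>t\<in>U. link (U - {t}) t * link S t) = ((m - 1) / 2) *\<^sub>R G" .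
qed

section \<open>Spectral projections after one site is removed or added\<close>

lemma proj_not_root:
  assumes "finite S" "2 * l \<le> card S" "eigval (card S) l \<noteq> r" "eigval (card S) l \<noteq> r'"
    and "(casimir S - of_real r) * ((casimir S - of_real r') * y) = 0"
  shows "proj S l * y = 0"
proof -
  have "(eigval (card S) l - r) *\<^sub>R (eigval (card S) l - r') *\<^sub>R (proj S l * y) = 0"
    using arg_cong[OF assms(5), of "\<lambda>z. proj S l * z"]
    by (simp add: proj_casimir_diff[OF assms(1,2)] del: scaleR_scaleR)
  then show ?thesis using assms(3,4) by simp
qed

text \<open>Here \<open>c\<close> is the spin \<open>s\<close> or \<open>- s - 1\<close>, which covers raising and lowering the spin at once.\<close>

lemma casimir_remove_quadratic:
  assumes "finite W" "t \<notin> W" "casimir (insert t W) * y = (c * (c + 1)) *\<^sub>R y"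
  shows "(casimir W - of_real ((c + 1/2) * (c + 3/2))) * y = - ((link W t + of_real (c + 3/2)) * y)"
    and "(casimir W - of_real ((c - 1/2) * (c + 1/2))) * ((casimir W - of_real ((c + 1/2) * (c + 3/2))) * y) = 0"
proof -
  let ?L = "link W t" and ?K = "casimir W"
  have Ky: "?K * y = (c * (c + 1) - 3/4) *\<^sub>R y - ?L * y"
  proof -
    have "?K * y = casimir (insert t W) * y - (3/4) *\<^sub>R y - ?L * y"
      unfolding casimir_insert[OF assms(1,2)] by (simp add: distrib_right of_real_times)
    then show ?thesis unfolding assms(3) by (simp add: scaleR_diff_left)
  qed
  show 1: "(?K - of_real ((c + 1/2) * (c + 3/2))) * y = - ((?L + of_real (c + 3/2)) * y)"
    unfolding left_diff_distrib distrib_right Ky of_real_times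
    by (rule operator_eqI) (simp add: field_simps)
  have KL: "?K * (?L * z) = ?L * (?K * z)" for z
    using link_casimir[OF assms(1,2)] by (metis mult.assoc)
  have LL: "?L * (?L * y) = ?K * y - ?L * y"
    unfolding link_quadratic[OF assms(1,2), symmetric] by (simp add: distrib_left distrib_right mult.assoc)
  have gen: "(?K - of_real p) * ((?L + of_real q) * y) = ?L * (?K * y) + q *\<^sub>R (?K * y) - p *\<^sub>R (?L * y) - (p * q) *\<^sub>R y" for p q
    by (simp add: left_diff_distrib right_diff_distrib distrib_right distrib_left of_real_times KL scaleR_diff_right scaleR_add_right)
  have "(?K - of_real ((c - 1/2) * (c + 1/2))) * ((?L + of_real (c + 3/2)) * y)
    = ?L * (?K * y) + (c + 3/2) *\<^sub>R (?K * y) - ((c - 1/2) * (c + 1/2)) *\<^sub>R (?L * y) - ((c - 1/2) * (c + 1/2) * (c + 3/2)) *\<^sub>R y"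
    by (simp only: gen)
  also have "\<dots> = 0"
    unfolding Ky right_diff_distrib mult_scaleR_right LL
    unfolding Ky by (rule operator_eqI) (simp add: field_simps)
  finally show "(?K - of_real ((c - 1/2) * (c + 1/2))) * ((?K - of_real ((c + 1/2) * (c + 3/2))) * y) = 0"
    unfolding 1 mult_minus_right by simp
qed

text \<open>Replacing \<open>c\<close> by \<open>- c - 1\<close> keeps \<open>c * (c + 1)\<close>
  and exchanges the two roots, so this too covers both directions of the spin.\<close>

lemma casimir_add_quadratic:
  assumes "finite S" "t \<notin> S" "casimir S * y = (c * (c + 1)) *\<^sub>R y"
  defines "K \<equiv> casimir (insert t S)"
  shows "(K - of_real ((c - 1/2) * (c + 1/2))) * y = (link S t + of_real (c + 1)) * y"
    and "(K - of_real ((c + 1/2) * (c + 3/2))) * ((K - of_real ((c - 1/2) * (c + 1/2))) * y) = 0"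
proof -
  let ?L = "link S t"
  have Ky: "K * y = (c * (c + 1) + 3/4) *\<^sub>R y + ?L * y"
    unfolding K_def casimir_insert[OF assms(1,2)]
    by (simp add: distrib_right of_real_times assms(3) scaleR_add_left)
  show 1: "(K - of_real ((c - 1/2) * (c + 1/2))) * y = (?L + of_real (c + 1)) * y"
    unfolding left_diff_distrib distrib_right Ky of_real_times
    by (rule operator_eqI) (simp add: field_simps)
  have KL: "K * (?L * z) = ?L * (K * z)" for z
  proof -
    have "K * ?L = ?L * K"
      unfolding K_def casimir_insert[OF assms(1,2)]
      using link_casimir[OF assms(1,2)] by (simp add: distrib_left distrib_right of_real_times)
    then show ?thesis by (metis mult.assoc)
  qed
  have LL: "?L * (?L * y) = (c * (c + 1)) *\<^sub>R y - ?L * y"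
    unfolding assms(3)[symmetric] link_quadratic[OF assms(1,2), symmetric]
    by (simp add: distrib_left distrib_right mult.assoc)
  have gen: "(K - of_real p) * ((?L + of_real q) * y) = ?L * (K * y) + q *\<^sub>R (K * y) - p *\<^sub>R (?L * y) - (p * q) *\<^sub>R y" for p q
    by (simp add: left_diff_distrib right_diff_distrib distrib_right distrib_left of_real_times KL scaleR_diff_right scaleR_add_right)
  have "(K - of_real ((c + 1/2) * (c + 3/2))) * ((?L + of_real (c + 1)) * y)
    = ?L * (K * y) + (c + 1) *\<^sub>R (K * y) - ((c + 1/2) * (c + 3/2)) *\<^sub>R (?L * y) - ((c + 1/2) * (c + 3/2) * (c + 1)) *\<^sub>R y"
    by (simp only: gen)
  also have "\<dots> = 0"
    unfolding Ky distrib_left mult_scaleR_right LL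
    by (rule operator_eqI) (simp add: field_simps)
  finally show "(K - of_real ((c + 1/2) * (c + 3/2))) * ((K - of_real ((c - 1/2) * (c + 1/2))) * y) = 0"
    unfolding 1 .
qed

text \<open>With only two possible values the interpolation polynomial is linear, hence linear in
  the link. A product of one removal and one addition is then quadratic in links, which is what
  \<open>link_sums\<close> can evaluate.\<close>

lemma proj_remove:
  assumes "finite W" "t \<notin> W" "2 * j' \<le> card W" "2 * j \<le> Suc (card W)"
    and c: "c * (c + 1) = eigval (Suc (card W)) j" "eigval (card W) j' = (c - 1/2) * (c + 1/2)" "2 * c + 1 \<noteq> 0"
  shows "proj W j' * proj (insert t W) j = (1 / (2 * c + 1)) *\<^sub>R ((link W t + of_real (c + 3/2)) * proj (insert t W) j)"
proof -
  let ?y = "proj (insert t W) j"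
  have y: "casimir (insert t W) * ?y = (c * (c + 1)) *\<^sub>R ?y"
    using casimir_proj[of "insert t W" j] assms by simp
  have d: "(c - 1/2) * (c + 1/2) - (c + 1/2) * (c + 3/2) = - (2 * c + 1)" by (simp add: field_simps)
  with c(3) have ne: "(c - 1/2) * (c + 1/2) \<noteq> (c + 1/2) * (c + 3/2)"
    by linarith
  show ?thesis
    using proj_two_roots[OF assms(1,3) c(2) ne casimir_remove_quadratic(2)[OF assms(1,2) y]]
    unfolding casimir_remove_quadratic(1)[OF assms(1,2) y] d minus_divide_right[symmetric]
    by (simp only: scaleR_minus_left scaleR_minus_right minus_minus)
qed

lemma proj_add:
  assumes "finite S" "t \<notin> S" "2 * l \<le> card S" "2 * l' \<le> Suc (card S)"
    and c: "c * (c + 1) = eigval (card S) l" "eigval (Suc (card S)) l' = (c + 1/2) * (c + 3/2)" "2 * c + 1 \<noteq> 0"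
  shows "proj (insert t S) l' * proj S l = (1 / (2 * c + 1)) *\<^sub>R ((link S t + of_real (c + 1)) * proj S l)"
proof -
  let ?y = "proj S l"
  have y: "casimir S * ?y = (c * (c + 1)) *\<^sub>R ?y"
    using casimir_proj[of S l] assms by simp
  have d: "(c + 1/2) * (c + 3/2) - (c - 1/2) * (c + 1/2) = 2 * c + 1" by (simp add: field_simps)
  with c(3) have ne: "(c + 1/2) * (c + 3/2) \<noteq> (c - 1/2) * (c + 1/2)"
    by linarith
  have "finite (insert t S)" "2 * l' \<le> card (insert t S)" "eigval (card (insert t S)) l' = (c + 1/2) * (c + 3/2)"
    using assms by simp_all
  from proj_two_roots[OF this ne casimir_add_quadratic(2)[OF assms(1,2) y]]
  show ?thesis
    unfolding casimir_add_quadratic(1)[OF assms(1,2) y] d .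
qed

lemma spin_shift_eq:
  fixes a c :: real
  assumes "0 \<le> a" "0 \<le> c"
  shows "a * (a + 1) = (c - 1/2) * (c + 1/2) \<Longrightarrow> a = c - 1/2"
    and "a * (a + 1) = (c + 1/2) * (c + 3/2) \<Longrightarrow> a = c + 1/2"
proof -
  assume "a * (a + 1) = (c - 1/2) * (c + 1/2)"
  then have "(a - (c - 1/2)) * (a + c + 1/2) = 0" by (simp add: algebra_simps)
  then show "a = c - 1/2" using assms by auto
next
  assume "a * (a + 1) = (c + 1/2) * (c + 3/2)"
  then have "(a - (c + 1/2)) * (a + c + 3/2) = 0" by (simp add: algebra_simps)
  then show "a = c + 1/2" using assms by auto
qed

lemma proj_remove_zero:
  assumes "finite W" "t \<notin> W" "2 * j' \<le> card W" "2 * j \<le> Suc (card W)" "j' \<noteq> j" "Suc j' \<noteq> j"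
  shows "proj W j' * proj (insert t W) j = 0"
proof -
  let ?y = "proj (insert t W) j" and ?c = "spin_of (Suc (card W)) j" and ?a = "spin_of (card W) j'"
  have y: "casimir (insert t W) * ?y = (?c * (?c + 1)) *\<^sub>R ?y"
    using casimir_proj[of "insert t W" j] assms by (simp add: eigval_def)
  have pos: "0 \<le> ?a" "0 \<le> ?c" using spin_of_nonneg assms(3,4) by auto
  have "eigval (card W) j' \<noteq> (?c - 1/2) * (?c + 1/2)"
    using spin_shift_eq(1)[OF pos] assms(5) by (auto simp: eigval_def spin_of_def add_divide_distrib)
  moreover have "eigval (card W) j' \<noteq> (?c + 1/2) * (?c + 3/2)"
    using spin_shift_eq(2)[OF pos] assms(6) by (auto simp: eigval_def spin_of_def add_divide_distrib)
  ultimately show ?thesis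
    using proj_not_root[OF assms(1,3) _ _ casimir_remove_quadratic(2)[OF assms(1,2) y]] by blast
qed

lemma proj_add_zero:
  assumes "finite S" "t \<notin> S" "2 * l \<le> card S" "2 * l' \<le> Suc (card S)" "l' \<noteq> l" "l' \<noteq> Suc l"
  shows "proj (insert t S) l' * proj S l = 0"
proof -
  let ?y = "proj S l" and ?c = "spin_of (card S) l" and ?a = "spin_of (Suc (card S)) l'"
  have y: "casimir S * ?y = (?c * (?c + 1)) *\<^sub>R ?y"
    using casimir_proj[of S l] assms by (simp add: eigval_def)
  have pos: "0 \<le> ?a" "0 \<le> ?c" using spin_of_nonneg assms(3,4) by auto
  have card: "card (insert t S) = Suc (card S)" using assms by simp
  have "eigval (Suc (card S)) l' \<noteq> (?c - 1/2) * (?c + 1/2)"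
    using spin_shift_eq(1)[OF pos] assms(6) by (auto simp: eigval_def spin_of_def add_divide_distrib)
  moreover have "eigval (Suc (card S)) l' \<noteq> (?c + 1/2) * (?c + 3/2)"
    using spin_shift_eq(2)[OF pos] assms(5) by (auto simp: eigval_def spin_of_def add_divide_distrib)
  moreover have "finite (insert t S)" "2 * l' \<le> card (insert t S)" using assms card by auto
  ultimately show ?thesis
    using proj_not_root[OF _ _ _ _ casimir_add_quadratic(2)[OF assms(1,2) y]] card by metis
qed

text \<open>The two numbers with the same \<open>c * (c + 1)\<close>. When a site is removed, the
  true case means that the spin drops by one half; when a site is added, it means that the spin
  grows by one half.\<close>

definition signed_spin :: "bool \<Rightarrow> real \<Rightarrow> real" where
  "signed_spin b c = (if b then c else - c - 1)"

text \<open>The scalar produced by moving one site from a set of \<open>m\<close> sites with label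
  \<open>j\<close> to a set of \<open>i\<close> sites with label \<open>l\<close>, the new labels
  being \<open>j'\<close> and \<open>l'\<close>. The difference of eigenvalues is the value of twice
  the inner product of the two total spins.\<close>

definition transfer_coeff :: "nat \<Rightarrow> nat \<Rightarrow> nat \<Rightarrow> nat \<Rightarrow> nat \<Rightarrow> nat \<Rightarrow> nat \<Rightarrow> real" where
  "transfer_coeff m i k j l j' l' =
    (if (j' = j \<or> Suc j' = j) \<and> (l' = l \<or> l' = Suc l)
     then let c = signed_spin (j' = j) (spin_of m j); d = signed_spin (l' = l) (spin_of i l) in
       (real m / 2 + c + 1) * (eigval (m + i) k - eigval m j - eigval i l + 2 * c * (d + 1)) / ((2 * c + 1) * (2 * d + 1))
     else 0)"

lemma signed_spin:
  assumes "2 * j \<le> m"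
  shows "signed_spin b (spin_of m j) * (signed_spin b (spin_of m j) + 1) = eigval m j"
    and "2 * signed_spin b (spin_of m j) + 1 \<noteq> 0"
  using spin_of_nonneg[OF assms] by (auto simp: signed_spin_def eigval_def algebra_simps)

lemma sum_quadratic_link:
  assumes "finite S" "finite U" "S \<inter> U = {}"
  defines "m \<equiv> real (card U)"
  shows "(\<Sum>t\<in>U. (link (U - {t}) t + of_real \<beta>) * (link S t + of_real \<delta>))
    = ((m - 1) / 2 + \<beta>) *\<^sub>R (casimir (S \<union> U) - casimir S - casimir U)
      + \<delta> *\<^sub>R (2 *\<^sub>R casimir U - of_real (3 * m / 2)) + of_real (m * \<beta> * \<delta>)"
proof -
  have "(\<Sum>t\<in>U. (link (U - {t}) t + of_real \<beta>) * (link S t + of_real \<delta>))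
    = (\<Sum>t\<in>U. link (U - {t}) t * link S t + \<delta> *\<^sub>R link (U - {t}) t + \<beta> *\<^sub>R link S t + of_real (\<beta> * \<delta>))"
    by (intro sum.cong refl) (simp add: distrib_left distrib_right of_real_times, simp add: of_real_def scaleR_add_right mult.commute)
  also have "\<dots> = (\<Sum>t\<in>U. link (U - {t}) t * link S t) + \<delta> *\<^sub>R (\<Sum>t\<in>U. link (U - {t}) t)
      + \<beta> *\<^sub>R (\<Sum>t\<in>U. link S t) + of_real (m * (\<beta> * \<delta>))"
    unfolding m_def by (simp add: sum.distrib scaleR_sum_right)
  finally show ?thesis
    unfolding sum_link_inner[OF assms(1-3)] sum_link_outer[OF assms(1-3)] sum_link_prod[OF assms(1-3)] m_def[symmetric]
    by (simp only: scaleR_add_left mult.assoc add_ac)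
qed

text \<open>Between \<open>proj U j\<close> and \<open>proj S l\<close> both inner projections are
  linear in links, so each summand is a product of two linear factors.
  \<open>sum_quadratic_link\<close> turns their sum into Casimir operators, which act on the outer
  projections by scalars.\<close>

lemma transfer_term:
  assumes fin: "finite S" "finite U" "S \<inter> U = {}"
    and k: "2 * k \<le> card (S \<union> U)" and jl: "2 * j \<le> card U" "2 * l \<le> card S"
    and jl': "2 * j' < card U" "2 * l' \<le> Suc (card S)"
  shows "(\<Sum>t\<in>U. proj U j * proj (U - {t}) j' * proj (insert t S) l' * proj S l * proj (S \<union> U) k)
    = transfer_coeff (card U) (card S) k j l j' l' *\<^sub>R (proj U j * proj S l * proj (S \<union> U) k)"
proof -
  let ?V = "S \<union> U" and ?m = "card U" and ?i = "card S"
  let ?F = "\<lambda>t. proj U j * proj (U - {t}) j' * proj (insert t S) l' * proj S l * proj ?V k"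
  have cU: "Suc (card (U - {t})) = ?m" "insert t (U - {t}) = U" "finite (U - {t})" if "t \<in> U" for t
    using fin that card_Suc_Diff1[OF fin(2) that] by auto
  have tS: "t \<notin> S" if "t \<in> U" for t using that fin by auto
  have cV: "card ?V = ?m + ?i" using fin by (simp add: card_Un_disjoint)
  have comm: "proj U j * proj (U - {t}) j' = proj (U - {t}) j' * proj U j" for t
    by (rule proj_commute_proj) auto
  show ?thesis
  proof (cases "(j' = j \<or> Suc j' = j) \<and> (l' = l \<or> l' = Suc l)")
    case False
    have "proj U j * proj (U - {t}) j' * proj (insert t S) l' * proj S l = 0" if t: "t \<in> U" for t
    proof (cases "j' = j \<or> Suc j' = j")
      case True
      then have "proj (insert t S) l' * proj S l = 0"
        using False proj_add_zero[OF fin(1) tS[OF t] jl(2) jl'(2)] by auto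
      then show ?thesis by (simp add: mult.assoc)
    next
      case False
      then have "proj (U - {t}) j' * proj U j = 0"
        using proj_remove_zero[of "U - {t}" t j' j] cU[OF t] jl jl' by auto
      then show ?thesis by (simp add: comm)
    qed
    then show ?thesis using False unfolding transfer_coeff_def
      by (simp only: if_False mult_zero_left scaleR_zero_left sum.neutral_const cong: sum.cong)
  next
    case True
    define c where "c = signed_spin (j' = j) (spin_of ?m j)"
    define d where "d = signed_spin (l' = l) (spin_of ?i l)"
    define z where "z = proj U j * proj S l * proj ?V k"
    define a where "a = 1 / ((2 * c + 1) * (2 * d + 1))"
    have c: "c * (c + 1) = eigval ?m j" "2 * c + 1 \<noteq> 0"
      unfolding c_def using signed_spin[OF jl(1)] by auto
    have d: "d * (d + 1) = eigval ?i l" "2 * d + 1 \<noteq> 0"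
      unfolding d_def using signed_spin[OF jl(2)] by auto
    obtain m' where m': "?m = Suc m'" using jl'(1) by (cases ?m) auto
    have c': "eigval m' j' = (c - 1/2) * (c + 1/2)"
      using True unfolding c_def m' by (auto simp: signed_spin_def eigval_def spin_of_def field_simps)
    have d': "eigval (Suc ?i) l' = (d + 1/2) * (d + 3/2)"
      using True unfolding d_def by (auto simp: signed_spin_def eigval_def spin_of_def field_simps)
    let ?L = "\<lambda>t. link (U - {t}) t + of_real (c + 3/2)" and ?M = "\<lambda>t. link S t + of_real (d + 1)"
    have pU: "proj (U - {t}) j' * proj U j = (1 / (2 * c + 1)) *\<^sub>R (?L t * proj U j)"
      if t: "t \<in> U" for t
    proof -
      have card: "card (U - {t}) = m'" using cU[OF t] m' by simp
      have 1: "t \<notin> U - {t}" "2 * j' \<le> card (U - {t})" "2 * j \<le> Suc (card (U - {t}))"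
        using jl(1) jl'(1) unfolding card m' by simp_all
      have 2: "c * (c + 1) = eigval (Suc (card (U - {t}))) j" "eigval (card (U - {t})) j' = (c - 1/2) * (c + 1/2)"
        unfolding card using c(1) c' m' by simp_all
      show ?thesis
        using proj_remove[OF cU(3)[OF t] 1 2 c(2)] unfolding cU(2)[OF t] .
    qed
    have pS: "proj (insert t S) l' * proj S l = (1 / (2 * d + 1)) *\<^sub>R (?M t * proj S l)"
      if t: "t \<in> U" for t
      using proj_add[OF fin(1) tS[OF t] jl(2) jl'(2) d(1) d' d(2)] .
    have commU: "proj U j * x = x * proj U j" if "x * casimir U = casimir U * x" for x
      by (rule proj_commute) fact
    have lt: "proj U j * (link (U - {t}) t + of_real b) = (link (U - {t}) t + of_real b) * proj U j" if t: "t \<in> U" for t b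
    proof (rule commU)
      have "t \<notin> U - {t}" by simp
      \<comment> \<open>The link is a difference of the Casimir operators of the nested sets
        \<open>U\<close> and \<open>U - {t}\<close> up to a scalar, so it commutes with
        \<open>casimir U\<close>.\<close>
      from casimir_insert[OF cU(3)[OF t] this] have L: "link (U - {t}) t = casimir U - casimir (U - {t}) - of_real (3/4)"
        using cU(2)[OF t] by simp
      have "casimir (U - {t}) * casimir U = casimir U * casimir (U - {t})"
        by (rule casimir_commute) auto
      then show "(link (U - {t}) t + of_real b) * casimir U = casimir U * (link (U - {t}) t + of_real b)"
        unfolding L by (simp add: left_diff_distrib right_diff_distrib distrib_left distrib_right of_real_times)
    qed
    have ch: "proj U j * proj S l = proj S l * proj U j" "proj U j * proj ?V k = proj ?V k * proj U j"
      "proj S l * proj ?V k = proj ?V k * proj S l"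
      using fin by (auto intro!: proj_commute_proj)
    define w where "w = proj S l * proj ?V k"
    have KU: "proj U j * casimir U = eigval ?m j *\<^sub>R proj U j"
      using casimir_proj[OF fin(2) jl(1)] by (simp add: commU)
    have KSw: "casimir S * w = eigval ?i l *\<^sub>R w"
      unfolding w_def using casimir_proj[OF fin(1) jl(2)] by (simp flip: mult.assoc)
    have KVw: "casimir ?V * w = eigval (?m + ?i) k *\<^sub>R w"
      unfolding w_def ch(3) using casimir_proj[of ?V k] fin k cV by (simp flip: mult.assoc)
    define g where "g = eigval (?m + ?i) k - eigval ?m j - eigval ?i l"
    have Gw: "proj U j * ((casimir ?V - casimir S - casimir U) * w) = g *\<^sub>R (proj U j * w)"
    proof -
      have "proj U j * (casimir U * w) = eigval ?m j *\<^sub>R (proj U j * w)"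
        using KU by (metis mult.assoc mult_scaleR_left)
      then show ?thesis
        by (simp add: left_diff_distrib right_diff_distrib KSw KVw g_def scaleR_diff_left)
    qed
    have summand: "?F t
        = a *\<^sub>R (proj U j * (?L t * ?M t * w))" if t: "t \<in> U" for t
    proof -
      have "?F t
        = (proj (U - {t}) j' * proj U j) * (proj (insert t S) l' * proj S l) * proj ?V k"
        unfolding comm by (simp only: mult.assoc)
      also have "\<dots> = a *\<^sub>R ((?L t * proj U j) * (?M t * proj S l) * proj ?V k)"
        unfolding pU[OF t] pS[OF t] a_def mult_scaleR_left mult_scaleR_right scaleR_scaleR by simp
      also have "\<dots> = a *\<^sub>R (proj U j * (?L t * ?M t * w))"
        unfolding lt[OF t, symmetric] w_def by (simp only: mult.assoc)
      finally show ?thesis .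
    qed
    have "(\<Sum>t\<in>U. ?F t)
       = a *\<^sub>R (proj U j * ((\<Sum>t\<in>U. ?L t * ?M t) * w))"
      unfolding sum_distrib_right sum_distrib_left scaleR_sum_right by (intro sum.cong refl summand)
    also have "\<dots> = a *\<^sub>R ((((real ?m - 1) / 2 + (c + 3/2)) * g + (d + 1) * (2 * eigval ?m j - 3 * real ?m / 2) + real ?m * (c + 3/2) * (d + 1)) *\<^sub>R (proj U j * w))"
    proof -
      have "proj U j * (casimir U * w) = eigval ?m j *\<^sub>R (proj U j * w)"
        using KU by (metis mult.assoc mult_scaleR_left)
      then have "proj U j * ((p *\<^sub>R (casimir ?V - casimir S - casimir U) + q *\<^sub>R (2 *\<^sub>R casimir U - of_real r) + of_real s) * w)
          = (p * g + q * (2 * eigval ?m j - r) + s) *\<^sub>R (proj U j * w)" for p q r s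
      proof -
        have "P * ((p *\<^sub>R x + q *\<^sub>R (2 *\<^sub>R y - of_real r) + of_real s) * w)
          = p *\<^sub>R (P * (x * w)) + q *\<^sub>R (2 *\<^sub>R (P * (y * w)) - r *\<^sub>R (P * w)) + s *\<^sub>R (P * w)" for P x y :: operator
          by (simp add: distrib_left distrib_right left_diff_distrib right_diff_distrib of_real_times scaleR_diff_right)
        then show ?thesis
          using Gw \<open>proj U j * (casimir U * w) = eigval ?m j *\<^sub>R (proj U j * w)\<close>
          by (simp add: scaleR_diff_left[symmetric] scaleR_add_left[symmetric] del: distrib_left)
      qed
      then show ?thesis
        unfolding sum_quadratic_link[OF fin] by (simp only: scaleR_scaleR)
    qed
    also have "\<dots> = (a * (((real ?m - 1) / 2 + (c + 3/2)) * g + (d + 1) * (2 * (c * (c + 1)) - 3 * real ?m / 2) + real ?m * (c + 3/2) * (d + 1))) *\<^sub>R (proj U j * w)"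
      unfolding c(1) by simp
    \<comment> \<open>The terms with \<open>3 * ?m / 2\<close> cancel, and what is left has the
      common factor \<open>?m / 2 + c + 1\<close>.\<close>
    also have "a * (((real ?m - 1) / 2 + (c + 3/2)) * g + (d + 1) * (2 * (c * (c + 1)) - 3 * real ?m / 2) + real ?m * (c + 3/2) * (d + 1))
       = a * ((real ?m / 2 + c + 1) * (g + 2 * c * (d + 1)))"
      by (simp add: field_simps)
    also have "\<dots> = transfer_coeff ?m ?i k j l j' l'"
      using True unfolding transfer_coeff_def Let_def c_def[symmetric] d_def[symmetric] g_def[symmetric] a_def by simp
    finally show ?thesis by (simp only: w_def mult.assoc)
  qed
qed

text \<open>The identity is resolved over \<open>U\<close> on the left and over \<open>S\<close> on
  the right. Each new projection then stands next to the one for its own set with \<open>t\<close>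
  removed or added.\<close>

lemma transfer_sum:
  assumes fin: "finite S" "finite U" "S \<inter> U = {}"
    and k: "2 * k \<le> card (S \<union> U)" and jl': "2 * j' < card U" "2 * l' \<le> Suc (card S)"
  shows "(\<Sum>t\<in>U. proj (U - {t}) j' * proj (insert t S) l' * proj (S \<union> U) k)
    = (\<Sum>j | 2 * j \<le> card U. \<Sum>l | 2 * l \<le> card S.
        transfer_coeff (card U) (card S) k j l j' l' *\<^sub>R (proj U j * proj S l * proj (S \<union> U) k))"
proof -
  let ?J = "{j. 2 * j \<le> card U}" and ?I = "{l. 2 * l \<le> card S}"
    and ?F = "\<lambda>t j l. proj U j * proj (U - {t}) j' * proj (insert t S) l' * proj S l * proj (S \<union> U) k"
    and ?lhs = "\<Sum>t\<in>U. proj (U - {t}) j' * proj (insert t S) l' * proj (S \<union> U) k"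
  have com: "proj (S \<union> U) k * proj S l = proj S l * proj (S \<union> U) k" for l
    by (rule proj_commute_proj) auto
  have "?lhs
    = (\<Sum>t\<in>U. (\<Sum>j\<in>?J. proj U j) * (proj (U - {t}) j' * proj (insert t S) l' * proj (S \<union> U) k) * (\<Sum>l\<in>?I. proj S l))"
    unfolding sum_proj[OF fin(1)] sum_proj[OF fin(2)] by simp
  also have "\<dots> = (\<Sum>t\<in>U. \<Sum>j\<in>?J. \<Sum>l\<in>?I.
      ?F t j l)"
    unfolding sum_distrib_right unfolding sum_distrib_left by (simp only: mult.assoc com)
  also have "\<dots> = (\<Sum>j\<in>?J. \<Sum>t\<in>U. \<Sum>l\<in>?I.
      ?F t j l)"
    by (rule sum.swap)
  also have "\<dots> = (\<Sum>j\<in>?J. \<Sum>l\<in>?I. \<Sum>t\<in>U.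
      ?F t j l)"
    by (intro sum.cong refl sum.swap)
  also have "\<dots> = (\<Sum>j\<in>?J. \<Sum>l\<in>?I.
        transfer_coeff (card U) (card S) k j l j' l' *\<^sub>R (proj U j * proj S l * proj (S \<union> U) k))"
    using assms by (intro sum.cong refl transfer_term) auto
  finally show ?thesis .
qed

section \<open>Dimensions of two-row Specht modules\<close>

text \<open>Standard fillings of an arbitrary set of cells, so that deleting a corner stays within
  the notion.\<close>

definition tableaux :: "(nat \<times> nat) set \<Rightarrow> (nat \<times> nat \<Rightarrow> nat) set" where
  "tableaux D = {T \<in> extensional D. bij_betw T D {1..card D} \<and>
       (\<forall>r c. (r, Suc c) \<in> D \<longrightarrow> T (r, c) < T (r, Suc c)) \<and>
       (\<forall>r c. (Suc r, c) \<in> D \<longrightarrow> T (r, c) < T (Suc r, c))}"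

text \<open>The largest entry imposes no condition on the other cells when its cell has no right or
  lower neighbour; deleting it and putting it back are inverse operations.\<close>

lemma card_tableaux_corner:
  assumes fin: "finite D" and x: "(r, c) \<in> D" "(r, Suc c) \<notin> D" "(Suc r, c) \<notin> D"
    and left: "\<And>r c. (r, Suc c) \<in> D \<Longrightarrow> (r, c) \<in> D"
    and up: "\<And>r c. (Suc r, c) \<in> D \<Longrightarrow> (r, c) \<in> D"
  shows "card {T \<in> tableaux D. T (r, c) = card D} = card (tableaux (D - {(r, c)}))"
proof -
  let ?x = "(r, c)" and ?N = "card D"
  let ?D = "D - {?x}"
  have N: "card ?D = ?N - 1" "0 < ?N" using fin x(1) by (auto simp: card_gt_0_iff)
  then have iv: "{1..?N} - {?N} = {1..card ?D}" by auto
  have "bij_betw (\<lambda>T. restrict T ?D) {T \<in> tableaux D. T ?x = ?N} (tableaux ?D)"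
  proof (rule bij_betw_byWitness[of _ "\<lambda>T. T(?x := ?N)"])
    show "\<forall>T\<in>{T \<in> tableaux D. T ?x = ?N}. (restrict T ?D)(?x := ?N) = T"
      using x(1) by (fastforce simp: tableaux_def extensional_def fun_eq_iff)
    show "\<forall>T\<in>tableaux ?D. restrict (T(?x := ?N)) ?D = T"
      by (auto simp: tableaux_def extensional_def fun_eq_iff)
    show "(\<lambda>T. restrict T ?D) ` {T \<in> tableaux D. T ?x = ?N} \<subseteq> tableaux ?D"
    proof clarify
      fix T assume T: "T \<in> tableaux D" "T ?x = ?N"
      have bij: "bij_betw T D {1..?N}" using T by (simp add: tableaux_def)
      have "bij_betw T ?D ({1..?N} - {?N})"
      proof -
        have "bij_betw T {?x} {?N}" using T(2) by (simp add: bij_betw_def)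
        from bij_betw_DiffI[OF bij this] show ?thesis using x(1) N by simp
      qed
      then have "bij_betw (restrict T ?D) ?D {1..card ?D}"
        unfolding iv by (subst bij_betw_cong[where g = T]) simp_all
      moreover have "restrict T ?D (r1, c1) < restrict T ?D (r1, Suc c1)" if "(r1, Suc c1) \<in> ?D" for r1 c1
        using that T left[of r1 c1] x(2) by (auto simp: tableaux_def)
      moreover have "restrict T ?D (r1, c1) < restrict T ?D (Suc r1, c1)" if "(Suc r1, c1) \<in> ?D" for r1 c1
        using that T up[of r1 c1] x(3) by (auto simp: tableaux_def)
      ultimately show "restrict T ?D \<in> tableaux ?D" by (simp add: tableaux_def)
    qed
    show "(\<lambda>T. T(?x := ?N)) ` tableaux ?D \<subseteq> {T \<in> tableaux D. T ?x = ?N}"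
    proof clarify
      fix T assume T: "T \<in> tableaux ?D"
      let ?T = "T(?x := ?N)"
      have bij: "bij_betw T ?D {1..card ?D}" using T by (simp add: tableaux_def)
      then have "bij_betw ?T ?D {1..card ?D}"
        by (subst bij_betw_cong[where g = T]) simp_all
      then have "bij_betw ?T (?D \<union> {?x}) ({1..card ?D} \<union> {?N})"
        using notIn_Un_bij_betw[of ?x ?D ?T "{1..card ?D}"] N by simp
      moreover have "?D \<union> {?x} = D" using x by auto
      moreover have "{1..card ?D} \<union> {?N} = {1..?N}" using N by auto
      ultimately have "bij_betw ?T D {1..?N}" by simp
      moreover have small: "T y < ?N" if "y \<in> ?D" for y
      proof -
        have "T y \<in> {1..card ?D}" using bij that by (auto simp: bij_betw_def)
        then have "T y \<le> ?N - 1" using N(1) by simp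
        then show ?thesis using N(2) by linarith
      qed
      have "?T (r1, c1) < ?T (r1, Suc c1)" if "(r1, Suc c1) \<in> D" for r1 c1
      proof -
        have "(r1, c1) \<in> ?D" using left[OF that] that x by auto
        then show ?thesis using small[of "(r1, c1)"] T that by (auto simp: tableaux_def)
      qed
      moreover have "?T (r1, c1) < ?T (Suc r1, c1)" if "(Suc r1, c1) \<in> D" for r1 c1
      proof -
        have "(r1, c1) \<in> ?D" using up[OF that] that x by auto
        then show ?thesis using small[of "(r1, c1)"] T that by (auto simp: tableaux_def)
      qed
      moreover have "?T \<in> extensional D" using T x(1) by (auto simp: tableaux_def extensional_def)
      ultimately show "?T \<in> tableaux D \<and> ?T ?x = ?N" by (simp add: tableaux_def)
    qed
  qed
  then show ?thesis by (rule bij_betw_same_card)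
qed

section \<open>Two-row shapes and ballot numbers\<close>

definition two_rows :: "nat \<Rightarrow> nat \<Rightarrow> (nat \<times> nat) set" where
  "two_rows a b = {0} \<times> {..<a} \<union> {1} \<times> {..<b}"

lemma two_rows_simps [simp]: "finite (two_rows a b)" "card (two_rows a b) = a + b"
proof -
  have "({0::nat} \<times> {..<a}) \<inter> ({1} \<times> {..<b}) = {}" by auto
  then show "finite (two_rows a b)" "card (two_rows a b) = a + b"
    by (simp_all add: two_rows_def card_Un_disjoint card_cartesian_product)
qed

lemma young_diagram_two_rows: "young_diagram [a, b] = two_rows a b"
  by (auto simp: young_diagram_def two_rows_def less_Suc_eq)

lemma specht_dim_two_rows: "specht_dim [a, b] = card (tableaux (two_rows a b))"
  by (simp add: specht_dim_def standard_tableaux_def tableaux_def young_diagram_two_rows)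

lemma finite_tableaux: "finite D \<Longrightarrow> finite (tableaux D)"
  by (rule finite_subset[OF _ finite_PiE[of D "\<lambda>_. {1..card D}"]])
    (auto simp: tableaux_def PiE_def bij_betw_def)

text \<open>The branching rule: the largest entry ends the first row, possible only if that row is
  strictly longer, or the second row.\<close>

lemma specht_dim_rec:
  assumes "b \<le> a" "a + b > 0"
  shows "specht_dim [a, b] = (if b < a then specht_dim [a - 1, b] else 0) + (if b > 0 then specht_dim [a, b - 1] else 0)"
proof -
  let ?D = "two_rows a b"
  have mem: "(r, c) \<in> ?D \<longleftrightarrow> (r = 0 \<and> c < a) \<or> (r = 1 \<and> c < b)" for r c
    by (auto simp: two_rows_def)
  let ?A = "if b < a then {T \<in> tableaux ?D. T (0, a - 1) = card ?D} else {}"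
  let ?B = "if b > 0 then {T \<in> tableaux ?D. T (1, b - 1) = card ?D} else {}"
  have "tableaux ?D \<subseteq> ?A \<union> ?B"
  proof
    fix T assume T: "T \<in> tableaux ?D"
    then have bij: "bij_betw T ?D {1..card ?D}" by (simp add: tableaux_def)
    have "card ?D \<in> {1..card ?D}" using assms by (simp add: Suc_le_eq)
    then obtain r c where rc: "(r, c) \<in> ?D" "T (r, c) = card ?D"
      using bij unfolding bij_betw_def by (metis (no_types, lifting) image_iff surj_pair)
    have max: "T y \<le> card ?D" if "y \<in> ?D" for y using bij that by (auto simp: bij_betw_def)
    have "(r, Suc c) \<notin> ?D" "(Suc r, c) \<notin> ?D"
      using T rc(2) max[of "(r, Suc c)"] max[of "(Suc r, c)"] unfolding tableaux_def
      by (metis (mono_tags, lifting) mem_Collect_eq not_less)+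
    then have "(r = 0 \<and> c = a - 1 \<and> b < a) \<or> (r = 1 \<and> c = b - 1 \<and> b > 0)"
      using rc(1) assms unfolding mem by auto
    then show "T \<in> ?A \<union> ?B" using T rc(2) by auto
  qed
  then have U: "tableaux ?D = ?A \<union> ?B" by auto
  have "?A \<inter> ?B = {}"
  proof -
    have False if "T \<in> tableaux ?D" "b < a" "b > 0" "T (0, a - 1) = card ?D" "T (1, b - 1) = card ?D" for T
    proof -
      have "inj_on T ?D" using that by (simp add: tableaux_def bij_betw_def)
      moreover have "(0, a - 1) \<in> ?D" "(1, b - 1) \<in> ?D" using that by (auto simp: mem)
      ultimately have "(0::nat, a - 1) = (1, b - 1)" using that(4,5) unfolding inj_on_def by metis
      then show False by simp
    qed
    then show ?thesis by auto
  qed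
  then have "card (tableaux ?D) = card ?A + card ?B"
    using finite_tableaux[of ?D] by (subst U, subst card_Un_disjoint) auto
  moreover have "card ?A = specht_dim [a - 1, b]" if "b < a"
  proof -
    have "?D - {(0, a - 1)} = two_rows (a - 1) b" using that by (auto simp: two_rows_def)
    moreover have "card {T \<in> tableaux ?D. T (0, a - 1) = card ?D} = card (tableaux (?D - {(0, a - 1)}))"
      by (rule card_tableaux_corner) (use that in \<open>auto simp: mem\<close>)
    ultimately show ?thesis using that by (simp add: specht_dim_two_rows)
  qed
  moreover have "card ?B = specht_dim [a, b - 1]" if "b > 0"
  proof -
    have "?D - {(1, b - 1)} = two_rows a (b - 1)" using that by (auto simp: two_rows_def)
    moreover have "card {T \<in> tableaux ?D. T (1, b - 1) = card ?D} = card (tableaux (?D - {(1, b - 1)}))"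
      by (rule card_tableaux_corner) (use that assms in \<open>auto simp: mem\<close>)
    ultimately show ?thesis using that by (simp add: specht_dim_two_rows)
  qed
  ultimately show ?thesis by (auto simp: specht_dim_two_rows)
qed

lemma specht_dim_0: "specht_dim [0, 0] = 1"
proof -
  have "tableaux (two_rows 0 0) = {\<lambda>x. undefined}"
    by (auto simp: two_rows_def tableaux_def bij_betw_def)
  then show ?thesis by (simp add: specht_dim_two_rows)
qed

text \<open>The arithmetic of the induction for ballot numbers: \<open>Y\<close> and
  \<open>Z\<close> are the counts for the two smaller shapes, \<open>P\<close> and \<open>Q\<close>
  their binomial coefficients, and \<open>C\<close> that of the full shape.\<close>

lemma ballot_recurrence_solution:
  fixes a b :: real
  assumes "Y * a = P * (a - b)" "Z * (a + 1) = Q * (a - b + 2)" "C * b = Q * (a + b)" "C * a = P * (a + b)"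
    and "a > 0" "b \<ge> 0"
  shows "(Y + Z) * (a + 1) = C * (a - b + 1)"
proof -
  have P: "P = C * a / (a + b)" and Q: "Q = C * b / (a + b)" using assms by (simp_all add: field_simps)
  have "Y * a = C * (a - b) / (a + b) * a" using assms(1) unfolding P by (simp add: mult_ac)
  then have Y: "Y = C * (a - b) / (a + b)" using assms(5) by (simp only: mult_right_cancel)
  have "(Y + Z) * (a + 1) = Y * (a + 1) + Q * (a - b + 2)" using assms(2) by (simp add: algebra_simps)
  also have "\<dots> = C * ((a - b) * (a + 1) + b * (a - b + 2)) / (a + b)"
    unfolding Y Q by (simp add: algebra_simps add_divide_distrib diff_divide_distrib)
  also have "(a - b) * (a + 1) + b * (a - b + 2) = (a - b + 1) * (a + b)" by (simp add: algebra_simps)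
  finally show ?thesis using assms by simp
qed

lemma specht_dim_closed_form:
  assumes "b \<le> a"
  shows "real (specht_dim [a, b]) * (real a + 1) = real ((a + b) choose b) * (real a - real b + 1)"
  using assms
proof (induction "a + b" arbitrary: a b)
  case 0
  then show ?case by (simp add: specht_dim_0)
next
  case (Suc N)
  have rec: "specht_dim [a, b] = (if b < a then specht_dim [a - 1, b] else 0) + (if b > 0 then specht_dim [a, b - 1] else 0)"
    using Suc by (intro specht_dim_rec) auto
  show ?case
  proof (cases "b = 0")
    case True
    then obtain a' where a': "a = Suc a'" using Suc by (cases a) auto
    have "real (specht_dim [a', 0]) * (real a' + 1) = real a' + 1"
      using Suc(1)[of a' 0] Suc(2) True a' by simp
    moreover have "real a' + 1 \<noteq> 0" by linarith
    ultimately have "real (specht_dim [a', 0]) = 1"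
      by (metis mult_1 mult_right_cancel)
    then show ?thesis using True rec a' by simp
  next
    case False
    then obtain b' where b': "b = Suc b'" by (cases b) auto
    then obtain a' where a': "a = Suc a'" using Suc by (cases a) auto
    have 1: "real (specht_dim [a, b']) * (real a + 1) = real ((a + b') choose b') * (real a - real b' + 1)"
      using Suc b' by auto
    have C1: "real ((a + b) choose b) * real b = real ((a + b') choose b') * real (a + b)"
    proof -
      have "((a + b) choose b) * b = ((a + b') choose b') * (a + b)"
        using Suc_times_binomial_eq[of "a + b'" b'] unfolding b' by (simp only: add_Suc_right mult.commute)
      then show ?thesis by (metis of_nat_mult)
    qed
    have C2: "real ((a + b) choose b) * real a = real ((a' + b) choose b) * real (a + b)"
    proof -
      have "((a + b) choose a) * a = (a + b) * ((a' + b) choose a')"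
        using Suc_times_binomial_eq[of "a' + b" a'] unfolding a' by (simp only: add_Suc)
      then have "((a + b) choose b) * a = (a + b) * ((a' + b) choose b)"
        by (simp add: binomial_symmetric[of b "a + b"] binomial_symmetric[of b "a' + b"])
      then show ?thesis by (metis of_nat_mult mult.commute)
    qed
    show ?thesis
    proof (cases "b < a")
      case True
      have 2: "real (specht_dim [a', b]) * real a = real ((a' + b) choose b) * (real a - real b)"
        using Suc(1)[of a' b] Suc(2) a' True by (simp add: add.commute add_diff_eq)
      have "real (specht_dim [a, b]) = real (specht_dim [a', b]) + real (specht_dim [a, b'])"
        using rec True a' b' by simp
      then show ?thesis
        using ballot_recurrence_solution[OF 2 _ _ C2[unfolded of_nat_add], of "real (specht_dim [a, b'])" "real ((a + b') choose b')"]
          1 C1 a' b' by (simp add: algebra_simps)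
    next
      case False
      then have ab: "a = b" using Suc by simp
      have "real (specht_dim [a, b]) * (real a + 1) = real ((a + b') choose b') * 2"
        using rec 1 ab b' by simp
      moreover have "real ((a + b) choose b) = real ((a + b') choose b') * 2"
        using C1 ab a' by (simp add: field_simps)
      ultimately show ?thesis using ab by simp
    qed
  qed
qed

section \<open>The 6j symbols with a spin one half\<close>

lemma rfact_nat [simp]: "rfact (real m) = fact m"
  by (simp add: rfact_def)

lemma half_nat_spin: "spin (real m / 2)"
  by (simp add: spin_def)

text \<open>The three triangle defects \<open>p\<close>, \<open>q\<close>, \<open>r\<close> are free
  natural numbers. In these parameters a triad is automatically admissible and every factorial has a
  natural argument.\<close>

lemma triangle_nat:
  assumes a: "a = real (p + q) / 2" and b: "b = real (p + r) / 2" and c: "c = real (q + r) / 2"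
  shows "triad a b c" and "(triangle_coeff a b c)\<^sup>2 = fact p * fact q * fact r / fact (p + q + r + 1)"
proof -
  have "a + b + c = real (p + q + r)" unfolding a b c by (simp add: field_simps)
  then have "a + b + c \<in> \<int>" by (metis Ints_of_nat)
  then show "triad a b c"
    using half_nat_spin unfolding triad_def a b c by (simp del: of_nat_add) (auto simp: abs_if field_simps)
  have "a + b - c = real p" "a - b + c = real q" "- a + b + c = real r" "a + b + c + 1 = real (p + q + r + 1)"
    unfolding a b c by (simp_all add: field_simps)
  then have "triangle_coeff a b c = sqrt (fact p * fact q * fact r / fact (p + q + r + 1))"
    unfolding triangle_coeff_def by (simp only: rfact_nat)
  then show "(triangle_coeff a b c)\<^sup>2 = fact p * fact q * fact r / fact (p + q + r + 1)"
    by simp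
qed

lemma fact_shift2: "fact m / fact (m + 2) = (1 / ((real m + 1) * (real m + 2)) :: real)"
proof -
  have *: "fact (m + 2) = (real m + 2) * ((real m + 1) * fact m)" by (simp add: algebra_simps)
  then show ?thesis unfolding * by simp
qed

text \<open>If a lower and an upper limit of Racah's sum meet, a single term remains. This happens
  whenever one spin is one half, and squaring removes its sign.\<close>

lemma wigner6j_square_single_term:
  fixes t a1 a2 a3 a4 b1 b2 b3 :: nat
  assumes triads: "triad j1 j2 j3" "triad j1 j5 j6" "triad j4 j2 j6" "triad j4 j5 j3"
    and a: "real t - j1 - j2 - j3 = real a1" "real t - j1 - j5 - j6 = real a2"
      "real t - j4 - j2 - j6 = real a3" "real t - j4 - j5 - j3 = real a4"
    and b: "j1 + j2 + j4 + j5 - real t = real b1" "j2 + j3 + j5 + j6 - real t = real b2"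
      "j3 + j1 + j6 + j4 - real t = real b3"
    and tight: "a1 = 0 \<or> a2 = 0 \<or> a3 = 0 \<or> a4 = 0" "b1 = 0 \<or> b2 = 0 \<or> b3 = 0"
  shows "(wigner6j j1 j2 j3 j4 j5 j6)\<^sup>2 =
    (triangle_coeff j1 j2 j3)\<^sup>2 * (triangle_coeff j1 j5 j6)\<^sup>2 * (triangle_coeff j4 j2 j6)\<^sup>2 * (triangle_coeff j4 j5 j3)\<^sup>2 *
    (fact (t + 1) / (fact a1 * fact a2 * fact a3 * fact a4 * fact b1 * fact b2 * fact b3))\<^sup>2"
proof -
  have "{t :: nat. j1 + j2 + j3 \<le> real t \<and> j1 + j5 + j6 \<le> real t \<and> j4 + j2 + j6 \<le> real t \<and> j4 + j5 + j3 \<le> real t \<and>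
      real t \<le> j1 + j2 + j4 + j5 \<and> real t \<le> j2 + j3 + j5 + j6 \<and> real t \<le> j3 + j1 + j6 + j4} = {t}"
    (is "?S = _")
  proof -
    have "t' = t" if "t' \<in> ?S" for t'
    proof -
      have "real t \<le> real t'"
        using that a tight(1) unfolding mem_Collect_eq by (elim disjE) (simp only: of_nat_0, linarith)+
      moreover have "real t' \<le> real t"
        using that b tight(2) unfolding mem_Collect_eq by (elim disjE) (simp only: of_nat_0, linarith)+
      ultimately show ?thesis by simp
    qed
    moreover have "t \<in> ?S"
      using a b of_nat_0_le_iff[of a1, where 'a = real] of_nat_0_le_iff[of a2, where 'a = real]
        of_nat_0_le_iff[of a3, where 'a = real] of_nat_0_le_iff[of a4, where 'a = real]
        of_nat_0_le_iff[of b1, where 'a = real] of_nat_0_le_iff[of b2, where 'a = real]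
        of_nat_0_le_iff[of b3, where 'a = real] unfolding mem_Collect_eq by linarith
    ultimately show ?thesis by blast
  qed
  then have "wigner6j j1 j2 j3 j4 j5 j6 = triangle_coeff j1 j2 j3 * triangle_coeff j1 j5 j6 * triangle_coeff j4 j2 j6 * triangle_coeff j4 j5 j3 *
      ((-1) ^ t * fact (t + 1) / (fact a1 * fact a2 * fact a3 * fact a4 * fact b1 * fact b2 * fact b3))"
    using triads unfolding wigner6j_def
    by (simp only: simp_thms if_True sum.insert sum.empty finite.emptyI empty_iff not_False_eq_True a b rfact_nat add_0_right)
  then show ?thesis
    by (simp add: power_mult_distrib power_divide flip: power_mult)
qed

text \<open>The first of the four symbols with a spin one half. In the names, the first word tells
  how \<open>j1\<close> arises from \<open>j3\<close>, the spin of the complement, and the second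
  how \<open>j6\<close> arises from \<open>j4\<close>, the spin of the chosen set.\<close>

lemma wigner6j_lower_raise:
  fixes x y z :: nat
  assumes j: "j1 = real (x + y) / 2" "j2 = real (1) / 2" "j3 = real (x + y + 1) / 2" "j4 = real (x + z) / 2" "j5 = real (y + 1 + z) / 2" "j6 = real (x + z + 1) / 2"
  shows "(wigner6j j1 j2 j3 j4 j5 j6)\<^sup>2 = (real y + 1) * (real z + 1) / ((real x + real y + 1) * (real x + real y + 2) * (real x + real z + 1) * (real x + real z + 2))"
proof -
  let ?t = "x + y + z + 1"
  \<comment> \<open>Naming one factorial and expressing its successor through it leaves an identity
    of rational functions.\<close>
  define G where "G = (fact (x + y + z + 1) :: real)"
  have G2: "fact (x + y + z + 2) = (real x + real y + real z + 2) * G"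
    unfolding G_def by (simp add: algebra_simps)
  have G_pos: "G > 0" unfolding G_def by simp
  have T0: "triad j1 j2 j3" "(triangle_coeff j1 j2 j3)\<^sup>2 = 1 / ((real (x + y) + 1) * (real (x + y) + 2))"
    using triangle_nat[of j1 "0" "x + y" j2 "1" j3] fact_shift2[of "x + y"] by (simp_all add: j del: of_nat_add)
  have T1: "triad j1 j5 j6" "(triangle_coeff j1 j5 j6)\<^sup>2 = (real z + 1) * (fact x * fact y * fact z) / ((real x + real y + real z + 2) * G)"
    using triangle_nat[of j1 "y" "x" j5 "z + 1" j6] unfolding G2 G_def by (simp_all add: j algebra_simps)
  have T2: "triad j4 j2 j6" "(triangle_coeff j4 j2 j6)\<^sup>2 = 1 / ((real (x + z) + 1) * (real (x + z) + 2))"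
    using triangle_nat[of j4 "0" "x + z" j2 "1" j6] fact_shift2[of "x + z"] by (simp_all add: j del: of_nat_add)
  have T3: "triad j4 j5 j3" "(triangle_coeff j4 j5 j3)\<^sup>2 = (real y + 1) * (fact x * fact y * fact z) / ((real x + real y + real z + 2) * G)"
    using triangle_nat[of j4 "z" "x" j5 "y + 1" j3] unfolding G2 G_def by (simp_all add: j algebra_simps)
  have "(wigner6j j1 j2 j3 j4 j5 j6)\<^sup>2 = (triangle_coeff j1 j2 j3)\<^sup>2 * (triangle_coeff j1 j5 j6)\<^sup>2 *
      (triangle_coeff j4 j2 j6)\<^sup>2 * (triangle_coeff j4 j5 j3)\<^sup>2 *
      (fact (x + y + z + 1 + 1) / (fact z * fact 0 * fact y * fact 0 * fact 0 * fact 1 * fact x))\<^sup>2"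
    by (rule wigner6j_square_single_term) (simp_all add: T0 T1 T2 T3, simp_all add: j field_simps)
  also have "fact (x + y + z + 1 + 1) = (real x + real y + real z + 2) * G"
    using G2 by simp
  finally show ?thesis
    unfolding T0(2) T1(2) T2(2) T3(2) using G_pos by (simp add: power2_eq_square divide_simps) (simp add: mult_ac)
qed

lemma wigner6j_lower_lower:
  fixes x y z :: nat
  assumes j: "j1 = real (x + y) / 2" "j2 = real (1) / 2" "j3 = real (x + 1 + y) / 2" "j4 = real (x + 1 + z) / 2" "j5 = real (y + z) / 2" "j6 = real (x + z) / 2"
  shows "(wigner6j j1 j2 j3 j4 j5 j6)\<^sup>2 = (real x + 1) * (real x + real y + real z + 2) / ((real x + real y + 1) * (real x + real y + 2) * (real x + real z + 1) * (real x + real z + 2))"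
proof -
  let ?t = "x + y + z + 1"
  define G where "G = (fact (x + y + z + 1) :: real)"
  have G2: "fact (x + y + z + 2) = (real x + real y + real z + 2) * G"
    unfolding G_def by (simp add: algebra_simps)
  have G_pos: "G > 0" unfolding G_def by simp
  have T0: "triad j1 j2 j3" "(triangle_coeff j1 j2 j3)\<^sup>2 = 1 / ((real (x + y) + 1) * (real (x + y) + 2))"
    using triangle_nat[of j1 "0" "x + y" j2 "1" j3] fact_shift2[of "x + y"] by (simp_all add: j del: of_nat_add)
  have T1: "triad j1 j5 j6" "(triangle_coeff j1 j5 j6)\<^sup>2 = fact x * fact y * fact z / G"
    using triangle_nat[of j1 "y" "x" j5 "z" j6] unfolding G2 G_def by (simp_all add: j algebra_simps)
  have T2: "triad j4 j2 j6" "(triangle_coeff j4 j2 j6)\<^sup>2 = 1 / ((real (x + z) + 1) * (real (x + z) + 2))"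
    using triangle_nat[of j4 "1" "x + z" j2 "0" j6] fact_shift2[of "x + z"] by (simp_all add: j del: of_nat_add)
  have T3: "triad j4 j5 j3" "(triangle_coeff j4 j5 j3)\<^sup>2 = (real x + 1) * (fact x * fact y * fact z) / ((real x + real y + real z + 2) * G)"
    using triangle_nat[of j4 "z" "x + 1" j5 "y" j3] unfolding G2 G_def by (simp_all add: j algebra_simps)
  have "(wigner6j j1 j2 j3 j4 j5 j6)\<^sup>2 = (triangle_coeff j1 j2 j3)\<^sup>2 * (triangle_coeff j1 j5 j6)\<^sup>2 *
      (triangle_coeff j4 j2 j6)\<^sup>2 * (triangle_coeff j4 j5 j3)\<^sup>2 *
      (fact (x + y + z + 1 + 1) / (fact z * fact 1 * fact y * fact 0 * fact 0 * fact 0 * fact x))\<^sup>2"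
    by (rule wigner6j_square_single_term) (simp_all add: T0 T1 T2 T3, simp_all add: j field_simps)
  also have "fact (x + y + z + 1 + 1) = (real x + real y + real z + 2) * G"
    using G2 by simp
  finally show ?thesis
    unfolding T0(2) T1(2) T2(2) T3(2) using G_pos by (simp add: power2_eq_square divide_simps)
qed

lemma wigner6j_raise_raise:
  fixes x y z :: nat
  assumes j: "j1 = real (x + y + 1) / 2" "j2 = real (1) / 2" "j3 = real (x + y) / 2" "j4 = real (x + z) / 2" "j5 = real (y + z) / 2" "j6 = real (x + z + 1) / 2"
  shows "(wigner6j j1 j2 j3 j4 j5 j6)\<^sup>2 = (real x + 1) * (real x + real y + real z + 2) / ((real x + real y + 1) * (real x + real y + 2) * (real x + real z + 1) * (real x + real z + 2))"
proof -
  let ?t = "x + y + z + 1"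
  define G where "G = (fact (x + y + z + 1) :: real)"
  have G2: "fact (x + y + z + 2) = (real x + real y + real z + 2) * G"
    unfolding G_def by (simp add: algebra_simps)
  have G_pos: "G > 0" unfolding G_def by simp
  have T0: "triad j1 j2 j3" "(triangle_coeff j1 j2 j3)\<^sup>2 = 1 / ((real (x + y) + 1) * (real (x + y) + 2))"
    using triangle_nat[of j1 "1" "x + y" j2 "0" j3] fact_shift2[of "x + y"] by (simp_all add: j del: of_nat_add)
  have T1: "triad j1 j5 j6" "(triangle_coeff j1 j5 j6)\<^sup>2 = (real x + 1) * (fact x * fact y * fact z) / ((real x + real y + real z + 2) * G)"
    using triangle_nat[of j1 "y" "x + 1" j5 "z" j6] unfolding G2 G_def by (simp_all add: j algebra_simps)
  have T2: "triad j4 j2 j6" "(triangle_coeff j4 j2 j6)\<^sup>2 = 1 / ((real (x + z) + 1) * (real (x + z) + 2))"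
    using triangle_nat[of j4 "0" "x + z" j2 "1" j6] fact_shift2[of "x + z"] by (simp_all add: j del: of_nat_add)
  have T3: "triad j4 j5 j3" "(triangle_coeff j4 j5 j3)\<^sup>2 = fact x * fact y * fact z / G"
    using triangle_nat[of j4 "z" "x" j5 "y" j3] unfolding G2 G_def by (simp_all add: j algebra_simps)
  have "(wigner6j j1 j2 j3 j4 j5 j6)\<^sup>2 = (triangle_coeff j1 j2 j3)\<^sup>2 * (triangle_coeff j1 j5 j6)\<^sup>2 *
      (triangle_coeff j4 j2 j6)\<^sup>2 * (triangle_coeff j4 j5 j3)\<^sup>2 *
      (fact (x + y + z + 1 + 1) / (fact z * fact 0 * fact y * fact 1 * fact 0 * fact 0 * fact x))\<^sup>2"
    by (rule wigner6j_square_single_term) (simp_all add: T0 T1 T2 T3, simp_all add: j field_simps)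
  also have "fact (x + y + z + 1 + 1) = (real x + real y + real z + 2) * G"
    using G2 by simp
  finally show ?thesis
    unfolding T0(2) T1(2) T2(2) T3(2) using G_pos by (simp add: power2_eq_square divide_simps)
qed

lemma wigner6j_raise_lower:
  fixes x y z :: nat
  assumes j: "j1 = real (x + y + 1) / 2" "j2 = real (1) / 2" "j3 = real (x + y) / 2" "j4 = real (x + z + 1) / 2" "j5 = real (y + z + 1) / 2" "j6 = real (x + z) / 2"
  shows "(wigner6j j1 j2 j3 j4 j5 j6)\<^sup>2 = (real z + 1) * (real y + 1) / ((real x + real y + 1) * (real x + real y + 2) * (real x + real z + 1) * (real x + real z + 2))"
proof -
  let ?t = "x + y + z + 1"
  define G where "G = (fact (x + y + z + 1) :: real)"
  have G2: "fact (x + y + z + 2) = (real x + real y + real z + 2) * G"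
    unfolding G_def by (simp add: algebra_simps)
  have G_pos: "G > 0" unfolding G_def by simp
  have T0: "triad j1 j2 j3" "(triangle_coeff j1 j2 j3)\<^sup>2 = 1 / ((real (x + y) + 1) * (real (x + y) + 2))"
    using triangle_nat[of j1 "1" "x + y" j2 "0" j3] fact_shift2[of "x + y"] by (simp_all add: j del: of_nat_add)
  have T1: "triad j1 j5 j6" "(triangle_coeff j1 j5 j6)\<^sup>2 = (real y + 1) * (fact x * fact y * fact z) / ((real x + real y + real z + 2) * G)"
    using triangle_nat[of j1 "y + 1" "x" j5 "z" j6] unfolding G2 G_def by (simp_all add: j algebra_simps)
  have T2: "triad j4 j2 j6" "(triangle_coeff j4 j2 j6)\<^sup>2 = 1 / ((real (x + z) + 1) * (real (x + z) + 2))"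
    using triangle_nat[of j4 "1" "x + z" j2 "0" j6] fact_shift2[of "x + z"] by (simp_all add: j del: of_nat_add)
  have T3: "triad j4 j5 j3" "(triangle_coeff j4 j5 j3)\<^sup>2 = (real z + 1) * (fact x * fact y * fact z) / ((real x + real y + real z + 2) * G)"
    using triangle_nat[of j4 "z + 1" "x" j5 "y" j3] unfolding G2 G_def by (simp_all add: j algebra_simps)
  have "(wigner6j j1 j2 j3 j4 j5 j6)\<^sup>2 = (triangle_coeff j1 j2 j3)\<^sup>2 * (triangle_coeff j1 j5 j6)\<^sup>2 *
      (triangle_coeff j4 j2 j6)\<^sup>2 * (triangle_coeff j4 j5 j3)\<^sup>2 *
      (fact (x + y + z + 1 + 1) / (fact z * fact 0 * fact y * fact 0 * fact 1 * fact 0 * fact x))\<^sup>2"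
    by (rule wigner6j_square_single_term) (simp_all add: T0 T1 T2 T3, simp_all add: j field_simps)
  also have "fact (x + y + z + 1 + 1) = (real x + real y + real z + 2) * G"
    using G2 by simp
  finally show ?thesis
    unfolding T0(2) T1(2) T2(2) T3(2) using G_pos by (simp add: power2_eq_square divide_simps) (simp add: mult_ac)
qed

section \<open>Transfer weights\<close>

text \<open>Only the three triangle inequalities remain. Adding them in pairs gives back
  \<open>2 * j \<le> n - i\<close> and \<open>2 * l \<le> i\<close>.\<close>

lemma valid_iff:
  assumes "2 * k \<le> n"
  shows "valid n k (i, j, l) \<longleftrightarrow> i \<le> n \<and> j + l \<le> k \<and> i + j + k \<le> n + l \<and> k + l \<le> i + j"
  using assms by (auto simp: Let_def)

declare valid.simps [simp del]

lemma valid_range: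
  assumes "2 * k \<le> n" "valid n k (i, j, l)"
  shows "i \<le> n" "2 * j \<le> n - i" "2 * l \<le> i"
  using assms by (auto simp: valid_iff)

text \<open>The symmetry exchanging a set with its complement; it derives removal of a site from
  addition.\<close>

lemma valid_swap: "2 * k \<le> n \<Longrightarrow> i \<le> n \<Longrightarrow> valid n k (n - i, l, j) \<longleftrightarrow> valid n k (i, j, l)"
  by (auto simp: valid_iff)

definition coupling_num :: "real \<Rightarrow> real \<Rightarrow> real \<Rightarrow> real" where
  "coupling_num E c d = E - c * (c + 1) - d * (d + 1) + 2 * c * (d + 1)"

text \<open>The factors measure the distance to the boundary of the triangle inequalities. They are
  the reason why a coefficient leading out of the valid region vanishes.\<close>

lemma coupling_num_factor: "coupling_num (e * (e + 1)) c d = (e + c - d) * (e - c + d + 1)"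
  by (simp add: coupling_num_def algebra_simps)

text \<open>Signed spins merge the four closed forms into one. The normalizing factor in
  \<open>coupling\<close> cancels two of the four linear factors of their common
  denominator.\<close>

lemma coupling_square:
  assumes k: "2 * k \<le> n" and v: "valid n k (i, j, l)" "valid n k (Suc i, j', l')"
    and nb: "j' = j \<or> Suc j' = j" "l' = l \<or> l' = Suc l"
  defines "c \<equiv> signed_spin (j' = j) (spin_of (n - i) j)" and "d \<equiv> signed_spin (l' = l) (spin_of i l)"
  shows "(coupling n k (i, j, l) (Suc i, j', l'))\<^sup>2 = coupling_num (eigval n k) c d / (2 * c * (2 * d + 1))"
proof -
  have in_n: "i \<le> n" using v valid_iff[OF k] by auto
  let ?c = "(real n - real i) / 2 - real j" and ?f = "real (Suc i) / 2 - real l'"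
  define w where "w = wigner6j ((real n - real (Suc i)) / 2 - real j') (1/2) ?c (real i / 2 - real l) (real n / 2 - real k) ?f"
  have cpl: "(coupling n k (i, j, l) (Suc i, j', l'))\<^sup>2 = (2 * ?c + 1) * (2 * ?f + 1) * w\<^sup>2"
  proof -
    have "0 \<le> ?c" using valid_range[OF k v(1)] spin_of_nonneg[of j "n - i"] in_n by (simp add: spin_of_def of_nat_diff)
    moreover have "0 \<le> ?f" using valid_range[OF k v(2)] spin_of_nonneg[of l' "Suc i"] by (simp add: spin_of_def)
    ultimately show ?thesis by (simp add: Let_def power_mult_distrib w_def)
  qed
  have cd: "c = signed_spin (j' = j) ?c" "d = signed_spin (l' = l) (real i / 2 - real l)"
    "eigval n k = (real n / 2 - real k) * (real n / 2 - real k + 1)"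
    using in_n by (simp_all add: c_def d_def spin_of_def of_nat_diff eigval_def)
  note vs = v[unfolded valid_iff[OF k]]
  let ?den = "\<lambda>x y z. (real x + real y + 1) * (real x + real y + 2) * (real x + real z + 1) * (real x + real z + 2)"
  consider "j' = j" "l' = l" | "j' = j" "l' = Suc l" | "j = Suc j'" "l' = l" | "j = Suc j'" "l' = Suc l"
    using nb by auto
  then show ?thesis
  proof cases
    case 1
    define x where "x = k - (j + l)"
    \<comment> \<open>Validity of the target triple supplies the additional one, so the subtraction
      is exact. The other cases obtain their slack in the same way.\<close>
    define y where "y = n + l - (i + j + k + 1)"
    define z where "z = i + j - (k + l)"
    have e: "real k = real j + real l + real x" "real n = real i + real j + real k + real y + 1 - real l" "real i = real k + real l + real z - real j"
      using vs 1 unfolding x_def y_def z_def by auto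
    have "w\<^sup>2 = (real y + 1) * (real z + 1) / ?den x y z"
      unfolding w_def by (rule wigner6j_lower_raise) (simp_all add: 1 e field_simps)
    then show ?thesis
      unfolding cpl cd signed_spin_def coupling_num_factor using 1 by (simp add: e divide_simps) (simp add: algebra_simps)
  next
    case 2
    define x where "x = k - (j + l + 1)"
    define y where "y = n + l - (i + j + k)"
    define z where "z = i + j - (k + l)"
    have e: "real k = real j + real l + real x + 1" "real n = real i + real j + real k + real y - real l" "real i = real k + real l + real z - real j"
      using vs 2 unfolding x_def y_def z_def by auto
    have "w\<^sup>2 = (real x + 1) * (real x + real y + real z + 2) / ?den x y z"
      unfolding w_def by (rule wigner6j_lower_lower) (simp_all add: 2 e field_simps)
    then show ?thesis
      unfolding cpl cd signed_spin_def coupling_num_factor using 2 by (simp add: e divide_simps) (simp add: algebra_simps)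
  next
    case 3
    define x where "x = k - (j + l)"
    define y where "y = n + l - (i + j + k)"
    define z where "z = i + j - (k + l)"
    have e: "real k = real j + real l + real x" "real n = real i + real j + real k + real y - real l" "real i = real k + real l + real z - real j"
      using vs 3 unfolding x_def y_def z_def by auto
    have "w\<^sup>2 = (real x + 1) * (real x + real y + real z + 2) / ?den x y z"
      unfolding w_def by (rule wigner6j_raise_raise) (use 3 e in \<open>simp_all add: field_simps\<close>)
    then show ?thesis
      unfolding cpl cd signed_spin_def coupling_num_factor using 3 e by (simp add: divide_simps) (simp add: algebra_simps)
  next
    case 4
    define x where "x = k - (j + l)"
    define y where "y = n + l - (i + j + k)"
    define z where "z = i + j - (k + l + 1)"
    have e: "real k = real j + real l + real x" "real n = real i + real j + real k + real y - real l" "real i = real k + real l + real z + 1 - real j"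
      using vs 4 unfolding x_def y_def z_def by auto
    have "w\<^sup>2 = (real z + 1) * (real y + 1) / ?den x y z"
      unfolding w_def by (rule wigner6j_raise_lower) (use 4 e in \<open>simp_all add: field_simps\<close>)
    then show ?thesis
      unfolding cpl cd signed_spin_def coupling_num_factor using 4 e by (simp add: divide_simps) (simp add: algebra_simps)
  qed
qed

lemma specht_dim_pos: "b \<le> a \<Longrightarrow> 0 < real (specht_dim [a, b])"
proof -
  assume "b \<le> a"
  then have "0 < real ((a + b) choose b) * (real a - real b + 1)" by (intro mult_pos_pos) auto
  then have "0 < real (specht_dim [a, b]) * (real a + 1)" using specht_dim_closed_form[OF \<open>b \<le> a\<close>] by simp
  then show ?thesis by (simp add: zero_less_mult_iff)
qed

text \<open>The quotient of ballot numbers is rational in the signed spin. Its factor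
  \<open>2 * c\<close> is the one that occurs in the denominator of
  \<open>coupling_square\<close>.\<close>

lemma specht_dim_ratio:
  assumes "2 * j \<le> Suc m" "2 * j' \<le> m" "j' = j \<or> Suc j' = j"
  defines "c \<equiv> signed_spin (j' = j) (spin_of (Suc m) j)"
  shows "real (Suc m) * (real (specht_dim [m - j', j']) / real (specht_dim [Suc m - j, j]))
    = 2 * c * (real (Suc m) / 2 + c + 1) / (2 * c + 1)"
proof -
  let ?F = "real (specht_dim [Suc m - j, j])" and ?F' = "real (specht_dim [m - j', j'])"
  have pos: "?F > 0" by (rule specht_dim_pos) (use assms in auto)
  have F: "?F * (real m + 2 - real j) = real (Suc m choose j) * (real m + 2 - 2 * real j)"
    using specht_dim_closed_form[of j "Suc m - j"] assms by (simp add: of_nat_diff algebra_simps)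
  have F': "?F' * (real m + 1 - real j') = real (m choose j') * (real m + 1 - 2 * real j')"
    using specht_dim_closed_form[of j' "m - j'"] assms by (simp add: of_nat_diff algebra_simps)
  have jm: "2 * real j \<le> real m + 1" "2 * real j' \<le> real m" using assms by linarith+
  have cross: "real (Suc m) * ?F' * (2 * c + 1) = 2 * c * (real (Suc m) / 2 + c + 1) * ?F"
  proof (cases "j' = j")
    case True
    have "(Suc m - j) * (Suc m choose j) = Suc m * (m choose j)"
      using binomial_absorb_comp[of "Suc m" j] by simp
    then have "(real (Suc m) - real j) * real (Suc m choose j) = real (Suc m) * real (m choose j)"
      using assms(1) by (metis of_nat_mult of_nat_diff le_trans mult_2 le_add1)
    then have B: "real (Suc m) * real (m choose j) = (real m + 1 - real j) * real (Suc m choose j)"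
      by (simp add: algebra_simps)
    have c: "2 * c = real m + 1 - 2 * real j" unfolding c_def signed_spin_def spin_of_def using True by (simp add: field_simps)
    have ne: "real m + 1 - real j \<noteq> 0" using jm True by linarith
    have "real (Suc m) * ?F' * (real m + 1 - real j) = real (Suc m) * real (m choose j) * (real m + 1 - 2 * real j)"
      using F' True by simp
    also have "\<dots> = real (Suc m choose j) * (real m + 1 - 2 * real j) * (real m + 1 - real j)"
      unfolding B by (simp add: mult_ac)
    finally have 1: "real (Suc m) * ?F' = real (Suc m choose j) * (real m + 1 - 2 * real j)"
      unfolding mult_right_cancel[OF ne] .
    have "real (Suc m) * ?F' * (2 * c + 1) = (2 * c) * (?F * (real m + 2 - real j))"
      unfolding 1 F c by (simp add: algebra_simps)
    also have "real m + 2 - real j = real (Suc m) / 2 + c + 1" using c by (simp add: field_simps)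
    finally show ?thesis by (simp add: mult_ac)
  next
    case False
    then have j: "j = Suc j'" using assms by simp
    have B: "real (Suc m) * real (m choose j') = real j * real (Suc m choose j)"
      using Suc_times_binomial_eq[of m j'] unfolding j by (metis mult.commute of_nat_mult)
    have c: "2 * c = - (real m + 1 - 2 * real j) - 2" unfolding c_def signed_spin_def spin_of_def using False by (simp add: field_simps)
    have ne: "real m + 2 - real j \<noteq> 0" using jm j by linarith
    have "?F' * (real m + 2 - real j) = real (m choose j') * (real m + 3 - 2 * real j)"
      using F' j by (simp add: algebra_simps)
    then have "real (Suc m) * ?F' * (real m + 2 - real j) = real (Suc m) * real (m choose j') * (real m + 3 - 2 * real j)"
      by (simp only: mult.assoc)
    also have "\<dots> = real j * real (Suc m choose j) * (real m + 3 - 2 * real j)"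
      unfolding B ..
    finally have 1: "real (Suc m) * ?F' * (real m + 2 - real j) = real j * real (Suc m choose j) * (real m + 3 - 2 * real j)" .
    have "real (Suc m) * ?F' * (2 * c + 1) * (real m + 2 - real j) = real j * real (Suc m choose j) * (real m + 3 - 2 * real j) * (2 * c + 1)"
      using 1 by (simp add: mult_ac)
    also have "\<dots> = (2 * c) * real j * (?F * (real m + 2 - real j))"
      unfolding F c by (simp add: algebra_simps)
    finally have "real (Suc m) * ?F' * (2 * c + 1) = 2 * c * real j * ?F"
      unfolding mult.assoc[symmetric] mult_right_cancel[OF ne] .
    moreover have "real j = real (Suc m) / 2 + c + 1" using c by (simp add: field_simps)
    ultimately show ?thesis by simp
  qed
  have "2 * c + 1 \<noteq> 0" unfolding c_def by (rule signed_spin(2)[OF assms(1)])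
  then show ?thesis using cross pos by (simp add: field_simps)
qed

lemma transfer_coeff_neighbour:
  assumes "j' = j \<or> Suc j' = j" "l' = l \<or> l' = Suc l" "2 * j \<le> m" "2 * l \<le> i"
  defines "c \<equiv> signed_spin (j' = j) (spin_of m j)" and "d \<equiv> signed_spin (l' = l) (spin_of i l)"
  shows "transfer_coeff m i k j l j' l' = (real m / 2 + c + 1) * coupling_num (eigval (m + i) k) c d / ((2 * c + 1) * (2 * d + 1))"
proof -
  have "c * (c + 1) = eigval m j" "d * (d + 1) = eigval i l"
    using signed_spin(1) assms by auto
  then show ?thesis
    using assms(1,2) unfolding transfer_coeff_def Let_def c_def[symmetric] d_def[symmetric] coupling_num_def by simp
qed

lemma signed_spin_lower_nonzero:
  assumes "2 * j \<le> Suc m" "2 * j' \<le> m" "j' = j \<or> Suc j' = j"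
  shows "signed_spin (j' = j) (spin_of (Suc m) j) \<noteq> 0"
proof (cases "j' = j")
  case True
  then have "2 * real j \<le> real m" using assms by linarith
  with True show ?thesis by (simp add: signed_spin_def spin_of_def field_simps)
next
  case False
  then show ?thesis using spin_of_nonneg[OF assms(1)] by (simp add: signed_spin_def)
qed

text \<open>If the larger level is valid and the smaller is not, one triangle inequality fails by
  exactly one, and the corresponding factor of \<open>coupling_num\<close> is zero. The neighbour
  with \<open>j' = j\<close> and \<open>l' = Suc l\<close> cannot lose validity, so three cases
  remain.\<close>

lemma transfer_coeff_invalid:
  assumes k: "2 * k \<le> n" and v: "valid n k (Suc i, j', l')" "\<not> valid n k (i, j, l)"
    and r: "2 * j \<le> n - i" "2 * l \<le> i"
  shows "transfer_coeff (n - i) i k j l j' l' = 0"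
proof (cases "(j' = j \<or> Suc j' = j) \<and> (l' = l \<or> l' = Suc l)")
  case False
  then show ?thesis unfolding transfer_coeff_def by auto
next
  case True
  have in_n: "i < n" using v(1) valid_iff[OF k] by auto
  note vs = v(1)[unfolded valid_iff[OF k]] v(2)[unfolded valid_iff[OF k]]
  consider "j' = j" "l' = l" "k + l = i + j + 1" | "j = Suc j'" "l' = l" "j + l = k + 1" | "j = Suc j'" "l' = Suc l" "i + j + k = n + l + 1"
    using True vs by auto
  then have "coupling_num (eigval n k) (signed_spin (j' = j) (spin_of (n - i) j)) (signed_spin (l' = l) (spin_of i l)) = 0"
  proof cases
    case 1
    then have e: "real l = real i + real j + 1 - real k" by linarith
    then show ?thesis unfolding eigval_def coupling_num_factor
      using 1 in_n by (simp add: e signed_spin_def spin_of_def of_nat_diff field_simps)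
  next
    case 2
    then have e: "real k = real j + real l - 1" by linarith
    then show ?thesis unfolding eigval_def coupling_num_factor
      using 2 in_n by (simp add: e signed_spin_def spin_of_def of_nat_diff field_simps)
  next
    case 3
    then have e: "real i = real n + real l + 1 - real j - real k" by linarith
    then show ?thesis unfolding eigval_def coupling_num_factor
      using 3 in_n by (simp add: e signed_spin_def spin_of_def of_nat_diff field_simps)
  qed
  then show ?thesis
    using transfer_coeff_neighbour[of j' j l' l "n - i" i k] True r in_n by simp
qed

lemma up_step_iff:
  "up_step n k (i, j, l) (i', j', l') \<longleftrightarrow> valid n k (i, j, l) \<and> valid n k (i', j', l') \<and> i' = Suc i \<and>
    (j' = j \<or> Suc j' = j) \<and> (l' = l \<or> l' = Suc l)"
  by (auto simp: valid.simps)

text \<open>The dimension quotient and the squared 6j symbol combine to the coefficient of the move;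
  their factors \<open>2 * c\<close> cancel because the signed spin is nonzero for an admissible
  removal.\<close>

lemma weight_up:
  assumes k: "2 * k \<le> n" "0 < n" and v: "valid n k (i, j, l)" "valid n k (Suc i, j', l')"
  shows "real n * weight n k (i, j, l) (Suc i, j', l') = transfer_coeff (n - i) i k j l j' l'"
proof (cases "(j' = j \<or> Suc j' = j) \<and> (l' = l \<or> l' = Suc l)")
  case False
  then have "transfer_coeff (n - i) i k j l j' l' = 0" unfolding transfer_coeff_def by auto
  moreover have "weight n k (i, j, l) (Suc i, j', l') = 0"
    unfolding weight_def up_step_iff using False by auto
  ultimately show ?thesis by simp
next
  case True
  then have step: "up_step n k (i, j, l) (Suc i, j', l')" using v unfolding up_step_iff by auto
  define c where "c = signed_spin (j' = j) (spin_of (n - i) j)"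
  define d where "d = signed_spin (l' = l) (spin_of i l)"
  have r: "2 * j \<le> n - i" "2 * l \<le> i" "2 * j' \<le> n - Suc i" "i < n"
    using valid_range[OF k(1) v(1)] valid_range[OF k(1) v(2)] by auto
  have m: "n - i = Suc (n - Suc i)" using r by simp
  have c0: "c \<noteq> 0"
    unfolding c_def m using signed_spin_lower_nonzero[of j "n - Suc i" j'] r m True by simp
  have ratio: "real (n - i) * (real (specht_dim [n - Suc i - j', j']) / real (specht_dim [n - i - j, j]))
    = 2 * c * (real (n - i) / 2 + c + 1) / (2 * c + 1)"
    unfolding c_def m using specht_dim_ratio[of j "n - Suc i" j'] r m True by simp
  have "real n * weight n k (i, j, l) (Suc i, j', l')
     = (real (n - i) * (real (specht_dim [n - Suc i - j', j']) / real (specht_dim [n - i - j, j]))) * (coupling n k (i, j, l) (Suc i, j', l'))\<^sup>2"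
    unfolding weight_def using step k(2) r by (simp add: of_nat_diff del: up_step.simps coupling.simps)
  also have "\<dots> = 2 * c * (real (n - i) / 2 + c + 1) / (2 * c + 1) * (coupling_num (eigval n k) c d / (2 * c * (2 * d + 1)))"
    unfolding ratio c_def d_def using coupling_square[OF k(1) v] True by simp
  also have "\<dots> = (real (n - i) / 2 + c + 1) * coupling_num (eigval n k) c d / ((2 * c + 1) * (2 * d + 1))"
    using c0 by (simp add: divide_simps)
  also have "\<dots> = transfer_coeff (n - i) i k j l j' l'"
    using transfer_coeff_neighbour[of j' j l' l "n - i" i k] True r unfolding c_def d_def by simp
  finally show ?thesis .
qed

text \<open>The roles of the set and its complement are exchanged. Seen from the smaller level, the
  signed spins become \<open>d + 1/2\<close> and \<open>c - 1/2\<close>, and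
  \<open>coupling_num\<close> is invariant under this substitution.\<close>

lemma weight_down:
  assumes k: "2 * k \<le> n" "0 < n" and v: "valid n k (Suc i, j, l)" "valid n k (i, j', l')"
  shows "real n * weight n k (Suc i, j, l) (i, j', l') = transfer_coeff (Suc i) (n - Suc i) k l j l' j'"
proof (cases "(l' = l \<or> Suc l' = l) \<and> (j' = j \<or> j' = Suc j)")
  case False
  then have "transfer_coeff (Suc i) (n - Suc i) k l j l' j' = 0" unfolding transfer_coeff_def by auto
  moreover have "weight n k (Suc i, j, l) (i, j', l') = 0"
    unfolding weight_def up_step_iff using False by auto
  ultimately show ?thesis by simp
next
  case True
  then have step: "up_step n k (i, j', l') (Suc i, j, l)" "\<not> up_step n k (Suc i, j, l) (i, j', l')"
    using v unfolding up_step_iff by auto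
  define c where "c = signed_spin (l' = l) (spin_of (Suc i) l)"
  define d where "d = signed_spin (j' = j) (spin_of (n - Suc i) j)"
  have r: "2 * j \<le> n - Suc i" "2 * l \<le> Suc i" "2 * l' \<le> i" "2 * j' \<le> n - i" "i < n"
    using valid_range[OF k(1) v(1)] valid_range[OF k(1) v(2)] by auto
  have c0: "c \<noteq> 0"
    unfolding c_def using signed_spin_lower_nonzero[of l i l'] r True by simp
  have ratio: "real (Suc i) * (real (specht_dim [i - l', l']) / real (specht_dim [Suc i - l, l]))
    = 2 * c * (real (Suc i) / 2 + c + 1) / (2 * c + 1)"
    unfolding c_def using specht_dim_ratio[of l i l'] r True by simp
  have c1: "signed_spin (j = j') (spin_of (n - i) j') = d + 1/2"
    unfolding d_def using True r by (auto simp: signed_spin_def spin_of_def of_nat_diff field_simps)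
  have d1: "signed_spin (l = l') (spin_of i l') = c - 1/2"
    unfolding c_def using True r by (auto simp: signed_spin_def spin_of_def field_simps)
  have "(coupling n k (i, j', l') (Suc i, j, l))\<^sup>2
      = coupling_num (eigval n k) (d + 1/2) (c - 1/2) / (2 * (d + 1/2) * (2 * (c - 1/2) + 1))"
    using coupling_square[OF k(1) v(2,1)] True unfolding c1 d1 by auto
  also have "\<dots> = coupling_num (eigval n k) c d / (2 * c * (2 * d + 1))"
    by (intro arg_cong2[of _ _ _ _ "(/)"]) (simp_all add: coupling_num_def algebra_simps)
  finally have cs: "(coupling n k (i, j', l') (Suc i, j, l))\<^sup>2 = coupling_num (eigval n k) c d / (2 * c * (2 * d + 1))" .
  have "real n * weight n k (Suc i, j, l) (i, j', l')
     = (real (Suc i) * (real (specht_dim [i - l', l']) / real (specht_dim [Suc i - l, l]))) * (coupling n k (i, j', l') (Suc i, j, l))\<^sup>2"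
    unfolding weight_def using step k(2) by (simp del: up_step.simps coupling.simps)
  also have "\<dots> = (real (Suc i) / 2 + c + 1) * coupling_num (eigval n k) c d / ((2 * c + 1) * (2 * d + 1))"
    unfolding ratio cs using c0 by (simp add: divide_simps)
  also have "\<dots> = transfer_coeff (Suc i) (n - Suc i) k l j l' j'"
    using transfer_coeff_neighbour[of l' l j' j "Suc i" "n - Suc i" k] True r unfolding c_def d_def by simp
  finally show ?thesis .
qed

section \<open>Detailed balance of the transfer weights\<close>

lemma mult_dim_pos:
  assumes "2 * k \<le> n" "valid n k \<omega>"
  shows "0 < mult_dim n \<omega>"
proof -
  obtain i j l where w: "\<omega> = (i, j, l)" by (cases \<omega>)
  have r: "i \<le> n" "2 * j \<le> n - i" "2 * l \<le> i"
    using valid_range[OF assms(1), of i j l] assms(2) w by simp_all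
  have "0 < real (specht_dim [n - i - j, j])" by (rule specht_dim_pos) (use r in auto)
  moreover have "0 < real (specht_dim [i - l, l])" by (rule specht_dim_pos) (use r in auto)
  moreover have "0 < real (n choose i)" using r by simp
  ultimately show ?thesis unfolding w by simp
qed

lemma balance_algebra:
  fixes f g' :: real
  assumes "C * u = C' * u'" "f \<noteq> 0" "g' \<noteq> 0"
  shows "C * f * g * (u / n * (f' / f) * K) = C' * f' * g' * (u' / n * (g / g') * K)"
proof -
  have "C * f * g * (u / n * (f' / f) * K) = (C * u) * (g * f' * K / n)" using assms(2) by simp
  also have "\<dots> = C' * f' * g' * (u' / n * (g / g') * K)" unfolding assms(1) using assms(3) by simp
  finally show ?thesis .
qed

text \<open>Both directions share the squared coupling, the dimension quotients are built to cancel,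
  and the binomial factors agree because \<open>(n choose i) * (n - i)\<close> counts the same pairs
  as \<open>(n choose Suc i) * Suc i\<close>.\<close>

lemma detailed_balance_up:
  assumes k: "2 * k \<le> n" "0 < n" and v: "valid n k (i, j, l)" "valid n k (Suc i, j', l')"
  shows "mult_dim n (i, j, l) * weight n k (i, j, l) (Suc i, j', l') = mult_dim n (Suc i, j', l') * weight n k (Suc i, j', l') (i, j, l)"
proof -
  have no: "\<not> up_step n k (Suc i, j', l') (i, j, l)" unfolding up_step_iff by simp
  show ?thesis
  proof (cases "up_step n k (i, j, l) (Suc i, j', l')")
    case False
    with no show ?thesis unfolding weight_def by (simp only: if_False mult_zero_right)
  next
    case True
    have r: "2 * j \<le> n - i" "2 * l \<le> i" "2 * j' \<le> n - Suc i" "2 * l' \<le> Suc i" "i < n"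
      using valid_range[OF k(1) v(1)] valid_range[OF k(1) v(2)] by auto
    have "0 < real (specht_dim [n - i - j, j])" by (rule specht_dim_pos) (use r in auto)
    moreover have "0 < real (specht_dim [Suc i - l', l'])" by (rule specht_dim_pos) (use r in auto)
    moreover have "real (n choose i) * (real n - real i) = real (n choose Suc i) * (real i + 1)"
    proof -
      have "(n choose i) * (n - i) = (n choose Suc i) * Suc i"
        using binomial_absorption[of i n] binomial_absorb_comp[of n i] by (simp add: mult.commute)
      then have "real (n choose i) * real (n - i) = real (n choose Suc i) * real (Suc i)" by (metis of_nat_mult)
      then show ?thesis using r by (simp add: of_nat_diff algebra_simps)
    qed
    ultimately show ?thesis
      unfolding weight_def if_P[OF True] if_not_P[OF no] mult_dim.simps dim_left.simps dim_right.simps fst_conv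
      using balance_algebra[of "real (n choose i)" "real n - real i" "real (n choose Suc i)" "real i + 1"] by simp
  qed
qed

lemma detailed_balance:
  assumes k: "2 * k \<le> n" "0 < n" and v: "valid n k \<omega>" "valid n k \<nu>"
  shows "mult_dim n \<omega> * weight n k \<omega> \<nu> = mult_dim n \<nu> * weight n k \<nu> \<omega>"
proof -
  obtain i j l i' j' l' where w: "\<omega> = (i, j, l)" "\<nu> = (i', j', l')" by (cases \<omega>, cases \<nu>)
  consider "i' = Suc i" | "i = Suc i'" | "i' \<noteq> Suc i" "i \<noteq> Suc i'" by blast
  then show ?thesis
  proof cases
    case 1
    then show ?thesis using detailed_balance_up[OF k] v w by simp
  next
    case 2
    then show ?thesis using detailed_balance_up[OF k, of i' j' l' j l] v w by simp
  next
    case 3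
    then show ?thesis unfolding weight_def w by (simp add: up_step_iff del: up_step.simps)
  qed
qed

lemma weight_nonneg: "i \<le> n \<Longrightarrow> 0 \<le> weight n k (i, j, l) \<nu>"
  unfolding weight_def by (auto intro!: mult_nonneg_nonneg divide_nonneg_nonneg)

section \<open>Normalization of the weights and summation over all sets of one size\<close>

definition level :: "nat \<Rightarrow> nat \<Rightarrow> nat \<Rightarrow> (nat \<times> nat) set" where
  "level n k i = {(j, l). valid n k (i, j, l)}"

lemma finite_level: "2 * k \<le> n \<Longrightarrow> finite (level n k i)"
  by (rule finite_subset[of _ "{..k} \<times> {..k}"]) (auto simp: level_def valid_iff)

text \<open>The coefficient of a neighbour that is not valid vanishes, so all four formal neighbours may be summed.\<close>

lemma sum_weight_down:
  assumes k: "2 * k \<le> n" "0 < n" and v: "valid n k (Suc i, j', l')"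
  shows "(\<Sum>(j, l)\<in>level n k i. real n * weight n k (Suc i, j', l') (i, j, l)) = real (Suc i)"
proof -
  define f where "f = spin_of (Suc i) l'"
  define a where "a = spin_of (n - Suc i) j'"
  define T where "T C A = (real (Suc i) / 2 + C + 1) * coupling_num (eigval n k) C A / ((2 * C + 1) * (2 * A + 1))" for C A
  have r: "2 * j' \<le> n - Suc i" "2 * l' \<le> Suc i" "i < n" using valid_range[OF k(1) v] by auto
  have pos: "0 \<le> f" "0 \<le> a" unfolding f_def a_def using r by (auto intro: spin_of_nonneg)
  note vs = v[unfolded valid_iff[OF k(1)]]
  have fe: "f = (real i + 1) / 2 - real l'" "a = (real n - real i - 1) / 2 - real j'" "eigval n k = (real n / 2 - real k) * (real n / 2 - real k + 1)"
    unfolding f_def a_def spin_of_def eigval_def using r by (simp_all add: of_nat_diff)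
  define g where "g j l = (if valid n k (i, j, l) then real n * weight n k (Suc i, j', l') (i, j, l) else 0)" for j l
  have gT: "g j l = T (signed_spin (l = l') f) (signed_spin (j = j') a)"
    if "valid n k (i, j, l)" "l = l' \<or> Suc l = l'" "j = j' \<or> j = Suc j'" for j l
    unfolding g_def using that weight_down[OF k v that(1)] r transfer_coeff_neighbour[of l l' j j' "Suc i" "n - Suc i" k]
    by (simp add: T_def f_def a_def)
  have g0: "real n * weight n k (Suc i, j', l') (i, j, l) = 0"
    if "\<not> ((l = l' \<or> Suc l = l') \<and> (j = j' \<or> j = Suc j'))" for j l
    using that unfolding weight_def up_step_iff by auto
  have g1: "g j' l' = T f a"
  proof (cases "valid n k (i, j', l')")
    case True then show ?thesis using gT[of j' l'] by (simp add: signed_spin_def)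
  next
    case False
    then have "i + 1 + j' = k + l'" using vs k(1) unfolding valid_iff[OF k(1)] by auto
    then have e: "real l' = real i + 1 + real j' - real k" by linarith
    have "coupling_num (eigval n k) f a = 0"
      unfolding fe coupling_num_factor by (simp add: e field_simps)
    then show ?thesis using False by (simp add: g_def T_def)
  qed
  have g2: "g (Suc j') l' = T f (- a - 1)"
  proof (cases "valid n k (i, Suc j', l')")
    case True then show ?thesis using gT[of "Suc j'" l'] by (simp add: signed_spin_def)
  next
    case False
    then have "j' + l' = k" using vs k(1) unfolding valid_iff[OF k(1)] by auto
    then have e: "real k = real j' + real l'" by linarith
    have "coupling_num (eigval n k) f (- a - 1) = 0"
      unfolding fe coupling_num_factor by (simp add: e field_simps)
    then show ?thesis using False by (simp add: g_def T_def)
  qed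
  \<comment> \<open>For \<open>l' = 0\<close> there is no neighbour with a smaller label, and the
    formal term vanishes because its first factor equals \<open>l'\<close>.\<close>
  have low: "T (- f - 1) A = 0" if "l' = 0" for A
    unfolding T_def fe using that by simp
  have g3: "g j' p = T (- f - 1) a" if l': "l' = Suc p" for p
  proof -
    have "valid n k (i, j', p)" using vs l' unfolding valid_iff[OF k(1)] by auto
    then show ?thesis using gT[of j' p] l' by (simp add: signed_spin_def)
  qed
  have g4: "g (Suc j') p = T (- f - 1) (- a - 1)" if l': "l' = Suc p" for p
  proof (cases "valid n k (i, Suc j', p)")
    case True then show ?thesis using gT[of "Suc j'" p] l' by (simp add: signed_spin_def)
  next
    case False
    then have "Suc i + j' + k = n + l'" using vs k(1) l' unfolding valid_iff[OF k(1)] by auto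
    then have e: "real n = real i + 1 + real j' + real k - real l'" by linarith
    have "coupling_num (eigval n k) (- f - 1) (- a - 1) = 0"
      unfolding fe coupling_num_factor by (simp add: e field_simps)
    then show ?thesis using False by (simp add: g_def T_def)
  qed
  \<comment> \<open>Adding both signs of \<open>a\<close> leaves only the part of
    \<open>coupling_num\<close> that is odd under \<open>a \<mapsto> - a - 1\<close>, which is
    linear in \<open>2 * a + 1\<close>. The sum over both signs of \<open>f\<close> in
    \<open>outer\<close> works in the same way.\<close>
  have inner: "T C a + T C (- a - 1) = (real (Suc i) / 2 + C + 1) * (2 * C) / (2 * C + 1)" if "2 * C + 1 \<noteq> 0" for C
  proof -
    have a1: "2 * a + 1 \<noteq> 0" "2 * (- a - 1) + 1 = - (2 * a + 1)" using pos by auto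
    have "coupling_num E C a / (2 * a + 1) - coupling_num E C (- a - 1) / (2 * a + 1) = 2 * C" for E
    proof -
      have "coupling_num E C a - coupling_num E C (- a - 1) = 2 * C * (2 * a + 1)"
        by (simp add: coupling_num_def algebra_simps)
      then show ?thesis using a1(1) unfolding diff_divide_distrib[symmetric] by simp
    qed
    then have "(real (Suc i) / 2 + C + 1) / (2 * C + 1) * (coupling_num (eigval n k) C a / (2 * a + 1) - coupling_num (eigval n k) C (- a - 1) / (2 * a + 1))
       = (real (Suc i) / 2 + C + 1) / (2 * C + 1) * (2 * C)" by simp
    then show ?thesis
      unfolding T_def a1(2) mult_minus_right minus_divide_right[symmetric] by (simp add: right_diff_distrib)
  qed
  have outer: "(real (Suc i) / 2 + f + 1) * (2 * f) / (2 * f + 1) + (real (Suc i) / 2 + (- f - 1) + 1) * (2 * (- f - 1)) / (2 * (- f - 1) + 1) = real (Suc i)"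
  proof -
    have f1: "2 * f + 1 \<noteq> 0" "2 * (- f - 1) + 1 = - (2 * f + 1)" using pos by auto
    have "(real (Suc i) / 2 + f + 1) * (2 * f) - (real (Suc i) / 2 + (- f - 1) + 1) * (2 * (- f - 1)) = real (Suc i) * (2 * f + 1)"
      by (simp add: field_simps)
    then show ?thesis
      unfolding f1(2) minus_divide_right[symmetric]
      by (simp only: add_uminus_conv_diff diff_divide_distrib[symmetric] nonzero_mult_div_cancel_right[OF f1(1)])
  qed
  have total: "T f a + T f (- a - 1) + (T (- f - 1) a + T (- f - 1) (- a - 1)) = real (Suc i)"
  proof -
    have 1: "2 * f + 1 \<noteq> 0" using pos by auto
    moreover have "2 * (- f - 1) + 1 = - (2 * f + 1)" by simp
    ultimately have 2: "2 * (- f - 1) + 1 \<noteq> 0" by (simp only: neg_equal_0_iff_equal not_False_eq_True)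
    show ?thesis unfolding inner[OF 1] inner[OF 2] by (rule outer)
  qed
  have "(\<Sum>(j, l)\<in>level n k i. real n * weight n k (Suc i, j', l') (i, j, l)) = (\<Sum>(j, l)\<in>{j', Suc j'} \<times> {l. l = l' \<or> Suc l = l'}. g j l)"
  proof (rule sum.mono_neutral_cong)
    have "{l. l = l' \<or> Suc l = l'} \<subseteq> {..l'}" by auto
    then have "finite {l. l = l' \<or> Suc l = l'}" by (rule finite_subset) simp
    then show "finite ({j', Suc j'} \<times> {l. l = l' \<or> Suc l = l'})" by simp
    show "finite (level n k i)" by (rule finite_level[OF k(1)])
  next
    fix p assume "p \<in> {j', Suc j'} \<times> {l. l = l' \<or> Suc l = l'} - level n k i"
    then show "(case p of (j, l) \<Rightarrow> g j l) = 0" by (auto simp: g_def level_def)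
  next
    fix p assume "p \<in> level n k i - {j', Suc j'} \<times> {l. l = l' \<or> Suc l = l'}"
    then show "(case p of (j, l) \<Rightarrow> real n * weight n k (Suc i, j', l') (i, j, l)) = 0"
      using g0[of "snd p" "fst p"] by (cases p) auto
  next
    fix p assume "p \<in> level n k i \<inter> ({j', Suc j'} \<times> {l. l = l' \<or> Suc l = l'})"
    then show "(case p of (j, l) \<Rightarrow> real n * weight n k (Suc i, j', l') (i, j, l)) = (case p of (j, l) \<Rightarrow> g j l)"
      by (auto simp: g_def level_def)
  qed
  also have "\<dots> = (\<Sum>l | l = l' \<or> Suc l = l'. g j' l + g (Suc j') l)"
    unfolding sum.cartesian_product[symmetric] by (subst sum.swap) simp
  also have "\<dots> = real (Suc i)"
  proof (cases l')
    case 0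
    then have "{l. l = l' \<or> Suc l = l'} = {l'}" by auto
    then show ?thesis using total g1 g2 low[OF 0] by simp
  next
    case (Suc p)
    then have "{l. l = l' \<or> Suc l = l'} = {l', p}" by auto
    then show ?thesis using total g1 g2 g3[OF Suc] g4[OF Suc] Suc by simp
  qed
  finally show ?thesis .
qed

definition cell :: "nat \<Rightarrow> nat \<Rightarrow> nat set \<Rightarrow> nat \<Rightarrow> nat \<Rightarrow> operator" where
  "cell n k S j l = proj ({..<n} - S) j * proj S l * proj {..<n} k"

lemma sum_level_range:
  fixes F :: "nat \<Rightarrow> nat \<Rightarrow> 'a::comm_monoid_add"
  assumes k: "2 * k \<le> n" and "\<And>j l. 2 * j \<le> n - i \<Longrightarrow> 2 * l \<le> i \<Longrightarrow> \<not> valid n k (i, j, l) \<Longrightarrow> F j l = 0"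
  shows "(\<Sum>j | 2 * j \<le> n - i. \<Sum>l | 2 * l \<le> i. F j l) = (\<Sum>(j, l)\<in>level n k i. F j l)"
  unfolding sum.cartesian_product
  by (rule sum.mono_neutral_right) (use assms valid_range[OF k] in \<open>auto simp: level_def\<close>)

lemma cell_up_sum:
  assumes k: "2 * k \<le> n" "0 < n" and S: "S \<subseteq> {..<n}" and v: "valid n k (Suc (card S), j', l')"
  shows "(\<Sum>t\<in>{..<n} - S. cell n k (insert t S) j' l')
    = (\<Sum>(j, l)\<in>level n k (card S). (real n * weight n k (card S, j, l) (Suc (card S), j', l')) *\<^sub>R cell n k S j l)"
proof -
  let ?U = "{..<n} - S" and ?i = "card S"
  have fin: "finite S" "finite ?U" "S \<inter> ?U = {}" using S finite_subset by auto
  have V: "S \<union> ?U = {..<n}" using S by auto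
  have cU: "card ?U = n - ?i" using S fin by (simp add: card_Diff_subset)
  have r: "2 * j' \<le> n - Suc ?i" "2 * l' \<le> Suc ?i" "?i < n" using valid_range[OF k(1) v] by auto
  have "(\<Sum>t\<in>?U. cell n k (insert t S) j' l') = (\<Sum>t\<in>?U. proj (?U - {t}) j' * proj (insert t S) l' * proj (S \<union> ?U) k)"
  proof (intro sum.cong refl)
    fix t
    have "{..<n} - insert t S = ?U - {t}" by auto
    then show "cell n k (insert t S) j' l' = proj (?U - {t}) j' * proj (insert t S) l' * proj (S \<union> ?U) k"
      unfolding cell_def V by simp
  qed
  also have "\<dots> = (\<Sum>j | 2 * j \<le> n - ?i. \<Sum>l | 2 * l \<le> ?i.
        transfer_coeff (n - ?i) ?i k j l j' l' *\<^sub>R cell n k S j l)"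
  proof -
    have "2 * k \<le> card (S \<union> ?U)" "2 * j' < card ?U" using k r unfolding V cU by auto
    from transfer_sum[OF fin this r(2)] show ?thesis unfolding cU V cell_def .
  qed
  also have "\<dots> = (\<Sum>(j, l)\<in>level n k ?i. transfer_coeff (n - ?i) ?i k j l j' l' *\<^sub>R cell n k S j l)"
    by (rule sum_level_range[OF k(1)]) (simp add: transfer_coeff_invalid[OF k(1) v])
  also have "\<dots> = (\<Sum>(j, l)\<in>level n k ?i. (real n * weight n k (?i, j, l) (Suc ?i, j', l')) *\<^sub>R cell n k S j l)"
    by (intro sum.cong refl) (auto simp: level_def weight_up[OF k _ v])
  finally show ?thesis .
qed

text \<open>Removing a site from \<open>S\<close> adds it to the complement, so
  \<open>transfer_sum\<close> is applied with the two sets and the labels \<open>j\<close> and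
  \<open>l\<close> exchanged.\<close>

lemma cell_down_sum:
  assumes k: "2 * k \<le> n" "0 < n" and S: "S \<subseteq> {..<n}" and v: "valid n k (i, j', l')" and i: "card S = Suc i"
  shows "(\<Sum>t\<in>S. cell n k (S - {t}) j' l')
    = (\<Sum>(j, l)\<in>level n k (Suc i). (real n * weight n k (Suc i, j, l) (i, j', l')) *\<^sub>R cell n k S j l)"
proof -
  let ?U = "{..<n} - S"
  have fin: "finite ?U" "finite S" "?U \<inter> S = {}" using S finite_subset by auto
  have V: "?U \<union> S = {..<n}" using S by auto
  have cU: "card ?U = n - Suc i" using S fin i by (simp add: card_Diff_subset)
  have in_n: "Suc i \<le> n" using card_mono[OF _ S] i by simp
  have r: "2 * j' \<le> n - i" "2 * l' \<le> i" using valid_range[OF k(1) v] by auto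
  have com: "proj S l * proj ({..<n} - S) j = proj ({..<n} - S) j * proj S l" for l j S
    by (rule proj_commute_proj) auto
  have "(\<Sum>t\<in>S. cell n k (S - {t}) j' l') = (\<Sum>t\<in>S. proj (S - {t}) l' * proj (insert t ?U) j' * proj (?U \<union> S) k)"
  proof (intro sum.cong refl)
    fix t assume "t \<in> S"
    then have "{..<n} - (S - {t}) = insert t ?U" using S by auto
    then show "cell n k (S - {t}) j' l' = proj (S - {t}) l' * proj (insert t ?U) j' * proj (?U \<union> S) k"
      unfolding cell_def V using com[of "S - {t}" l' j'] by simp
  qed
  also have "\<dots> = (\<Sum>l | 2 * l \<le> Suc i. \<Sum>j | 2 * j \<le> n - Suc i.
        transfer_coeff (Suc i) (n - Suc i) k l j l' j' *\<^sub>R cell n k S j l)"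
  proof -
    have "2 * k \<le> card (?U \<union> S)" "2 * l' < card S" "2 * j' \<le> Suc (card ?U)" using k r i in_n unfolding V cU by auto
    from transfer_sum[OF fin this] show ?thesis unfolding cU V cell_def com i .
  qed
  also have "\<dots> = (\<Sum>j | 2 * j \<le> n - Suc i. \<Sum>l | 2 * l \<le> Suc i.
        transfer_coeff (Suc i) (n - Suc i) k l j l' j' *\<^sub>R cell n k S j l)"
    by (rule sum.swap)
  also have "\<dots> = (\<Sum>(j, l)\<in>level n k (Suc i). transfer_coeff (Suc i) (n - Suc i) k l j l' j' *\<^sub>R cell n k S j l)"
  proof (rule sum_level_range[OF k(1)])
    fix j l assume jl: "2 * j \<le> n - Suc i" "2 * l \<le> Suc i" "\<not> valid n k (Suc i, j, l)"
    have "valid n k (Suc (n - Suc i), l', j')"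
      using valid_swap[OF k(1), of i l' j'] v in_n by (simp add: Suc_diff_Suc)
    moreover have "\<not> valid n k (n - Suc i, l, j)" using valid_swap[OF k(1) in_n] jl(3) by simp
    moreover have "n - (n - Suc i) = Suc i" using in_n by simp
    ultimately show "transfer_coeff (Suc i) (n - Suc i) k l j l' j' *\<^sub>R cell n k S j l = 0"
      using transfer_coeff_invalid[OF k(1), of "n - Suc i" l' j' l j] jl(1,2) by simp
  qed
  also have "\<dots> = (\<Sum>(j, l)\<in>level n k (Suc i). (real n * weight n k (Suc i, j, l) (i, j', l')) *\<^sub>R cell n k S j l)"
    by (intro sum.cong refl) (auto simp: level_def weight_down[OF k _ v])
  finally show ?thesis .
qed

text \<open>Double counting of pairs of a set and one of its elements.\<close>

lemma sum_cells_up: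
  fixes F :: "nat set \<Rightarrow> 'a::real_algebra_1"
  shows "(\<Sum>S | S \<subseteq> {..<n} \<and> card S = i. \<Sum>t\<in>{..<n} - S. F (insert t S)) = real (Suc i) *\<^sub>R (\<Sum>S | S \<subseteq> {..<n} \<and> card S = Suc i. F S)"
proof -
  let ?A = "{S. S \<subseteq> {..<n} \<and> card S = i}" and ?B = "{S. S \<subseteq> {..<n} \<and> card S = Suc i}"
  have fin: "finite ?A" "finite ?B" by (auto intro: finite_subset[of _ "Pow {..<n}"])
  have finS: "S \<subseteq> {..<n} \<Longrightarrow> finite S" for S using finite_subset by auto
  have "(\<Sum>S\<in>?A. \<Sum>t\<in>{..<n} - S. F (insert t S)) = (\<Sum>(S, t)\<in>Sigma ?A (\<lambda>S. {..<n} - S). F (insert t S))"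
    using fin by (simp add: sum.Sigma)
  also have "\<dots> = (\<Sum>(S, t)\<in>Sigma ?B (\<lambda>S. S). F S)"
    by (rule sum.reindex_bij_witness[of _ "\<lambda>(S, t). (S - {t}, t)" "\<lambda>(S, t). (insert t S, t)"])
      (auto simp: finS insert_absorb card_insert_if)
  also have "\<dots> = (\<Sum>S\<in>?B. \<Sum>t\<in>S. F S)"
    using fin finS by (subst sum.Sigma) auto
  also have "\<dots> = (\<Sum>S\<in>?B. real (Suc i) *\<^sub>R F S)"
    by (intro sum.cong refl) (simp add: of_nat_times del: of_nat_Suc)
  finally show ?thesis by (simp only: scaleR_sum_right)
qed

text \<open>By \<open>sum_cells_up\<close> and \<open>cell_up_sum\<close>, level
  \<open>i + 1\<close> is a combination of sums at level \<open>i\<close>, all proportional to the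
  total projection by induction. Detailed balance turns the upward weights into downward ones, whose
  total is \<open>sum_weight_down\<close>.\<close>

lemma sum_cells:
  assumes k: "2 * k \<le> n" "0 < n" and v: "valid n k (i, j, l)"
  shows "(\<Sum>S | S \<subseteq> {..<n} \<and> card S = i. cell n k S j l)
    = (mult_dim n (i, j, l) / real (specht_dim [n - k, k])) *\<^sub>R proj {..<n} k"
  using v
proof (induction i arbitrary: j l)
  case 0
  have jl: "j = k" "l = 0" using "0.prems" k(1) unfolding valid_iff[OF k(1)] by auto
  have "{S. S \<subseteq> {..<n} \<and> card S = 0} = {{}}"
    using finite_subset[of _ "{..<n}"] by (auto simp: card_eq_0_iff)
  moreover have "proj {} 0 = 1" using sum_proj[of "{}"] by simp
  moreover have "proj {..<n} k * proj {..<n} k = proj {..<n} k"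
    using proj_mult[of "{..<n}" k k] k by simp
  moreover have "specht_dim [n - k, k] > 0" using specht_dim_pos[of k "n - k"] k by simp
  ultimately show ?case using specht_dim_0 by (simp add: jl cell_def)
next
  case (Suc i)
  let ?d = "real (specht_dim [n - k, k])" and ?P = "proj {..<n} k"
  let ?r = "mult_dim n (Suc i, j, l) / ?d" and ?u = "\<lambda>j' l'. real n * weight n k (i, j', l') (Suc i, j, l)"
    and ?v = "\<lambda>j' l'. real n * weight n k (Suc i, j, l) (i, j', l')"
  let ?A = "{S. S \<subseteq> {..<n} \<and> card S = i}"
  have "real (Suc i) *\<^sub>R (\<Sum>S | S \<subseteq> {..<n} \<and> card S = Suc i. cell n k S j l)
      = (\<Sum>S\<in>?A. \<Sum>t\<in>{..<n} - S. cell n k (insert t S) j l)"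
    by (rule sum_cells_up[symmetric])
  also have "\<dots> = (\<Sum>S\<in>?A. \<Sum>(j', l')\<in>level n k i. (?u j' l') *\<^sub>R cell n k S j' l')"
    using cell_up_sum[OF k] Suc.prems by (intro sum.cong refl) auto
  also have "\<dots> = (\<Sum>(j', l')\<in>level n k i. (?u j' l') *\<^sub>R (\<Sum>S\<in>?A. cell n k S j' l'))"
    by (subst sum.swap) (simp add: scaleR_sum_right split_def)
  also have "\<dots> = (\<Sum>(j', l')\<in>level n k i. (?r * (?v j' l')) *\<^sub>R ?P)"
  proof (intro sum.cong refl, clarify)
    fix j' l' assume "(j', l') \<in> level n k i"
    then have v': "valid n k (i, j', l')" by (simp add: level_def)
    have "mult_dim n (i, j', l') * weight n k (i, j', l') (Suc i, j, l) = mult_dim n (Suc i, j, l) * weight n k (Suc i, j, l) (i, j', l')"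
      by (rule detailed_balance[OF k v' Suc.prems])
    then have "?u j' l' * (mult_dim n (i, j', l') / ?d) = ?r * (?v j' l')"
      by (simp add: mult_ac del: mult_dim.simps)
    then show "(?u j' l') *\<^sub>R (\<Sum>S\<in>?A. cell n k S j' l')
       = (?r * (?v j' l')) *\<^sub>R ?P"
      unfolding Suc.IH[OF v'] scaleR_scaleR by (simp only:)
  qed
  also have "\<dots> = (?r * (\<Sum>(j', l')\<in>level n k i. ?v j' l')) *\<^sub>R ?P"
    by (simp only: scaleR_sum_left sum_distrib_left split_def)
  also have "\<dots> = real (Suc i) *\<^sub>R ((?r) *\<^sub>R ?P)"
    unfolding sum_weight_down[OF k Suc.prems] by (simp only: scaleR_scaleR mult.commute)
  finally have eq: "real (Suc i) *\<^sub>R (\<Sum>S | S \<subseteq> {..<n} \<and> card S = Suc i. cell n k S j l)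
      = real (Suc i) *\<^sub>R ((?r) *\<^sub>R ?P)" .
  have "real (Suc i) \<noteq> 0" by simp
  then show ?case using eq unfolding scaleR_cancel_left by (simp only: simp_thms)
qed

section \<open>Traces on the finite chain\<close>

definition entry :: "operator \<Rightarrow> nat set \<Rightarrow> nat set \<Rightarrow> real" where
  "entry x A B = app x (\<lambda>C. if C = B then 1 else 0) A"

lemma entry_simps [simp]:
  "entry 0 A B = 0" "entry (x + y) A B = entry x A B + entry y A B"
  "entry (c *\<^sub>R x) A B = c * entry x A B" "entry (sum f I) A B = (\<Sum>i\<in>I. entry (f i) A B)"
  by (simp_all add: entry_def)

lemma entry_one [simp]: "entry 1 A B = (if A = B then 1 else 0)" "entry (of_real c) A B = (if A = B then c else 0)"
  by (simp_all add: entry_def)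

text \<open>No vector supported on the finite chain is moved out of it. Matrix products, and with
  them the cyclicity of the trace, can then be computed by sums over \<open>Pow {..<n}\<close>
  although the chain is infinite.\<close>

definition block_op :: "nat \<Rightarrow> operator \<Rightarrow> bool" where
  "block_op n x \<longleftrightarrow> (\<forall>B\<in>Pow {..<n}. \<forall>A. A \<notin> Pow {..<n} \<longrightarrow> entry x A B = 0)"

definition adjoint :: "nat \<Rightarrow> operator \<Rightarrow> operator \<Rightarrow> bool" where
  "adjoint n x y \<longleftrightarrow> (\<forall>A\<in>Pow {..<n}. \<forall>B\<in>Pow {..<n}. entry x A B = entry y B A)"

definition symmetric_op :: "nat \<Rightarrow> operator \<Rightarrow> bool" where
  "symmetric_op n x \<longleftrightarrow> block_op n x \<and> adjoint n x x"

lemma entry_mult: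
  assumes "block_op n y" "B \<in> Pow {..<n}"
  shows "entry (x * y) A B = (\<Sum>C\<in>Pow {..<n}. entry x A C * entry y C B)"
proof -
  have "app y (\<lambda>C. if C = B then 1 else 0) = (\<lambda>A. \<Sum>C\<in>Pow {..<n}. entry y C B * (if A = C then 1 else 0))"
  proof
    fix A
    show "app y (\<lambda>C. if C = B then 1 else 0) A = (\<Sum>C\<in>Pow {..<n}. entry y C B * (if A = C then 1 else 0))"
    proof (cases "A \<in> Pow {..<n}")
      case True
      then show ?thesis by (simp add: entry_def sum.delta' if_distrib[of "\<lambda>u. _ * u"] cong: if_cong)
    next
      case False
      then have "entry y A B = 0" using assms unfolding block_op_def by blast
      moreover have "(\<Sum>C\<in>Pow {..<n}. entry y C B * (if A = C then 1 else 0)) = 0"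
        using False by (intro sum.neutral) auto
      ultimately show ?thesis by (simp add: entry_def)
    qed
  qed
  then have "entry (x * y) A B = (\<Sum>C\<in>Pow {..<n}. entry y C B * app x (\<lambda>A. if A = C then 1 else 0) A)"
    unfolding entry_def[of "x * y"] by (simp add: app_sum_fun)
  then show ?thesis by (simp add: entry_def mult.commute)
qed

lemma block_op_mult: "block_op n x \<Longrightarrow> block_op n y \<Longrightarrow> block_op n (x * y)"
  unfolding block_op_def[of n "x * y"]
proof (intro ballI allI impI)
  fix A B assume xy: "block_op n x" "block_op n y" and AB: "B \<in> Pow {..<n}" "A \<notin> Pow {..<n}"
  have "entry x A C = 0" if "C \<in> Pow {..<n}" for C
    using xy(1) that AB(2) unfolding block_op_def by blast
  then show "entry (x * y) A B = 0"
    unfolding entry_mult[OF xy(2) AB(1)] by (intro sum.neutral) simp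
qed

lemma adjoint_mult:
  assumes "block_op n y" "block_op n x'" "adjoint n x x'" "adjoint n y y'"
  shows "adjoint n (x * y) (y' * x')"
  unfolding adjoint_def
proof (intro ballI)
  fix A B assume AB: "A \<in> Pow {..<n}" "B \<in> Pow {..<n}"
  show "entry (x * y) A B = entry (y' * x') B A"
    unfolding entry_mult[OF assms(1) AB(2)] entry_mult[OF assms(2) AB(1)]
    using assms(3,4) AB unfolding adjoint_def by (intro sum.cong refl) (simp add: mult.commute)
qed

lemma symmetric_op_mult:
  assumes "symmetric_op n x" "symmetric_op n y" "x * y = y * x"
  shows "symmetric_op n (x * y)"
  using assms adjoint_mult[of n y x x y] block_op_mult by (simp add: symmetric_op_def)

lemma symmetric_op_add: "symmetric_op n x \<Longrightarrow> symmetric_op n y \<Longrightarrow> symmetric_op n (x + y)"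
  by (simp add: symmetric_op_def block_op_def adjoint_def)

lemma symmetric_op_scaleR: "symmetric_op n x \<Longrightarrow> symmetric_op n (c *\<^sub>R x)"
  by (simp add: symmetric_op_def block_op_def adjoint_def)

lemma symmetric_op_of_real: "symmetric_op n (of_real c)"
  by (auto simp: symmetric_op_def block_op_def adjoint_def)

lemma symmetric_op_zero: "symmetric_op n 0"
  by (simp add: symmetric_op_def block_op_def adjoint_def)

lemma symmetric_op_sum: "(\<And>i. i \<in> I \<Longrightarrow> symmetric_op n (f i)) \<Longrightarrow> symmetric_op n (sum f I)"
  by (induction I rule: infinite_finite_induct) (auto intro: symmetric_op_add symmetric_op_zero)

lemma symmetric_op_tau:
  assumes "a < n" "b < n"
  shows "symmetric_op n (tau a b)"
proof -
  have inv: "transpose a b ` transpose a b ` A = A" for A by (simp add: image_comp)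
  have e: "entry (tau a b) A B = (if transpose a b ` A = B then 1 else 0)" for A B
    by (simp add: entry_def)
  have sw: "transpose a b ` A = B \<longleftrightarrow> transpose a b ` B = A" for A B using inv by blast
  have V: "transpose a b ` {..<n} = {..<n}" using assms by (intro transpose_image_eq) simp
  have sub: "A \<subseteq> {..<n}" if "transpose a b ` A \<subseteq> {..<n}" for A
    using image_mono[OF that, of "transpose a b"] unfolding inv V .
  have "block_op n (tau a b)"
    unfolding block_op_def e
  proof (intro ballI allI impI)
    fix A B assume AB: "B \<in> Pow {..<n}" "A \<notin> Pow {..<n}"
    then have "transpose a b ` A \<noteq> B" using sub[of A] by blast
    then show "(if transpose a b ` A = B then 1 else 0 :: real) = 0" by (simp only: if_False)
  qed
  moreover have "adjoint n (tau a b) (tau a b)"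
    unfolding adjoint_def e by (intro ballI if_cong sw refl)
  ultimately show ?thesis unfolding symmetric_op_def ..
qed

lemma symmetric_op_casimir: "S \<subseteq> {..<n} \<Longrightarrow> symmetric_op n (casimir S)"
  unfolding casimir_def
  by (intro symmetric_op_add symmetric_op_scaleR symmetric_op_sum symmetric_op_of_real symmetric_op_tau) auto

lemma symmetric_op_peval:
  assumes "symmetric_op n x"
  shows "symmetric_op n (peval p x)"
proof (induction p)
  case 0
  then show ?case by (simp add: symmetric_op_zero)
next
  case (pCons a p)
  have "x * peval p x = peval p x * x" by (rule peval_commute[symmetric]) simp
  then show ?case using pCons assms
    by (simp add: symmetric_op_add symmetric_op_of_real symmetric_op_mult)
qed

lemma symmetric_op_proj: "S \<subseteq> {..<n} \<Longrightarrow> symmetric_op n (proj S l)"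
  unfolding proj_def by (intro symmetric_op_peval symmetric_op_casimir)

definition trace :: "nat \<Rightarrow> operator \<Rightarrow> real" where
  "trace n x = (\<Sum>A\<in>Pow {..<n}. entry x A A)"

lemma trace_simps [simp]: "trace n 0 = 0" "trace n (x + y) = trace n x + trace n y" "trace n (c *\<^sub>R x) = c * trace n x"
  "trace n (sum f I) = (\<Sum>i\<in>I. trace n (f i))"
  by (auto simp: trace_def sum.distrib sum_distrib_left intro: sum.swap)

lemma trace_mult:
  "block_op n y \<Longrightarrow> trace n (x * y) = (\<Sum>A\<in>Pow {..<n}. \<Sum>C\<in>Pow {..<n}. entry x A C * entry y C A)"
  unfolding trace_def by (intro sum.cong refl entry_mult)

lemma trace_commute: "block_op n x \<Longrightarrow> block_op n y \<Longrightarrow> trace n (x * y) = trace n (y * x)"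
  by (simp add: trace_mult mult.commute) (rule sum.swap)

lemma trace_adjoint_mult:
  assumes "block_op n y" "adjoint n x y"
  shows "trace n (x * y) = (\<Sum>A\<in>Pow {..<n}. \<Sum>C\<in>Pow {..<n}. (entry x A C)\<^sup>2)"
  unfolding trace_mult[OF assms(1)] using assms(2)
  by (intro sum.cong refl) (auto simp: adjoint_def power2_eq_square)

lemma trace_square_nonneg: "symmetric_op n x \<Longrightarrow> 0 \<le> trace n (x * x)"
  by (subst trace_adjoint_mult) (auto simp: symmetric_op_def intro!: sum_nonneg)

text \<open>By cyclicity the trace is that of the transpose of \<open>p * q\<close> times
  \<open>p * q\<close>, a sum of squared entries.\<close>

lemma trace_projections_nonneg:
  assumes p: "symmetric_op n p" "p * p = p" and q: "symmetric_op n q" "q * q = q"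
  shows "0 \<le> trace n (p * q)"
proof -
  have b: "block_op n p" "block_op n q" using p q by (auto simp: symmetric_op_def)
  have "trace n (p * q) = trace n ((p * p * q) * q)"
    using p(2) q(2) by (simp add: mult.assoc)
  also have "\<dots> = trace n (q * (p * p * q))"
    using b by (intro trace_commute block_op_mult)
  also have "\<dots> = trace n ((q * p) * (p * q))" by (simp only: mult.assoc)
  also have "\<dots> \<ge> 0"
    using b p q by (subst trace_adjoint_mult)
      (auto simp: symmetric_op_def intro!: sum_nonneg block_op_mult adjoint_mult)
  finally show ?thesis .
qed

section \<open>A highest-weight vector and positivity of the trace\<close>

lemma app_peval_eigen:
  assumes "\<And>A. app x g A = e * g A"
  shows "app (peval p x) g A = poly p e * g A"
proof (induction p arbitrary: A)
  case (pCons a p)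
  have "app (peval p x) g = (\<lambda>A. poly p e * g A)" using pCons by auto
  then have "app x (app (peval p x) g) A = poly p e * (e * g A)" by (simp add: app_scale assms)
  then show ?case by (simp add: algebra_simps)
qed simp

definition pair_sign :: "nat \<Rightarrow> nat set \<Rightarrow> real" where
  "pair_sign r A = (if (2 * r \<in> A) = (Suc (2 * r) \<in> A) then 0 else if 2 * r \<in> A then 1 else -1)"

text \<open>The product of \<open>k\<close> singlets on the pairs \<open>{2 r, 2 r + 1}\<close>, with all other sites up.\<close>

definition singlets :: "nat \<Rightarrow> nat set \<Rightarrow> real" where
  "singlets k A = (if A \<subseteq> {..<2 * k} then \<Prod>r<k. pair_sign r A else 0)"

lemma singlets_support:
  assumes "singlets k A \<noteq> 0"
  shows "A \<subseteq> {..<2 * k}" "card A = k"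
proof -
  show sub: "A \<subseteq> {..<2 * k}" using assms by (auto simp: singlets_def split: if_splits)
  have one: "(2 * r \<in> A) \<noteq> (Suc (2 * r) \<in> A)" if "r < k" for r
  proof -
    have "pair_sign r A \<noteq> 0" using assms sub that by (auto simp: singlets_def)
    then show ?thesis by (auto simp: pair_sign_def split: if_splits)
  qed
  \<comment> \<open>Each of the \<open>k\<close> pairs carries exactly one down spin, so the index
    of the pair determines the element of \<open>A\<close>.\<close>
  have "bij_betw (\<lambda>a. a div 2) A {..<k}"
  proof (rule bij_betw_byWitness[of _ "\<lambda>r. if 2 * r \<in> A then 2 * r else Suc (2 * r)"])
    show "\<forall>a\<in>A. (if 2 * (a div 2) \<in> A then 2 * (a div 2) else Suc (2 * (a div 2))) = a"
    proof
      fix a assume a: "a \<in> A"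
      then have "a div 2 < k" using sub by auto
      from one[OF this] a show "(if 2 * (a div 2) \<in> A then 2 * (a div 2) else Suc (2 * (a div 2))) = a"
        by (cases "even a") (auto elim!: evenE oddE)
    qed
    show "\<forall>r\<in>{..<k}. (if 2 * r \<in> A then 2 * r else Suc (2 * r)) div 2 = r" by auto
    show "(\<lambda>a. a div 2) ` A \<subseteq> {..<k}" using sub by auto
    show "(\<lambda>r. if 2 * r \<in> A then 2 * r else Suc (2 * r)) ` {..<k} \<subseteq> A" using one by auto
  qed
  then show "card A = k" using bij_betw_same_card by fastforce
qed

lemma sum_pairs: "(\<Sum>a<2 * k. h a) = (\<Sum>r<k. h (2 * r) + h (Suc (2 * r)))" for h :: "nat \<Rightarrow> real"
  by (induction k) (auto simp: add.assoc)

text \<open>Raising either site of a pair gives the same configuration with opposite signs, so the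
  two contributions cancel pair by pair.\<close>

lemma raise_singlets:
  assumes "2 * k \<le> n"
  shows "(\<Sum>a<n. app (raise a) (singlets k) B) = 0"
proof -
  define h where "h a = (if a \<in> B then 0 else singlets k (insert a B))" for a
  have "(\<Sum>a<n. app (raise a) (singlets k) B) = (\<Sum>a<2 * k. h a)"
    using assms by (intro sum.mono_neutral_cong_right) (auto simp: h_def singlets_def)
  also have "\<dots> = (\<Sum>r<k. h (2 * r) + h (Suc (2 * r)))" by (rule sum_pairs)
  also have "\<dots> = 0"
  proof (rule sum.neutral, rule ballI)
    fix r assume "r \<in> {..<k}"
    then have r: "r < k" by simp
    define Q where "Q = (\<Prod>r'\<in>{..<k} - {r}. pair_sign r' B)"
    have s: "singlets k (insert a B) = (if B \<subseteq> {..<2 * k} then pair_sign r (insert a B) * Q else 0)"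
      if a: "a = 2 * r \<or> a = Suc (2 * r)" for a
    proof -
      have "a < 2 * k" using a r by auto
      have "(\<Prod>r'<k. pair_sign r' (insert a B)) = pair_sign r (insert a B) * (\<Prod>r'\<in>{..<k} - {r}. pair_sign r' (insert a B))"
        using r by (subst prod.remove[of _ r]) auto
      also have "(\<Prod>r'\<in>{..<k} - {r}. pair_sign r' (insert a B)) = Q"
        unfolding Q_def
      proof (intro prod.cong refl)
        fix r' assume "r' \<in> {..<k} - {r}"
        then have "r' \<noteq> r" by simp
        then have "2 * r' \<noteq> a" using a by presburger
        moreover have "Suc (2 * r') \<noteq> a" using a \<open>r' \<noteq> r\<close> by presburger
        ultimately show "pair_sign r' (insert a B) = pair_sign r' B" by (simp add: pair_sign_def)
      qed
      finally show ?thesis using \<open>a < 2 * k\<close> by (simp add: singlets_def)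
    qed
    have "h (2 * r) = (if 2 * r \<in> B then 0 else if B \<subseteq> {..<2 * k} then pair_sign r (insert (2 * r) B) * Q else 0)"
      "h (Suc (2 * r)) = (if Suc (2 * r) \<in> B then 0 else if B \<subseteq> {..<2 * k} then pair_sign r (insert (Suc (2 * r)) B) * Q else 0)"
      unfolding h_def using s by simp_all
    then show "h (2 * r) + h (Suc (2 * r)) = 0"
      by (auto simp: pair_sign_def)
  qed
  finally show ?thesis .
qed

text \<open>The vector is killed by the total raising operator and has \<open>n / 2 - k\<close> as
  its \<open>Z\<close> value, so the second form in \<open>casimir_ladder\<close> gives the
  eigenvalue.\<close>

lemma casimir_singlets:
  assumes "2 * k \<le> n"
  shows "app (casimir {..<n}) (singlets k) A = eigval n k * singlets k A"
proof -
  define R where "R = (\<Sum>a<n. raise a)"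
  define L where "L = (\<Sum>a<n. lower a)"
  define Z where "Z = (\<Sum>a<n. spinz a)"
  have "app R (singlets k) = (\<lambda>B. 0)"
    unfolding R_def using raise_singlets[OF assms] by (simp add: fun_eq_iff del: app_basic)
  then have LR: "app (L * R) (singlets k) A = 0" by simp
  have Z: "app Z (singlets k) B = spin_of n k * singlets k B" for B
  proof (cases "singlets k B = 0")
    case True
    then show ?thesis by (simp add: Z_def)
  next
    case False
    then have B: "B \<subseteq> {..<n}" "card B = k" using singlets_support[OF False] assms by auto
    have "(\<Sum>a<n. if a \<in> B then - (1/2) else 1/2 :: real) = (\<Sum>a<n. 1/2 - (if a \<in> B then 1 else 0))"
      by (intro sum.cong refl) auto
    also have "\<dots> = real n / 2 - real (card ({..<n} \<inter> B))"
      by (simp add: sum_subtractf sum.If_cases)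
    also have "{..<n} \<inter> B = B" using B by auto
    finally show ?thesis using B(2) by (simp add: Z_def spin_of_def sum_distrib_right[symmetric])
  qed
  have "app Z (singlets k) = (\<lambda>B. spin_of n k * singlets k B)" using Z by auto
  then have ZZ: "app (Z * Z) (singlets k) A = spin_of n k * (spin_of n k * singlets k A)"
    by (simp add: app_scale Z)
  show ?thesis
    using casimir_ladder(2)[of "{..<n}"] LR ZZ Z unfolding R_def[symmetric] L_def[symmetric] Z_def[symmetric]
    by (simp add: eigval_def algebra_simps)
qed

text \<open>The trace is the sum of the squared entries of the projection. Were it zero, the
  projection would annihilate the singlet vector, which it fixes.\<close>

lemma trace_proj_pos:
  assumes "2 * k \<le> n"
  shows "0 < trace n (proj {..<n} k)"
proof -
  let ?P = "proj {..<n} k"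
  have sym: "symmetric_op n ?P" by (rule symmetric_op_proj) simp
  have idem: "?P * ?P = ?P" using proj_mult[of "{..<n}" k k] assms by simp
  have tr: "trace n ?P = (\<Sum>A\<in>Pow {..<n}. \<Sum>C\<in>Pow {..<n}. (entry ?P A C)\<^sup>2)"
    using trace_adjoint_mult[of n ?P ?P] sym idem by (simp add: symmetric_op_def)
  have "trace n ?P \<noteq> 0"
  proof
    assume "trace n ?P = 0"
    then have z: "entry ?P A C = 0" if "A \<in> Pow {..<n}" "C \<in> Pow {..<n}" for A C
      using that unfolding tr by (subst (asm) sum_nonneg_eq_0_iff) (auto simp: sum_nonneg_eq_0_iff intro!: sum_nonneg)
    \<comment> \<open>The first site of every pair is down, so all signs are \<open>1\<close> and
      the amplitude is visibly nonzero.\<close>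
    define A0 where "A0 = (\<lambda>r. 2 * r) ` {..<k}"
    have A0: "A0 \<in> Pow {..<n}" using assms by (auto simp: A0_def)
    have "Suc (2 * r) \<notin> A0" for r unfolding A0_def by (auto dest: arg_cong[of _ _ even])
    then have psi1: "singlets k A0 = 1"
      by (auto simp: singlets_def A0_def pair_sign_def intro!: prod.neutral)
    have psi2: "singlets k A0 = app ?P (singlets k) A0"
      using app_peval_eigen[of "casimir {..<n}" "singlets k" "eigval n k" "lagrange n k" A0, OF casimir_singlets[OF assms]] poly_lagrange[of k n k] assms
      by (simp add: proj_def)
    have expand: "singlets k = (\<lambda>A. \<Sum>B\<in>Pow {..<n}. singlets k B * (if A = B then 1 else 0))"
    proof
      fix A
      show "singlets k A = (\<Sum>B\<in>Pow {..<n}. singlets k B * (if A = B then 1 else 0))"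
      proof (cases "A \<in> Pow {..<n}")
        case True
        then show ?thesis by (simp add: sum.delta' if_distrib[of "\<lambda>u. _ * u"] cong: if_cong)
      next
        case False
        have "singlets k A = 0"
        proof (rule ccontr)
          assume "singlets k A \<noteq> 0"
          then have "A \<subseteq> {..<2 * k}" by (rule singlets_support)
          also have "\<dots> \<subseteq> {..<n}" using assms by auto
          finally show False using False by simp
        qed
        moreover have "(\<Sum>B\<in>Pow {..<n}. singlets k B * (if A = B then 1 else 0)) = 0"
          using False by (intro sum.neutral) auto
        ultimately show ?thesis by simp
      qed
    qed
    have "app ?P (singlets k) A0 = app ?P (\<lambda>A. \<Sum>B\<in>Pow {..<n}. singlets k B * (if A = B then 1 else 0)) A0"
      by (rule arg_cong[OF expand])
    also have "\<dots> = (\<Sum>B\<in>Pow {..<n}. singlets k B * entry ?P A0 B)"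
      unfolding entry_def by (rule app_sum_fun)
    finally have "app ?P (singlets k) A0 = 0" using z A0 by (simp add: sum.neutral)
    then show False using psi1 psi2 by simp
  qed
  moreover have "trace n ?P \<ge> 0" unfolding tr by (intro sum_nonneg) auto
  ultimately show ?thesis by simp
qed

section \<open>Cells as symmetric projections\<close>

lemma cell_symmetric:
  assumes "S \<subseteq> {..<n}"
  shows "symmetric_op n (cell n k S j l)"
  unfolding cell_def
proof (intro symmetric_op_mult symmetric_op_proj)
  have c: "proj ({..<n} - S) j * proj S l = proj S l * proj ({..<n} - S) j"
    "proj ({..<n} - S) j * proj {..<n} k = proj {..<n} k * proj ({..<n} - S) j"
    "proj S l * proj {..<n} k = proj {..<n} k * proj S l"
    using assms by (auto intro!: proj_commute_proj)
  show "proj ({..<n} - S) j * proj S l = proj S l * proj ({..<n} - S) j" by (rule c)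
  show "proj ({..<n} - S) j * proj S l * proj {..<n} k = proj {..<n} k * (proj ({..<n} - S) j * proj S l)"
    using c by (metis mult.assoc)
qed (use assms in auto)

lemma cell_idem:
  assumes "2 * k \<le> n" "S \<subseteq> {..<n}" "2 * j \<le> n - card S" "2 * l \<le> card S"
  shows "cell n k S j l * cell n k S j l = cell n k S j l"
proof -
  let ?a = "proj ({..<n} - S) j" and ?b = "proj S l" and ?c = "proj {..<n} k"
  have fin: "finite S" using assms finite_subset by auto
  have c: "?a * ?b = ?b * ?a" "?a * ?c = ?c * ?a" "?b * ?c = ?c * ?b"
    using assms by (auto intro!: proj_commute_proj)
  have card: "card ({..<n} - S) = n - card S" using assms fin by (simp add: card_Diff_subset)
  have i: "?a * ?a = ?a" "?b * ?b = ?b" "?c * ?c = ?c"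
    using proj_mult[of "{..<n} - S" j j] proj_mult[of S l l] proj_mult[of "{..<n}" k k] assms fin card by auto
  have "(?a * ?b * ?c) * (?a * ?b * ?c) = (?a * ?a) * (?b * ?b) * (?c * ?c)"
    using c by (metis mult.assoc)
  then show ?thesis unfolding cell_def i .
qed

section \<open>The bound for codes\<close>

definition flip :: "nat \<Rightarrow> nat set \<Rightarrow> nat set" where
  "flip t S = (if t \<in> S then S - {t} else insert t S)"

lemma flip_flip [simp]: "flip t (flip t S) = S"
  by (auto simp: flip_def)

lemma flip_subset: "t < n \<Longrightarrow> flip t S \<subseteq> {..<n} \<longleftrightarrow> S \<subseteq> {..<n}"
  by (auto simp: flip_def)

lemma sum_flip:
  fixes F :: "nat set \<Rightarrow> 'a::comm_monoid_add"
  assumes "t < n"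
  shows "(\<Sum>S\<in>Pow {..<n}. F (flip t S)) = (\<Sum>S\<in>Pow {..<n}. F S)"
  by (rule sum.reindex_bij_witness[of _ "flip t" "flip t"]) (use flip_subset[OF assms] in auto)

text \<open>Extension by zero off the layer \<open>card S = i\<close>, so that triples of different
  levels can be summed over one common index set.\<close>

fun layer_cell :: "nat \<Rightarrow> nat \<Rightarrow> nat set \<Rightarrow> triple \<Rightarrow> operator" where
  "layer_cell n k S (i, j, l) = (if card S = i then cell n k S j l else 0)"

lemma layer_cell_symmetric: "S \<subseteq> {..<n} \<Longrightarrow> symmetric_op n (layer_cell n k S \<omega>)"
  by (cases \<omega>) (simp add: cell_symmetric symmetric_op_zero)

lemma layer_cell_idem:
  assumes "2 * k \<le> n" "S \<subseteq> {..<n}" "valid n k \<omega>"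
  shows "layer_cell n k S \<omega> * layer_cell n k S \<omega> = layer_cell n k S \<omega>"
proof -
  obtain i j l where w: "\<omega> = (i, j, l)" by (cases \<omega>)
  have "2 * j \<le> n - i" "2 * l \<le> i" using valid_range[OF assms(1), of i j l] assms(3) w by simp_all
  then show ?thesis using cell_idem[OF assms(1,2), of j l] by (simp add: w)
qed

text \<open>Sites outside \<open>S\<close> are added and sites inside are removed; for a given
  triple at most one of the two kinds reaches its layer.\<close>

lemma layer_cell_flip_sum:
  assumes k: "2 * k \<le> n" "0 < n" and S: "S \<subseteq> {..<n}" and v: "valid n k \<omega>"
  shows "(\<Sum>t<n. layer_cell n k (flip t S) \<omega>)
    = (\<Sum>(j, l)\<in>level n k (card S). (real n * weight n k (card S, j, l) \<omega>) *\<^sub>R cell n k S j l)"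
proof -
  obtain i j' l' where w: "\<omega> = (i, j', l')" by (cases \<omega>)
  have fin: "finite S" using S finite_subset by auto
  let ?f = "\<lambda>t. layer_cell n k (flip t S) \<omega>"
  have "(\<Sum>t<n. ?f t) = (\<Sum>t\<in>({..<n} - S) \<union> S. ?f t)"
    using S by (intro sum.cong) auto
  also have "\<dots> = (\<Sum>t\<in>{..<n} - S. ?f t) + (\<Sum>t\<in>S. ?f t)"
    using fin by (intro sum.union_disjoint) auto
  also have "(\<Sum>t\<in>{..<n} - S. ?f t) = (\<Sum>t\<in>{..<n} - S. if i = Suc (card S) then cell n k (insert t S) j' l' else 0)"
    using fin by (intro sum.cong refl) (auto simp: w flip_def)
  also have "(\<Sum>t\<in>S. ?f t) = (\<Sum>t\<in>S. if card S = Suc i then cell n k (S - {t}) j' l' else 0)"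
  proof (intro sum.cong refl)
    fix t assume t: "t \<in> S"
    then have "Suc (card (S - {t})) = card S" using fin by (rule card_Suc_Diff1[rotated])
    then have "card (S - {t}) = i \<longleftrightarrow> card S = Suc i" by linarith
    then show "?f t = (if card S = Suc i then cell n k (S - {t}) j' l' else 0)"
      using t by (simp add: w flip_def)
  qed
  finally have split: "(\<Sum>t<n. ?f t) = (\<Sum>t\<in>{..<n} - S. if i = Suc (card S) then cell n k (insert t S) j' l' else 0)
      + (\<Sum>t\<in>S. if card S = Suc i then cell n k (S - {t}) j' l' else 0)" .
  consider "i = Suc (card S)" | "card S = Suc i" | "i \<noteq> Suc (card S)" "card S \<noteq> Suc i" by blast
  then show ?thesis
  proof cases
    case 1
    then show ?thesis unfolding split using cell_up_sum[OF k S, of j' l'] v w by simp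
  next
    case 2
    then show ?thesis unfolding split using cell_down_sum[OF k S, of i j' l'] v w by simp
  next
    case 3
    then have "weight n k (card S, j, l) \<omega> = 0" for j l
      unfolding weight_def w up_step_iff by simp
    then show ?thesis unfolding split using 3 by (simp add: split_def)
  qed
qed

lemma sum_layer_cells:
  assumes k: "2 * k \<le> n" "0 < n" and v: "valid n k \<omega>"
  shows "(\<Sum>S\<in>Pow {..<n}. layer_cell n k S \<omega>) = (mult_dim n \<omega> / real (specht_dim [n - k, k])) *\<^sub>R proj {..<n} k"
proof -
  obtain i j l where w: "\<omega> = (i, j, l)" by (cases \<omega>)
  have "(\<Sum>S\<in>Pow {..<n}. layer_cell n k S \<omega>) = (\<Sum>S | S \<subseteq> {..<n} \<and> card S = i. cell n k S j l)"
    by (rule sum.mono_neutral_cong_right) (auto simp: w)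
  then show ?thesis using sum_cells[OF k, of i j l] v w by simp
qed

section \<open>Characters of the cube and the kernel of a code\<close>

definition chi :: "nat set \<Rightarrow> (nat \<Rightarrow> int) \<Rightarrow> real" where
  "chi S x = (\<Prod>t\<in>S. real_of_int (x t))"

lemma word_square: "x \<in> words n \<Longrightarrow> t < n \<Longrightarrow> real_of_int (x t) * real_of_int (x t) = 1"
  unfolding words_def by (drule PiE_mem[of _ _ _ t]) auto

lemma chi_flip:
  assumes "x \<in> words n" "S \<subseteq> {..<n}" "t < n"
  shows "chi (flip t S) x = real_of_int (x t) * chi S x"
proof (cases "t \<in> S")
  case True
  have "finite S" using assms finite_subset by auto
  then have "chi S x = real_of_int (x t) * chi (S - {t}) x" unfolding chi_def using True by (rule prod.remove)
  then show ?thesis using True word_square[OF assms(1,3)] by (simp add: flip_def flip: mult.assoc)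
next
  case False
  have "finite S" using assms finite_subset by auto
  then show ?thesis using False by (simp add: flip_def chi_def)
qed

lemma chi_square:
  assumes "x \<in> words n" "S \<subseteq> {..<n}"
  shows "chi S x * chi S x = 1"
  unfolding chi_def prod.distrib[symmetric]
  by (intro prod.neutral ballI word_square[OF assms(1)]) (use assms(2) in auto)

lemma inner_product_hamming:
  assumes "x \<in> words n" "y \<in> words n"
  shows "(\<Sum>t<n. real_of_int (x t) * real_of_int (y t)) = real n - 2 * real (hamming n x y)"
proof -
  have "(\<Sum>t<n. real_of_int (x t) * real_of_int (y t)) = (\<Sum>t<n. 1 - 2 * (if x t \<noteq> y t then 1 else 0))"
  proof (intro sum.cong refl)
    fix t assume "t \<in> {..<n}"
    then have "x t \<in> {-1, 1}" "y t \<in> {-1, 1}" using assms unfolding words_def by (auto dest!: PiE_mem)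
    then show "real_of_int (x t) * real_of_int (y t) = 1 - 2 * (if x t \<noteq> y t then 1 else 0)" by auto
  qed
  also have "\<dots> = real n - 2 * (\<Sum>t<n. if x t \<noteq> y t then 1 else 0)"
    by (simp add: sum_subtractf sum_distrib_left)
  also have "(\<Sum>t<n. if x t \<noteq> y t then 1 else 0 :: real) = real (hamming n x y)"
  proof -
    have "{i. i < n \<and> x i \<noteq> y i} = {..<n} \<inter> {i. x i \<noteq> y i}" by auto
    then show ?thesis unfolding hamming_def by (simp add: sum.If_cases)
  qed
  finally show ?thesis .
qed

lemma sum_swap_pairs:
  fixes f :: "'a \<Rightarrow> 'b \<Rightarrow> 'c \<Rightarrow> 'd \<Rightarrow> real"
  shows "(\<Sum>x\<in>A. \<Sum>y\<in>B. \<Sum>S\<in>V. \<Sum>T\<in>W. f x y S T) = (\<Sum>S\<in>V. \<Sum>T\<in>W. \<Sum>x\<in>A. \<Sum>y\<in>B. f x y S T)"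
proof -
  have inner: "(\<Sum>y\<in>B. \<Sum>S\<in>V. \<Sum>T\<in>W. f x y S T) = (\<Sum>S\<in>V. \<Sum>T\<in>W. \<Sum>y\<in>B. f x y S T)" for x
    by (subst sum.swap, rule sum.cong[OF refl], rule sum.swap)
  show ?thesis
    unfolding inner by (subst sum.swap, rule sum.cong[OF refl], rule sum.swap)
qed

lemma code_bound:
  assumes k: "2 * k \<le> n" "0 < n" and d: "2 * d \<le> n" and s: "s = 1 - 2 * real d / real n"
    and \<Omega>: "finite \<Omega>" "\<Omega> \<noteq> {}" "\<forall>\<omega>\<in>\<Omega>. valid n k \<omega>"
    and w: "\<And>\<omega>. \<omega> \<in> \<Omega> \<Longrightarrow> 0 < w \<omega>"
    and rate: "\<And>\<nu>. \<nu> \<in> \<Omega> \<Longrightarrow> r * w \<nu> \<le> (\<Sum>\<omega>\<in>\<Omega>. weight n k \<omega> \<nu> * w \<omega>)" and rs: "s < r"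
    and C: "C \<subseteq> words n" "\<And>x y. x \<in> C \<Longrightarrow> y \<in> C \<Longrightarrow> x \<noteq> y \<Longrightarrow> d \<le> hamming n x y"
  shows "real (card C) \<le> (1 - s) / (real (specht_dim [n - k, k]) * (r - s)) * profile_dim n \<Omega> w"
proof -
  let ?V = "Pow {..<n}" and ?d = "real (specht_dim [n - k, k])"
  let ?e = "\<lambda>x y S T. chi S x * chi S y * (chi T x * chi T y)"
    and ?ip = "\<lambda>(x :: nat \<Rightarrow> int) (y :: nat \<Rightarrow> int). \<Sum>t<n. real_of_int (x t) * real_of_int (y t)"
  let ?c = "layer_cell n k" and ?p = "proj {..<n} k"
  define D where "D = mult_dim n"
  define u where "u \<omega> = w \<omega> / D \<omega>" for \<omega>
  define M where "M S = (\<Sum>\<omega>\<in>\<Omega>. u \<omega> *\<^sub>R ?c S \<omega>)" for S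
  define N where "N S = (\<Sum>t<n. M (flip t S))" for S
  let ?q = "\<lambda>x y A. \<Sum>T\<in>?V. chi T x * chi T y * trace n (A * M T)"
  define \<tau> where "\<tau> = trace n (?p)"
  have Dpos: "0 < D \<omega>" if "\<omega> \<in> \<Omega>" for \<omega> using mult_dim_pos[OF k(1)] \<Omega>(3) that by (auto simp: D_def)
  have upos: "0 < u \<omega>" if "\<omega> \<in> \<Omega>" for \<omega> using w Dpos that by (simp add: u_def)
  have dpos: "0 < ?d" by (rule specht_dim_pos) (use k in simp)
  have \<tau>pos: "0 < \<tau>" unfolding \<tau>_def by (rule trace_proj_pos[OF k(1)])
  have finC: "finite C"
  proof (rule finite_subset[OF C(1)])
    show "finite (words n)" unfolding words_def by (intro finite_PiE) auto
  qed
  have symM: "symmetric_op n (M S)" if "S \<in> ?V" for S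
    unfolding M_def using that by (intro symmetric_op_sum symmetric_op_scaleR layer_cell_symmetric) auto
  have cells: "0 \<le> trace n (?c S \<omega> * ?c T \<nu>)" if "S \<in> ?V" "T \<in> ?V" "valid n k \<omega>" "valid n k \<nu>" for S T \<omega> \<nu>
    using that by (intro trace_projections_nonneg layer_cell_symmetric layer_cell_idem[OF k(1)]) auto
  have MM: "trace n (M S * M T) = (\<Sum>\<omega>\<in>\<Omega>. \<Sum>\<nu>\<in>\<Omega>. u \<omega> * u \<nu> * trace n (?c S \<omega> * ?c T \<nu>))" for S T
    unfolding M_def sum_product by (simp add: mult_ac)
  have MMpos: "0 \<le> trace n (M S * M T)" if "S \<in> ?V" "T \<in> ?V" for S T
    unfolding MM using that \<Omega>(3) by (intro sum_nonneg mult_nonneg_nonneg cells less_imp_le[OF upos]) auto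
  have N: "N S = (\<Sum>(j, l)\<in>level n k (card S). (real n * (\<Sum>\<omega>\<in>\<Omega>. u \<omega> * weight n k (card S, j, l) \<omega>)) *\<^sub>R cell n k S j l)" if "S \<in> ?V" for S
  proof -
    have "N S = (\<Sum>\<omega>\<in>\<Omega>. u \<omega> *\<^sub>R (\<Sum>t<n. ?c (flip t S) \<omega>))"
      unfolding N_def M_def scaleR_sum_right by (rule sum.swap)
    also have "\<dots> = (\<Sum>\<omega>\<in>\<Omega>. u \<omega> *\<^sub>R (\<Sum>(j, l)\<in>level n k (card S). (real n * weight n k (card S, j, l) \<omega>) *\<^sub>R cell n k S j l))"
      using that \<Omega>(3) by (intro sum.cong refl arg_cong[of _ _ "\<lambda>z. _ *\<^sub>R z"] layer_cell_flip_sum[OF k]) auto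
    also have "\<dots> = (\<Sum>(j, l)\<in>level n k (card S). (\<Sum>\<omega>\<in>\<Omega>. u \<omega> * (real n * weight n k (card S, j, l) \<omega>)) *\<^sub>R cell n k S j l)"
      unfolding scaleR_sum_right scaleR_sum_left split_def by (subst sum.swap) (simp only: scaleR_scaleR)
    finally show ?thesis by (simp add: sum_distrib_left mult_ac)
  qed
  \<comment> \<open>\<open>M S\<close> and \<open>N S\<close> are written over the same family of
    cells, so that their coefficients can be compared one by one.\<close>
  have M_level: "M S = (\<Sum>(j, l)\<in>level n k (card S). (if (card S, j, l) \<in> \<Omega> then u (card S, j, l) else 0) *\<^sub>R cell n k S j l)" for S
  proof -
    have "M S = (\<Sum>\<omega>\<in>(\<lambda>(j, l). (card S, j, l)) ` level n k (card S). (if \<omega> \<in> \<Omega> then u \<omega> else 0) *\<^sub>R ?c S \<omega>)"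
      unfolding M_def
    proof (rule sum.mono_neutral_cong)
      fix \<omega> assume "\<omega> \<in> \<Omega> - (\<lambda>(j, l). (card S, j, l)) ` level n k (card S)"
      then have "fst \<omega> \<noteq> card S" using \<Omega>(3) by (cases \<omega>) (force simp: level_def image_iff)
      then show "u \<omega> *\<^sub>R ?c S \<omega> = 0" by (cases \<omega>) simp
    qed (use \<Omega>(1) finite_level[OF k(1)] in auto)
    also have "\<dots> = (\<Sum>(j, l)\<in>level n k (card S). (if (card S, j, l) \<in> \<Omega> then u (card S, j, l) else 0) *\<^sub>R cell n k S j l)"
      by (subst sum.reindex) (auto simp: inj_on_def intro!: sum.cong)
    finally show ?thesis .
  qed
  \<comment> \<open>The trace of every cell against \<open>M T\<close> is nonnegative, so comparing
    coefficients suffices. Inside \<open>\<Omega>\<close> detailed balance transposes the rate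
    condition; outside it the coefficient of \<open>M S\<close> is \<open>0\<close> and that of
    \<open>N S\<close> is nonnegative.\<close>
  have NM: "real n * r * trace n (M S * M T) \<le> trace n (N S * M T)" if ST: "S \<in> ?V" "T \<in> ?V" for S T
  proof -
    have tr: "trace n ((\<Sum>(j, l)\<in>level n k (card S). f j l *\<^sub>R cell n k S j l) * M T)
        = (\<Sum>(j, l)\<in>level n k (card S). f j l * trace n (cell n k S j l * M T))" for f
      by (simp add: sum_distrib_right split_def)
    have "real n * r * (if (card S, j, l) \<in> \<Omega> then u (card S, j, l) else 0) * trace n (cell n k S j l * M T)
        \<le> real n * (\<Sum>\<omega>\<in>\<Omega>. u \<omega> * weight n k (card S, j, l) \<omega>) * trace n (cell n k S j l * M T)"
      if jl: "(j, l) \<in> level n k (card S)" for j l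
    proof (rule mult_right_mono)
      let ?\<nu> = "(card S, j, l)"
      have v: "valid n k ?\<nu>" using jl by (simp add: level_def)
      have "trace n (cell n k S j l * M T) = (\<Sum>\<omega>\<in>\<Omega>. u \<omega> * trace n (?c S ?\<nu> * ?c T \<omega>))"
        unfolding M_def sum_distrib_left by simp
      also have "\<dots> \<ge> 0"
        using ST \<Omega>(3) v by (intro sum_nonneg mult_nonneg_nonneg cells less_imp_le[OF upos]) auto
      finally show "0 \<le> trace n (cell n k S j l * M T)" .
      show "real n * r * (if ?\<nu> \<in> \<Omega> then u ?\<nu> else 0) \<le> real n * (\<Sum>\<omega>\<in>\<Omega>. u \<omega> * weight n k ?\<nu> \<omega>)"
      proof (cases "?\<nu> \<in> \<Omega>")
        case True
        have "u \<omega> * weight n k ?\<nu> \<omega> = weight n k \<omega> ?\<nu> * w \<omega> / D ?\<nu>" if "\<omega> \<in> \<Omega>" for \<omega>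
        proof -
          have "D \<omega> * weight n k \<omega> ?\<nu> = D ?\<nu> * weight n k ?\<nu> \<omega>"
            unfolding D_def using detailed_balance[OF k _ v] \<Omega>(3) that by blast
          then have "weight n k ?\<nu> \<omega> = D \<omega> * weight n k \<omega> ?\<nu> / D ?\<nu>" using Dpos[OF True] by (simp add: field_simps)
          then show ?thesis using Dpos[OF that] by (simp add: u_def)
        qed
        then have "(\<Sum>\<omega>\<in>\<Omega>. u \<omega> * weight n k ?\<nu> \<omega>) = (\<Sum>\<omega>\<in>\<Omega>. weight n k \<omega> ?\<nu> * w \<omega>) / D ?\<nu>"
          unfolding sum_divide_distrib by (intro sum.cong refl) auto
        also have "\<dots> \<ge> r * w ?\<nu> / D ?\<nu>" using rate[OF True] Dpos[OF True] by (simp add: divide_right_mono)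
        finally have "r * u ?\<nu> \<le> (\<Sum>\<omega>\<in>\<Omega>. u \<omega> * weight n k ?\<nu> \<omega>)" by (simp add: u_def)
        from mult_left_mono[OF this, of "real n"] show ?thesis using True by (simp add: mult.assoc)
      next
        case False
        have "card S \<le> n" using v valid_range[OF k(1)] by blast
        then have "0 \<le> (\<Sum>\<omega>\<in>\<Omega>. u \<omega> * weight n k ?\<nu> \<omega>)"
          by (intro sum_nonneg mult_nonneg_nonneg weight_nonneg less_imp_le[OF upos])
        then show ?thesis using False by simp
      qed
    qed
    then show ?thesis
      unfolding N[OF ST(1)] M_level[of S] tr sum_distrib_left
      by (intro sum_mono) (auto simp: mult_ac)
  qed
  define F where "F x y = (\<Sum>S\<in>?V. (chi S x * chi S y) *\<^sub>R M S)" for x y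
  define G where "G x y = trace n (F x y * F x y)" for x y
  have Gpos: "0 \<le> G x y" for x y
    unfolding G_def F_def by (intro trace_square_nonneg symmetric_op_sum symmetric_op_scaleR symM)
  have G: "G x y = (\<Sum>S\<in>?V. \<Sum>T\<in>?V. ?e x y S T * trace n (M S * M T))" for x y
    unfolding G_def F_def sum_product by (simp add: mult_ac)
  define Q where "Q S T = (\<Sum>x\<in>C. chi S x * chi T x)" for S T
  \<comment> \<open>Summing over both code words produces a square. This nonnegative weight allows
    \<open>NM\<close> to be applied to each pair \<open>S\<close>, \<open>T\<close>
    separately.\<close>
  have Q2: "(\<Sum>x\<in>C. \<Sum>y\<in>C. ?e x y S T) = (Q S T)\<^sup>2" for S T
    unfolding Q_def power2_eq_square sum_product by (simp add: mult_ac)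
  have sumG: "(\<Sum>x\<in>C. \<Sum>y\<in>C. G x y) = (\<Sum>S\<in>?V. \<Sum>T\<in>?V. (Q S T)\<^sup>2 * trace n (M S * M T))"
  proof -
    have "(\<Sum>x\<in>C. \<Sum>y\<in>C. G x y) = (\<Sum>S\<in>?V. \<Sum>T\<in>?V. \<Sum>x\<in>C. \<Sum>y\<in>C. ?e x y S T * trace n (M S * M T))"
      unfolding G by (rule sum_swap_pairs)
    then show ?thesis unfolding Q2[symmetric] sum_distrib_right .
  qed
  \<comment> \<open>Multiplication by \<open>x t * y t\<close> flips \<open>t\<close> in the index
    of the character; reindexing moves the flip to \<open>M\<close>, and the sum over
    \<open>t\<close> becomes \<open>N S\<close>.\<close>
  have ipG: "?ip x y * G x y
      = (\<Sum>S\<in>?V. \<Sum>T\<in>?V. ?e x y S T * trace n (N S * M T))" if xy: "x \<in> C" "y \<in> C" for x y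
  proof -
    have W: "x \<in> words n" "y \<in> words n" using xy C by auto
    have "?ip x y * G x y
      = (\<Sum>t<n. \<Sum>S\<in>?V. chi (flip t S) x * chi (flip t S) y * ?q x y (M S))"
      unfolding G sum_distrib_right
    proof (intro sum.cong refl)
      fix t assume t: "t \<in> {..<n}"
      have "real_of_int (x t) * real_of_int (y t) * (\<Sum>S\<in>?V. \<Sum>T\<in>?V. ?e x y S T * trace n (M S * M T))
        = (\<Sum>S\<in>?V. (real_of_int (x t) * chi S x) * (real_of_int (y t) * chi S y) * ?q x y (M S))"
        by (simp add: sum_distrib_left mult_ac)
      also have "\<dots> = (\<Sum>S\<in>?V. chi (flip t S) x * chi (flip t S) y * ?q x y (M S))"
        using chi_flip[OF W(1)] chi_flip[OF W(2)] t by (intro sum.cong refl) auto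
      finally show "real_of_int (x t) * real_of_int (y t) * (\<Sum>S\<in>?V. \<Sum>T\<in>?V. ?e x y S T * trace n (M S * M T))
        = (\<Sum>S\<in>?V. chi (flip t S) x * chi (flip t S) y * ?q x y (M S))" .
    qed
    also have "\<dots> = (\<Sum>t<n. \<Sum>S\<in>?V. chi S x * chi S y * ?q x y (M (flip t S)))"
    proof (rule sum.cong[OF refl])
      fix t assume t: "t \<in> {..<n}"
      show "(\<Sum>S\<in>?V. chi (flip t S) x * chi (flip t S) y * ?q x y (M S))
         = (\<Sum>S\<in>?V. chi S x * chi S y * ?q x y (M (flip t S)))"
        using sum_flip[of t n "\<lambda>S. chi S x * chi S y * ?q x y (M (flip t S))"] t by simp
    qed
    also have "\<dots> = (\<Sum>S\<in>?V. \<Sum>t<n. chi S x * chi S y * ?q x y (M (flip t S)))"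
      by (rule sum.swap)
    also have "\<dots> = (\<Sum>S\<in>?V. \<Sum>T\<in>?V. ?e x y S T * trace n (N S * M T))"
    proof (rule sum.cong[OF refl])
      fix S
      have "(\<Sum>t<n. chi S x * chi S y * ?q x y (M (flip t S)))
        = (\<Sum>T\<in>?V. \<Sum>t<n. chi S x * chi S y * (chi T x * chi T y * trace n (M (flip t S) * M T)))"
        unfolding sum_distrib_left by (rule sum.swap)
      also have "\<dots> = (\<Sum>T\<in>?V. ?e x y S T * trace n (N S * M T))"
        unfolding N_def sum_distrib_right trace_simps sum_distrib_left by (simp only: mult.assoc)
      finally show "(\<Sum>t<n. chi S x * chi S y * ?q x y (M (flip t S)))
        = (\<Sum>T\<in>?V. ?e x y S T * trace n (N S * M T))" .
    qed
    finally show ?thesis .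
  qed
  have sumipG: "(\<Sum>x\<in>C. \<Sum>y\<in>C. ?ip x y * G x y)
      = (\<Sum>S\<in>?V. \<Sum>T\<in>?V. (Q S T)\<^sup>2 * trace n (N S * M T))"
  proof -
    have "(\<Sum>x\<in>C. \<Sum>y\<in>C. ?ip x y * G x y)
       = (\<Sum>x\<in>C. \<Sum>y\<in>C. \<Sum>S\<in>?V. \<Sum>T\<in>?V. ?e x y S T * trace n (N S * M T))"
      by (intro sum.cong refl ipG)
    also have "\<dots> = (\<Sum>S\<in>?V. \<Sum>T\<in>?V. \<Sum>x\<in>C. \<Sum>y\<in>C. ?e x y S T * trace n (N S * M T))"
      by (rule sum_swap_pairs)
    finally show ?thesis unfolding Q2[symmetric] sum_distrib_right .
  qed
  define H where "H = (\<Sum>x\<in>C. \<Sum>y\<in>C. (?ip x y - real n * s) * G x y)"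
  have ns: "real n * s = real n - 2 * real d" using k(2) by (simp add: s field_simps)
  let ?W2 = "\<Sum>\<omega>\<in>\<Omega>. (w \<omega>)\<^sup>2 / D \<omega>" and ?W = "\<Sum>\<omega>\<in>\<Omega>. w \<omega>"
  have upper: "H \<le> real (card C) * (real n * (1 - s) * (?W\<^sup>2 / ?d\<^sup>2 * \<tau>))"
  proof -
    have diag: "G x x = ?W\<^sup>2 / ?d\<^sup>2 * \<tau>" if "x \<in> C" for x
    proof -
      have "x \<in> words n" using that C by auto
      then have "F x x = (\<Sum>S\<in>?V. M S)"
        unfolding F_def by (intro sum.cong refl) (simp add: chi_square)
      also have "\<dots> = (\<Sum>\<omega>\<in>\<Omega>. u \<omega> *\<^sub>R (\<Sum>S\<in>?V. ?c S \<omega>))"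
        unfolding M_def scaleR_sum_right by (rule sum.swap)
      also have "\<dots> = (\<Sum>\<omega>\<in>\<Omega>. (w \<omega> / ?d) *\<^sub>R ?p)"
      proof (intro sum.cong refl)
        fix \<omega> assume \<omega>: "\<omega> \<in> \<Omega>"
        have "u \<omega> * (D \<omega> / ?d) = w \<omega> / ?d" using Dpos[OF \<omega>] by (simp add: u_def)
        then show "u \<omega> *\<^sub>R (\<Sum>S\<in>?V. ?c S \<omega>) = (w \<omega> / ?d) *\<^sub>R ?p"
          using sum_layer_cells[OF k, of \<omega>] \<Omega>(3) \<omega> by (simp add: D_def)
      qed
      also have "\<dots> = (?W / ?d) *\<^sub>R ?p"
        by (simp only: scaleR_sum_left sum_divide_distrib)
      finally have F: "F x x = (?W / ?d) *\<^sub>R ?p" .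
      have "?p * ?p = ?p" using proj_mult[of "{..<n}" k k] k by simp
      then show ?thesis unfolding G_def F \<tau>_def by (simp add: power2_eq_square)
    qed
    \<comment> \<open>For distinct code words the inner product is at most
      \<open>n - 2 * d = n * s\<close>, so off-diagonal terms are nonpositive.\<close>
    have "H \<le> (\<Sum>x\<in>C. \<Sum>y\<in>C. if x = y then real n * (1 - s) * G x x else 0)"
      unfolding H_def
    proof (intro sum_mono)
      fix x y assume xy: "x \<in> C" "y \<in> C"
      have ip: "?ip x y = real n - 2 * real (hamming n x y)"
        using xy C by (intro inner_product_hamming) auto
      show "(?ip x y - real n * s) * G x y \<le> (if x = y then real n * (1 - s) * G x x else 0)"
      proof (cases "x = y")
        case True
        then show ?thesis unfolding ip by (simp add: hamming_def algebra_simps)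
      next
        case False
        then have "real d \<le> real (hamming n x y)" using C(2) xy by simp
        then have "(real n - 2 * real (hamming n x y) - real n * s) * G x y \<le> 0"
          unfolding ns using Gpos by (intro mult_nonpos_nonneg) auto
        then show ?thesis unfolding ip using False by simp
      qed
    qed
    also have "\<dots> = (\<Sum>x\<in>C. real n * (1 - s) * G x x)" using finC by simp
    also have "\<dots> = real (card C) * (real n * (1 - s) * (?W\<^sup>2 / ?d\<^sup>2 * \<tau>))" by (simp add: diag)
    finally show ?thesis .
  qed
  \<comment> \<open>The terms with \<open>T \<noteq> S\<close>, and within \<open>M S\<close> those
    with two different triples, are nonnegative and are dropped. What remains is explicit, since
    \<open>Q S S\<close> is the size of the code.\<close>
  have lower: "real n * (r - s) * ((real (card C))\<^sup>2 * (?W2 / ?d * \<tau>)) \<le> H"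
  proof -
    have "(real (card C))\<^sup>2 * (?W2 / ?d * \<tau>) \<le> (real (card C))\<^sup>2 * (\<Sum>S\<in>?V. trace n (M S * M S))"
    proof (rule mult_left_mono)
      have "?W2 / ?d * \<tau> = (\<Sum>\<omega>\<in>\<Omega>. (u \<omega>)\<^sup>2 * (D \<omega> / ?d * \<tau>))"
        unfolding sum_divide_distrib sum_distrib_right
        using Dpos by (intro sum.cong refl) (simp add: u_def power2_eq_square)
      also have "\<dots> = (\<Sum>\<omega>\<in>\<Omega>. (u \<omega>)\<^sup>2 * trace n (\<Sum>S\<in>?V. ?c S \<omega>))"
        using sum_layer_cells[OF k] \<Omega>(3) by (intro sum.cong refl) (simp add: D_def \<tau>_def del: trace_simps(4))
      also have "\<dots> = (\<Sum>S\<in>?V. \<Sum>\<omega>\<in>\<Omega>. (u \<omega>)\<^sup>2 * trace n (?c S \<omega>))"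
        unfolding trace_simps(4) sum_distrib_left by (rule sum.swap)
      also have "\<dots> \<le> (\<Sum>S\<in>?V. trace n (M S * M S))"
      proof (rule sum_mono)
        fix S assume S: "S \<in> ?V"
        have "(\<Sum>\<omega>\<in>\<Omega>. (u \<omega>)\<^sup>2 * trace n (?c S \<omega>)) = (\<Sum>\<omega>\<in>\<Omega>. u \<omega> * u \<omega> * trace n (?c S \<omega> * ?c S \<omega>))"
          using S \<Omega>(3) layer_cell_idem[OF k(1)] by (intro sum.cong refl) (auto simp: power2_eq_square)
        also have "\<dots> \<le> trace n (M S * M S)"
          unfolding MM
        proof (rule sum_mono)
          fix \<omega> assume \<omega>: "\<omega> \<in> \<Omega>"
          have "0 \<le> u \<omega> * u \<nu> * trace n (?c S \<omega> * ?c S \<nu>)" if "\<nu> \<in> \<Omega>" for \<nu>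
            using S \<Omega>(3) \<omega> that by (intro mult_nonneg_nonneg cells less_imp_le[OF upos]) auto
          then show "u \<omega> * u \<omega> * trace n (?c S \<omega> * ?c S \<omega>)
              \<le> (\<Sum>\<nu>\<in>\<Omega>. u \<omega> * u \<nu> * trace n (?c S \<omega> * ?c S \<nu>))"
            using \<Omega>(1) \<omega> by (intro member_le_sum) auto
        qed
        finally show "(\<Sum>\<omega>\<in>\<Omega>. (u \<omega>)\<^sup>2 * trace n (?c S \<omega>)) \<le> trace n (M S * M S)" .
      qed
      finally show "?W2 / ?d * \<tau> \<le> (\<Sum>S\<in>?V. trace n (M S * M S))" .
    qed simp
    also have "\<dots> = (\<Sum>S\<in>?V. (Q S S)\<^sup>2 * trace n (M S * M S))"
      unfolding sum_distrib_left
    proof (intro sum.cong refl)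
      fix S assume "S \<in> ?V"
      then have "Q S S = real (card C)" unfolding Q_def using C(1) chi_square by (subst sum.cong[OF refl, of _ _ "\<lambda>_. 1"]) auto
      then show "(real (card C))\<^sup>2 * trace n (M S * M S) = (Q S S)\<^sup>2 * trace n (M S * M S)" by simp
    qed
    also have "\<dots> \<le> (\<Sum>S\<in>?V. \<Sum>T\<in>?V. (Q S T)\<^sup>2 * trace n (M S * M T))"
    proof (rule sum_mono)
      fix S assume S: "S \<in> ?V"
      have "0 \<le> (Q S T)\<^sup>2 * trace n (M S * M T)" if "T \<in> ?V" for T
        using MMpos[OF S that] by simp
      then show "(Q S S)\<^sup>2 * trace n (M S * M S) \<le> (\<Sum>T\<in>?V. (Q S T)\<^sup>2 * trace n (M S * M T))"
        using S by (intro member_le_sum) auto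
    qed
    finally have 1: "(real (card C))\<^sup>2 * (?W2 / ?d * \<tau>) \<le> (\<Sum>S\<in>?V. \<Sum>T\<in>?V. (Q S T)\<^sup>2 * trace n (M S * M T))" (is "_ \<le> ?E") .
    have "real n * r * ?E \<le> (\<Sum>S\<in>?V. \<Sum>T\<in>?V. (Q S T)\<^sup>2 * trace n (N S * M T))"
      unfolding sum_distrib_left
    proof (intro sum_mono)
      fix S T assume "S \<in> ?V" "T \<in> ?V"
      from mult_left_mono[OF NM[OF this], of "(Q S T)\<^sup>2"]
      show "real n * r * ((Q S T)\<^sup>2 * trace n (M S * M T)) \<le> (Q S T)\<^sup>2 * trace n (N S * M T)"
        by (simp add: mult_ac)
    qed
    moreover have "H = (\<Sum>S\<in>?V. \<Sum>T\<in>?V. (Q S T)\<^sup>2 * trace n (N S * M T)) - real n * s * ?E"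
      unfolding H_def left_diff_distrib sum_subtractf sumipG sumG[symmetric] sum_distrib_left ..
    ultimately have "real n * (r - s) * ?E \<le> H" by (simp add: algebra_simps)
    moreover have "real n * (r - s) * ((real (card C))\<^sup>2 * (?W2 / ?d * \<tau>)) \<le> real n * (r - s) * ?E"
      using rs by (intro mult_left_mono[OF 1]) simp
    ultimately show ?thesis by simp
  qed
  have W2pos: "0 < ?W2"
    using \<Omega>(1,2) by (intro sum_pos divide_pos_pos Dpos zero_less_power w) auto
  have s1: "0 \<le> 1 - s" using k(2) by (simp add: s)
  have pd: "profile_dim n \<Omega> w = ?W\<^sup>2 / ?W2" by (simp add: profile_dim_def D_def)
  show ?thesis
  proof (cases "card C = 0")
    case True
    then show ?thesis using s1 dpos rs W2pos by (simp add: pd)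
  next
    case False
    then have c: "0 < real (card C)" by simp
    have "real n * (r - s) * ((real (card C))\<^sup>2 * (?W2 / ?d * \<tau>)) \<le> real (card C) * (real n * (1 - s) * (?W\<^sup>2 / ?d\<^sup>2 * \<tau>))"
      using lower upper by linarith
    \<comment> \<open>The common factor isolated here contains the trace \<open>\<tau>\<close>, so
      its actual value cancels.\<close>
    then have "(real (card C) * (?d * (r - s)) * ?W2) * (real (card C) * real n * \<tau> / ?d\<^sup>2) \<le> ((1 - s) * ?W\<^sup>2) * (real (card C) * real n * \<tau> / ?d\<^sup>2)"
      using dpos by (simp add: power2_eq_square mult_ac)
    moreover have "0 < real (card C) * real n * \<tau> / ?d\<^sup>2" using c k(2) \<tau>pos dpos by simp
    ultimately have "real (card C) * (?d * (r - s)) * ?W2 \<le> (1 - s) * ?W\<^sup>2"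
      by (simp only: mult_le_cancel_right_pos)
    then have le: "real (card C) * (?d * (r - s) * ?W2) \<le> (1 - s) * ?W\<^sup>2" by (simp only: mult.assoc)
    have pos: "0 < ?d * (r - s) * ?W2" using dpos rs W2pos by (intro mult_pos_pos) auto
    show ?thesis unfolding pd times_divide_times_eq pos_le_divide_eq[OF pos] by (rule le)
  qed
qed

lemma A2_bound:
  assumes "\<And>C. C \<subseteq> words n \<Longrightarrow> (\<And>x y. x \<in> C \<Longrightarrow> y \<in> C \<Longrightarrow> x \<noteq> y \<Longrightarrow> d \<le> hamming n x y) \<Longrightarrow> real (card C) \<le> b"
  shows "real (A2 n d) \<le> b"
proof -
  let ?\<C> = "{C. C \<subseteq> words n \<and> (\<forall>x\<in>C. \<forall>y\<in>C. x \<noteq> y \<longrightarrow> d \<le> hamming n x y)}"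
  have "finite (words n)" unfolding words_def by (intro finite_PiE) auto
  then have "finite ?\<C>" by simp
  moreover have "{} \<in> ?\<C>" by simp
  ultimately have "A2 n d \<in> card ` ?\<C>" unfolding A2_def by (intro Max_in) auto
  then show ?thesis using assms by auto
qed

theorem theorem3p8:
  fixes n k d :: nat and s :: real and \<Omega> :: "triple set"
  assumes "n \<ge> 1" and "2 * k \<le> n" and "1 \<le> d" and "2 * d \<le> n"
    and "s = 1 - 2 * real d / real n"
    and "finite \<Omega>" and "\<Omega> \<noteq> {}" and "\<forall>\<omega>\<in>\<Omega>. valid n k \<omega>" and "box_connected n k \<Omega>"
  shows "(\<forall>w. positive_profile \<Omega> w \<and> profile_rate n k \<Omega> w > s \<longrightarrow>
            real (A2 n d) \<le>
              (1 - s) / (real (specht_dim [n - k, k]) * (profile_rate n k \<Omega> w - s))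
                * profile_dim n \<Omega> w)
       \<and> (\<forall>v. positive_unit_perron n k \<Omega> v \<and> J_lambda_max n k \<Omega> > s \<longrightarrow>
            real (A2 n d) \<le>
              (1 - s) / (real (specht_dim [n - k, k]) * (J_lambda_max n k \<Omega> - s))
                * (\<Sum>\<omega>\<in>\<Omega>. sqrt (mult_dim n \<omega>) * v \<omega>)\<^sup>2
          \<and> (1 - s) / (real (specht_dim [n - k, k]) * (J_lambda_max n k \<Omega> - s))
                * (\<Sum>\<omega>\<in>\<Omega>. sqrt (mult_dim n \<omega>) * v \<omega>)\<^sup>2
              \<le> (1 - s) / (real (specht_dim [n - k, k]) * (J_lambda_max n k \<Omega> - s))
                * (\<Sum>\<omega>\<in>\<Omega>. mult_dim n \<omega>))"
proof (intro conjI allI impI)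
  let ?K = "\<lambda>x. (1 - s) / (real (specht_dim [n - k, k]) * (x - s))"
  have n0: "0 < n" using assms(1) by simp
  fix w assume "positive_profile \<Omega> w \<and> profile_rate n k \<Omega> w > s"
  then have w: "\<And>\<omega>. \<omega> \<in> \<Omega> \<Longrightarrow> 0 < w \<omega>" and r: "s < profile_rate n k \<Omega> w"
    by (auto simp: positive_profile_def)
  show "real (A2 n d) \<le> ?K (profile_rate n k \<Omega> w) * profile_dim n \<Omega> w"
  proof (rule A2_bound, rule code_bound[OF assms(2) n0 assms(4-8) w _ r])
    fix \<nu> assume \<nu>: "\<nu> \<in> \<Omega>"
    then have "profile_rate n k \<Omega> w \<le> (\<Sum>\<omega>\<in>\<Omega>. weight n k \<omega> \<nu> * w \<omega>) / w \<nu>"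
      unfolding profile_rate_def using assms(6) by (intro Min_le) auto
    then show "profile_rate n k \<Omega> w * w \<nu> \<le> (\<Sum>\<omega>\<in>\<Omega>. weight n k \<omega> \<nu> * w \<omega>)"
      using w[OF \<nu>] by (simp add: pos_le_divide_eq)
  qed
next
  have n0: "0 < n" using assms(1) by simp
  fix v assume pv: "positive_unit_perron n k \<Omega> v \<and> J_lambda_max n k \<Omega> > s"
  let ?K = "\<lambda>x. (1 - s) / (real (specht_dim [n - k, k]) * (x - s))"
    and ?\<Lambda> = "J_lambda_max n k \<Omega>" and ?D = "mult_dim n"
  have Dpos: "0 < ?D \<omega>" if "\<omega> \<in> \<Omega>" for \<omega> using mult_dim_pos[OF assms(2)] assms(8) that by auto
  have vpos: "0 < v \<omega>" if "\<omega> \<in> \<Omega>" for \<omega> using pv that by (auto simp: positive_unit_perron_def)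
  have unit: "(\<Sum>\<omega>\<in>\<Omega>. (v \<omega>)\<^sup>2) = 1" using pv by (auto simp: positive_unit_perron_def)
  have eig: "(\<Sum>\<nu>\<in>\<Omega>. J n k \<omega> \<nu> * v \<nu>) = ?\<Lambda> * v \<omega>" if "\<omega> \<in> \<Omega>" for \<omega>
    using pv that by (auto simp: positive_unit_perron_def J_eigenpair_def)
  \<comment> \<open>Conjugation by the square roots of the dimensions turns the weight matrix into
    \<open>J\<close>. For this profile the rate condition holds with equality, and the denominator
    of \<open>profile_dim\<close> is the squared norm of \<open>v\<close>.\<close>
  define w where "w \<omega> = sqrt (?D \<omega>) * v \<omega>" for \<omega>
  have pd: "profile_dim n \<Omega> w = (\<Sum>\<omega>\<in>\<Omega>. sqrt (?D \<omega>) * v \<omega>)\<^sup>2"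
  proof -
    have "(\<Sum>\<omega>\<in>\<Omega>. (w \<omega>)\<^sup>2 / ?D \<omega>) = (\<Sum>\<omega>\<in>\<Omega>. (v \<omega>)\<^sup>2)"
      using Dpos by (intro sum.cong refl) (simp add: w_def power_mult_distrib less_imp_le less_imp_neq[symmetric])
    then show ?thesis unfolding profile_dim_def unit by (simp add: w_def)
  qed
  have "real (A2 n d) \<le> ?K ?\<Lambda> * profile_dim n \<Omega> w"
  proof (rule A2_bound, rule code_bound[OF assms(2) n0 assms(4-8)])
    show "s < ?\<Lambda>" using pv by simp
    show "0 < w \<omega>" if "\<omega> \<in> \<Omega>" for \<omega> using Dpos[OF that] vpos[OF that] by (simp add: w_def)
    fix \<nu> assume \<nu>: "\<nu> \<in> \<Omega>"
    have "weight n k \<omega> \<nu> * w \<omega> = sqrt (?D \<nu>) * (J n k \<nu> \<omega> * v \<omega>)" if \<omega>: "\<omega> \<in> \<Omega>" for \<omega>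
    proof -
      have nn: "0 \<le> weight n k \<omega> \<nu>"
      proof -
        obtain i j l where "\<omega> = (i, j, l)" by (cases \<omega>)
        then show ?thesis using weight_nonneg[of i n k j l \<nu>] valid_range(1)[OF assms(2), of i j l] assms(8) \<omega> by auto
      qed
      have "?D \<nu> * (weight n k \<nu> \<omega> * weight n k \<omega> \<nu>) = ?D \<omega> * (weight n k \<omega> \<nu>)\<^sup>2"
        using detailed_balance[OF assms(2) n0, of \<nu> \<omega>] assms(8) \<nu> \<omega> by (simp add: power2_eq_square)
      then have "sqrt (?D \<nu>) * J n k \<nu> \<omega> = sqrt (?D \<omega>) * weight n k \<omega> \<nu>"
        unfolding J_def real_sqrt_mult[symmetric] using nn by (simp add: real_sqrt_mult)
      then show ?thesis by (simp add: w_def mult_ac)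
    qed
    then have "(\<Sum>\<omega>\<in>\<Omega>. weight n k \<omega> \<nu> * w \<omega>) = sqrt (?D \<nu>) * (\<Sum>\<omega>\<in>\<Omega>. J n k \<nu> \<omega> * v \<omega>)"
      unfolding sum_distrib_left by (intro sum.cong refl) auto
    also have "\<dots> = ?\<Lambda> * w \<nu>" unfolding eig[OF \<nu>] w_def by simp
    finally show "?\<Lambda> * w \<nu> \<le> (\<Sum>\<omega>\<in>\<Omega>. weight n k \<omega> \<nu> * w \<omega>)" by simp
  qed
  then show "real (A2 n d) \<le> ?K ?\<Lambda> * (\<Sum>\<omega>\<in>\<Omega>. sqrt (?D \<omega>) * v \<omega>)\<^sup>2"
    unfolding pd .
  define b where "b = (\<Sum>\<omega>\<in>\<Omega>. sqrt (?D \<omega>) * v \<omega>)"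
  \<comment> \<open>Cauchy-Schwarz as a sum of squares: \<open>b\<close> is the coefficient of the
    orthogonal projection onto the unit vector \<open>v\<close>.\<close>
  have "0 \<le> (\<Sum>\<omega>\<in>\<Omega>. (sqrt (?D \<omega>) - b * v \<omega>)\<^sup>2)" by (intro sum_nonneg) simp
  also have "\<dots> = (\<Sum>\<omega>\<in>\<Omega>. ?D \<omega> - 2 * b * (sqrt (?D \<omega>) * v \<omega>) + b\<^sup>2 * (v \<omega>)\<^sup>2)"
    using Dpos by (intro sum.cong refl) (simp add: power2_diff power_mult_distrib less_imp_le mult_ac)
  also have "\<dots> = (\<Sum>\<omega>\<in>\<Omega>. ?D \<omega>) - b\<^sup>2"
    unfolding sum.distrib sum_subtractf sum_distrib_left[symmetric] unit b_def[symmetric]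
    by (simp add: power2_eq_square)
  finally have "(\<Sum>\<omega>\<in>\<Omega>. sqrt (?D \<omega>) * v \<omega>)\<^sup>2 \<le> (\<Sum>\<omega>\<in>\<Omega>. ?D \<omega>)" unfolding b_def by simp
  moreover have "0 \<le> ?K ?\<Lambda>"
    using pv assms(5) n0 by (auto intro!: divide_nonneg_nonneg mult_nonneg_nonneg)
  ultimately show "?K ?\<Lambda> * (\<Sum>\<omega>\<in>\<Omega>. sqrt (?D \<omega>) * v \<omega>)\<^sup>2
      \<le> ?K ?\<Lambda> * (\<Sum>\<omega>\<in>\<Omega>. ?D \<omega>)"
    by (rule mult_left_mono)
qed

end
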